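(* Let $u\in\mathcal{W}(I)$ be the solution of the unsteady heat equation $\partial_tu(t)+(-\Delta)u(t)=f(t)$ in $V^*$ for a.e. $t\in I$, $u(0)=u_0$ in $H$, with $f\in L^2(I;V^* )$ and $u_0\in H$. Then, for every $v\in\mathcal{W}(I)$ with $v(0)=u_0$ in $H$, $$\begin{aligned}&\tfrac12\|\nabla(v-u)\|_Q^2+\tfrac12\|\partial_t(v-u)\|_{L^2(I;V^* )}^2+\tfrac12\|(v-u)(T)\|_H^2\\&\qquad=\inf\bigl\{\tfrac12\|y-\nabla v\|_Q^2\;\bigm|\;y\in L^2(I;Y^* ),\ L^*y=f-\partial_tv\text{ in }L^2(I;V^* )\bigr\}\\&\qquad=\tfrac12\|\partial_tv+(-\Delta)v-f\|_{L^2(I;V^* )}^2 .\end{aligned}$$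
   Context: $\Omega\subseteq\mathbb{R}^d$ is a bounded Lipschitz domain with boundary split into disjoint relatively open sets $\Gamma_D\ne\emptyset$ and $\Gamma_N$, $\overline\Gamma_D\cup\overline\Gamma_N=\partial\Omega$; $I=(0,T)$, $0<T<\infty$; $Q=I\times\Omega$. $V=W^{1,2}_D(\Omega)$ (zero trace on $\Gamma_D$) with norm $\|v\|_V=\|\nabla v\|_{L^2(\Omega)}$, $V^*$ with the dual norm, $H=L^2(\Omega)$, $Y=Y^*=L^2(\Omega;\mathbb{R}^d)$. $V\hookrightarrow H\cong H^*\hookrightarrow V^*$ is the usual evolution triple and $\mathcal{W}(I)=\{v\in L^2(I;V)\mid\partial_tv\in L^2(I;V^* )\}\hookrightarrow C^0(\overline I;H)$. $L=\nabla\colon V\to Y$, and $L^*\colon Y^*\to V^*$ is its adjoint, $\langle L^*y,v\rangle_V=\int_\Omega y\cdot\nabla v\,dx$; $-\Delta=L^*\circ\nabla\colon V\to V^*$. Operators act pointwise in time. $\|\cdot\|_Q$ is the $L^2(Q)$-norm. *)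

theory Defs
  imports "HOL-Analysis.Analysis"
begin

(* Elements of L^2, W^{1,2} etc. are represented by functions; equality in these spaces is
   equality almost everywhere. The value of such a function outside the domain is irrelevant. *)

section \<open>Lebesgue and Sobolev spaces\<close>

definition L2_space :: "'a measure \<Rightarrow> ('a \<Rightarrow> 'b::euclidean_space) set" where
  "L2_space M = {f. f \<in> borel_measurable M \<and> integrable M (\<lambda>x. (norm (f x))\<^sup>2)}"

definition L2_norm :: "'a measure \<Rightarrow> ('a \<Rightarrow> 'b::euclidean_space) \<Rightarrow> real" where
  "L2_norm M f = sqrt (LINT x|M. (norm (f x))\<^sup>2)"

primrec Ck :: "nat \<Rightarrow> ('a::euclidean_space \<Rightarrow> real) \<Rightarrow> bool" where
  "Ck 0 f \<longleftrightarrow> continuous_on UNIV f"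
| "Ck (Suc k) f \<longleftrightarrow> (\<forall>x. f differentiable (at x)) \<and>
     (\<forall>i\<in>Basis. Ck k (\<lambda>x. frechet_derivative f (at x) i))"

(* C_c^infinity(U), extended by zero *)
definition test_functions :: "'a::euclidean_space set \<Rightarrow> ('a \<Rightarrow> real) set" where
  "test_functions U = {\<phi>. (\<forall>k. Ck k \<phi>) \<and>
     compact (closure {x. \<phi> x \<noteq> 0}) \<and> closure {x. \<phi> x \<noteq> 0} \<subseteq> U}"

definition has_weak_grad ::
    "'a::euclidean_space set \<Rightarrow> ('a \<Rightarrow> real) \<Rightarrow> ('a \<Rightarrow> 'a) \<Rightarrow> bool" where
  "has_weak_grad \<Omega> f g \<longleftrightarrow> f \<in> L2_space (lebesgue_on \<Omega>) \<and> g \<in> L2_space (lebesgue_on \<Omega>) \<and>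
     (\<forall>\<phi>\<in>test_functions \<Omega>. \<forall>i\<in>Basis.
        (LINT x|lebesgue_on \<Omega>. f x * frechet_derivative \<phi> (at x) i)
          = - (LINT x|lebesgue_on \<Omega>. (g x \<bullet> i) * \<phi> x))"

definition W12 :: "'a::euclidean_space set \<Rightarrow> ('a \<Rightarrow> real) set" where
  "W12 \<Omega> = {f. \<exists>g. has_weak_grad \<Omega> f g}"

(* unique almost everywhere in \<Omega> *)
definition wgrad :: "'a::euclidean_space set \<Rightarrow> ('a \<Rightarrow> real) \<Rightarrow> 'a \<Rightarrow> 'a" where
  "wgrad \<Omega> f = (SOME g. has_weak_grad \<Omega> f g)"

section \<open>Lipschitz domains, surface measure and traces\<close>

(* Near each boundary point, \<Omega> is the strict epigraph, in the direction of a unit vector e,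
   of a Lipschitz function on the hyperplane orthogonal to e. *)
definition bounded_lipschitz_domain :: "'a::euclidean_space set \<Rightarrow> bool" where
  "bounded_lipschitz_domain \<Omega> \<longleftrightarrow> open \<Omega> \<and> connected \<Omega> \<and> bounded \<Omega> \<and> \<Omega> \<noteq> {} \<and>
     (\<forall>x\<in>frontier \<Omega>. \<exists>U e L \<gamma>. open U \<and> x \<in> U \<and> norm e = 1 \<and>
        L-lipschitz_on {z. z \<bullet> e = 0} \<gamma> \<and>
        \<Omega> \<inter> U = {y \<in> U. \<gamma> (y - (y \<bullet> e) *\<^sub>R e) < y \<bullet> e})"

definition hausdorff_pre :: "nat \<Rightarrow> real \<Rightarrow> 'a::euclidean_space set \<Rightarrow> ennreal" where
  "hausdorff_pre s \<delta> A =
     (INF U \<in> {U :: nat \<Rightarrow> 'a set. A \<subseteq> (\<Union>i. U i) \<and> (\<forall>i. bounded (U i) \<and> diameter (U i) \<le> \<delta>)}.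
        \<Sum>i. if U i = {} then 0 else ennreal (diameter (U i) ^ s))"

definition hausdorff_outer :: "nat \<Rightarrow> 'a::euclidean_space set \<Rightarrow> ennreal" where
  "hausdorff_outer s A = (SUP \<delta>\<in>{0<..}. hausdorff_pre s \<delta> A)"

(* The (d-1)-dimensional Hausdorff measure on the boundary. The Hausdorff outer measure is countably
   additive on the Borel sets (it is a metric outer measure), so measure_of does not degenerate.
   The usual normalising constant is omitted: it affects neither null sets nor L^2 convergence. *)
definition surface_measure :: "'a::euclidean_space set \<Rightarrow> 'a measure" where
  "surface_measure \<Omega> =
     restrict_space (measure_of UNIV (sets borel) (hausdorff_outer (DIM('a) - 1))) (frontier \<Omega>)"

(* The graph of the trace operator from W^{1,2}(\<Omega>) to L^2 of the boundary: the continuous extension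
   of restriction to the boundary from the functions in W^{1,2}(\<Omega>) that are continuous on the
   closure of \<Omega>. Those restrictions are bounded, hence in L^2 as the surface measure is finite. *)
definition has_trace :: "'a::euclidean_space set \<Rightarrow> ('a \<Rightarrow> real) \<Rightarrow> ('a \<Rightarrow> real) \<Rightarrow> bool" where
  "has_trace \<Omega> v g \<longleftrightarrow> v \<in> W12 \<Omega> \<and> g \<in> L2_space (surface_measure \<Omega>) \<and>
     (\<exists>\<phi> :: nat \<Rightarrow> 'a \<Rightarrow> real.
        (\<forall>n. \<phi> n \<in> W12 \<Omega> \<and> continuous_on (closure \<Omega>) (\<phi> n) \<and>
             \<phi> n \<in> L2_space (surface_measure \<Omega>)) \<and>
        (\<lambda>n. L2_norm (lebesgue_on \<Omega>) (\<phi> n - v)) \<longlonglongrightarrow> 0 \<and>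
        (\<lambda>n. L2_norm (lebesgue_on \<Omega>) (wgrad \<Omega> (\<phi> n) - wgrad \<Omega> v)) \<longlonglongrightarrow> 0 \<and>
        (\<lambda>n. L2_norm (surface_measure \<Omega>) (\<phi> n - g)) \<longlonglongrightarrow> 0)"

section \<open>The evolution triple\<close>

definition W12_D :: "'a::euclidean_space set \<Rightarrow> 'a set \<Rightarrow> ('a \<Rightarrow> real) set" where
  "W12_D \<Omega> \<Gamma>D = {v \<in> W12 \<Omega>. \<exists>g. has_trace \<Omega> v g \<and>
     (AE x in surface_measure \<Omega>. x \<in> \<Gamma>D \<longrightarrow> g x = 0)}"

definition V_norm :: "'a::euclidean_space set \<Rightarrow> ('a \<Rightarrow> real) \<Rightarrow> real" where
  "V_norm \<Omega> v = L2_norm (lebesgue_on \<Omega>) (wgrad \<Omega> v)"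

(* Functionals are only considered on V = W12_D \<Omega> \<Gamma>D; equality in V' is equality on V. Boundedness
   forces them to respect equality almost everywhere. *)
definition V_dual :: "'a::euclidean_space set \<Rightarrow> 'a set \<Rightarrow> (('a \<Rightarrow> real) \<Rightarrow> real) set" where
  "V_dual \<Omega> \<Gamma>D = {\<xi>.
     (\<forall>z\<in>W12_D \<Omega> \<Gamma>D. \<forall>w\<in>W12_D \<Omega> \<Gamma>D. \<xi> (\<lambda>x. z x + w x) = \<xi> z + \<xi> w) \<and>
     (\<forall>c. \<forall>z\<in>W12_D \<Omega> \<Gamma>D. \<xi> (\<lambda>x. c * z x) = c * \<xi> z) \<and>
     (\<exists>C. \<forall>z\<in>W12_D \<Omega> \<Gamma>D. \<bar>\<xi> z\<bar> \<le> C * V_norm \<Omega> z)}"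

definition V_dual_norm :: "'a::euclidean_space set \<Rightarrow> 'a set \<Rightarrow> (('a \<Rightarrow> real) \<Rightarrow> real) \<Rightarrow> real" where
  "V_dual_norm \<Omega> \<Gamma>D \<xi> = (SUP z\<in>{z \<in> W12_D \<Omega> \<Gamma>D. V_norm \<Omega> z \<le> 1}. \<bar>\<xi> z\<bar>)"

(* the embedding of H = L^2(\<Omega>) into the dual V' of V *)
definition H_embed :: "'a::euclidean_space set \<Rightarrow> ('a \<Rightarrow> real) \<Rightarrow> ('a \<Rightarrow> real) \<Rightarrow> real" where
  "H_embed \<Omega> h = (\<lambda>z. LINT x|lebesgue_on \<Omega>. h x * z x)"

(* L' : Y' \<rightarrow> V', the adjoint of L = grad : V \<rightarrow> Y *)
definition grad_adj :: "'a::euclidean_space set \<Rightarrow> ('a \<Rightarrow> 'a) \<Rightarrow> ('a \<Rightarrow> real) \<Rightarrow> real" where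
  "grad_adj \<Omega> y = (\<lambda>z. LINT x|lebesgue_on \<Omega>. y x \<bullet> wgrad \<Omega> z x)"

definition neg_laplace :: "'a::euclidean_space set \<Rightarrow> ('a \<Rightarrow> real) \<Rightarrow> ('a \<Rightarrow> real) \<Rightarrow> real" where
  "neg_laplace \<Omega> v = grad_adj \<Omega> (wgrad \<Omega> v)"

section \<open>Bochner spaces and the weak time derivative\<close>

(* L^2(I;X) for a space X given by a set of representatives and a norm (a seminorm on the
   representatives). Strong measurability is the almost everywhere approximability by
   X-valued simple functions. *)
definition bochner_L2 :: "real set \<Rightarrow> 'x set \<Rightarrow> ('x \<Rightarrow> real) \<Rightarrow> (real \<Rightarrow> 'x::minus) set" where
  "bochner_L2 I X nrm = {w.
     (AE t in lebesgue_on I. w t \<in> X) \<and>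
     (\<exists>s :: nat \<Rightarrow> real \<Rightarrow> 'x.
        (\<forall>n. simple_function (lebesgue_on I) (s n) \<and> s n ` I \<subseteq> X) \<and>
        (AE t in lebesgue_on I. (\<lambda>n. nrm (s n t - w t)) \<longlonglongrightarrow> 0)) \<and>
     integrable (lebesgue_on I) (\<lambda>t. (nrm (w t))\<^sup>2)}"

definition bochner_norm :: "real set \<Rightarrow> ('x \<Rightarrow> real) \<Rightarrow> (real \<Rightarrow> 'x) \<Rightarrow> real" where
  "bochner_norm I nrm w = sqrt (LINT t|lebesgue_on I. (nrm (w t))\<^sup>2)"

abbreviation L2_V :: "'a::euclidean_space set \<Rightarrow> 'a set \<Rightarrow> real \<Rightarrow> (real \<Rightarrow> 'a \<Rightarrow> real) set" where
  "L2_V \<Omega> \<Gamma>D T \<equiv> bochner_L2 {0<..<T} (W12_D \<Omega> \<Gamma>D) (V_norm \<Omega>)"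

abbreviation L2_Vdual ::
    "'a::euclidean_space set \<Rightarrow> 'a set \<Rightarrow> real \<Rightarrow> (real \<Rightarrow> ('a \<Rightarrow> real) \<Rightarrow> real) set" where
  "L2_Vdual \<Omega> \<Gamma>D T \<equiv> bochner_L2 {0<..<T} (V_dual \<Omega> \<Gamma>D) (V_dual_norm \<Omega> \<Gamma>D)"

abbreviation L2_Y :: "'a::euclidean_space set \<Rightarrow> real \<Rightarrow> (real \<Rightarrow> 'a \<Rightarrow> 'a) set" where
  "L2_Y \<Omega> T \<equiv>
     bochner_L2 {0<..<T} (L2_space (lebesgue_on \<Omega>)) (L2_norm (lebesgue_on \<Omega>))"

(* The norm of L^2(Q), under the identification of L^2(Q) with L^2(I;L^2(\<Omega>)). *)
abbreviation Q_norm :: "'a::euclidean_space set \<Rightarrow> real \<Rightarrow> (real \<Rightarrow> 'a \<Rightarrow> 'a) \<Rightarrow> real" where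
  "Q_norm \<Omega> T \<equiv> bochner_norm {0<..<T} (L2_norm (lebesgue_on \<Omega>))"

abbreviation L2_Vdual_norm ::
    "'a::euclidean_space set \<Rightarrow> 'a set \<Rightarrow> real \<Rightarrow> (real \<Rightarrow> ('a \<Rightarrow> real) \<Rightarrow> real) \<Rightarrow> real" where
  "L2_Vdual_norm \<Omega> \<Gamma>D T \<equiv> bochner_norm {0<..<T} (V_dual_norm \<Omega> \<Gamma>D)"

(* g is the distributional derivative of v as a V'-valued function, v being viewed in V' through
   the embeddings of the evolution triple (which map L^2(I;V) into L^2(I;V')). The identity of
   V'-valued Bochner integrals is evaluated at z \<in> V. *)
definition has_time_deriv :: "'a::euclidean_space set \<Rightarrow> 'a set \<Rightarrow> real \<Rightarrow>
    (real \<Rightarrow> 'a \<Rightarrow> real) \<Rightarrow> (real \<Rightarrow> ('a \<Rightarrow> real) \<Rightarrow> real) \<Rightarrow> bool" where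
  "has_time_deriv \<Omega> \<Gamma>D T v g \<longleftrightarrow>
     (\<lambda>t. H_embed \<Omega> (v t)) \<in> L2_Vdual \<Omega> \<Gamma>D T \<and> g \<in> L2_Vdual \<Omega> \<Gamma>D T \<and>
     (\<forall>\<phi>\<in>test_functions {0<..<T}. \<forall>z\<in>W12_D \<Omega> \<Gamma>D.
        (LINT t|lebesgue_on {0<..<T}. H_embed \<Omega> (v t) z * deriv \<phi> t)
          = - (LINT t|lebesgue_on {0<..<T}. g t z * \<phi> t))"

(* unique in V' for almost every t *)
definition time_deriv :: "'a::euclidean_space set \<Rightarrow> 'a set \<Rightarrow> real \<Rightarrow>
    (real \<Rightarrow> 'a \<Rightarrow> real) \<Rightarrow> real \<Rightarrow> ('a \<Rightarrow> real) \<Rightarrow> real" where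
  "time_deriv \<Omega> \<Gamma>D T v = (SOME g. has_time_deriv \<Omega> \<Gamma>D T v g)"

definition W_space ::
    "'a::euclidean_space set \<Rightarrow> 'a set \<Rightarrow> real \<Rightarrow> (real \<Rightarrow> 'a \<Rightarrow> real) set" where
  "W_space \<Omega> \<Gamma>D T = {v \<in> L2_V \<Omega> \<Gamma>D T. \<exists>g. has_time_deriv \<Omega> \<Gamma>D T v g}"

definition continuous_rep ::
    "'a::euclidean_space set \<Rightarrow> real \<Rightarrow> (real \<Rightarrow> 'a \<Rightarrow> real) \<Rightarrow> (real \<Rightarrow> 'a \<Rightarrow> real) \<Rightarrow> bool" where
  "continuous_rep \<Omega> T v w \<longleftrightarrow>
     (\<forall>t\<in>{0..T}. w t \<in> L2_space (lebesgue_on \<Omega>) \<and>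
        ((\<lambda>s. L2_norm (lebesgue_on \<Omega>) (w s - w t)) \<longlongrightarrow> 0) (at t within {0..T})) \<and>
     (AE t in lebesgue_on {0<..<T}. AE x in lebesgue_on \<Omega>. w t x = v t x)"

(* The value v(t), for t in the closed interval [0,T], of the representative in C^0([0,T];H)
   of v \<in> W(I). *)
definition value_at ::
    "'a::euclidean_space set \<Rightarrow> real \<Rightarrow> (real \<Rightarrow> 'a \<Rightarrow> real) \<Rightarrow> real \<Rightarrow> 'a \<Rightarrow> real" where
  "value_at \<Omega> T v = (SOME w. continuous_rep \<Omega> T v w)"

end

theory Submission
  imports Defs "HOL-Library.Function_Algebras"
begin

text \<open>Put \<open>w = v - u\<close> and \<open>R = \<partial>\<^sub>t v - \<Delta> v - f = \<partial>\<^sub>t w - \<Delta> w\<close>.  The Riesz representation of \<open>V'\<close> in the closure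
  in \<open>L\<^sup>2\<close> of the gradients of \<open>V\<close> is an isometry; it needs neither the completeness of \<open>V\<close> nor the
  Friedrichs inequality.  The least distance from \<open>\<nabla> v\<close> to an admissible \<open>y\<close> is therefore the norm of
  \<open>R\<close>, attained when \<open>\<nabla> v - y\<close> represents \<open>R\<close>.  As \<open>\<nabla> w\<close> represents \<open>- \<Delta> w\<close>, expanding the square
  gives \<open>\<parallel>R\<parallel>\<^sup>2 = \<parallel>\<partial>\<^sub>t w\<parallel>\<^sup>2 + 2 \<langle>\<partial>\<^sub>t w, w\<rangle> + \<parallel>\<nabla> w\<parallel>\<^sup>2\<close>, and the energy identity together with \<open>w 0 = 0\<close>
  turns the integral of the mixed term into \<open>\<parallel>w T\<parallel>\<^sup>2\<close>.

  The energy identity is obtained without mollification: on a set \<open>N\<close> of full measure the equation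
  integrates to \<open>(w t - w s, w r) = \<integral>\<^sub>s\<^sup>t \<langle>\<partial>\<^sub>t w, w r\<rangle>\<close> for \<open>r, s, t \<in> N\<close>, whence
  \<open>\<parallel>w t\<parallel>\<^sup>2 - \<parallel>w s\<parallel>\<^sup>2 = \<integral>\<^sub>s\<^sup>t \<langle>\<partial>\<^sub>t w, w s + w t\<rangle>\<close>, and one sums this over partitions whose points are chosen well.\<close>

section \<open>Square integrable functions\<close>

text \<open>\<open>wgrad\<close>, \<open>time_deriv\<close> and \<open>value_at\<close> are
  \<open>SOME\<close> choices among functions determined only up to null sets. Existence and
  uniqueness of what they denote must be proved, and their values at \<open>v - u\<close> identified
  with the differences of those at \<open>v\<close> and \<open>u\<close>, before the algebra can
  start. Two obstacles shape the energy identity. The weak derivative is tested with a fixed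
  \<open>z\<close>, its exceptional null set depends on \<open>z\<close>, and yet
  \<open>z = w r\<close> is wanted for varying \<open>r\<close>; strong measurability reduces this
  to countably many \<open>z\<close>. Next, one step of the partition has the error
  \<open>\<integral> <g, w s + w t - 2 w \<tau>>\<close>. It is controlled by a modulus of
  continuity in the mean: \<open>(normV (w t - w \<tau>))^2\<close> is at most
  \<open>E t + E \<tau> + e\<close> for close \<open>t\<close> and \<open>\<tau>\<close>, with
  \<open>\<integral> E < e\<close>. A well chosen point of a cell is one where \<open>E\<close> does
  not exceed its cell average, so that Riemann sums of \<open>E\<close> are bounded by its integral.
  The continuous representative is not presupposed: the energy identity between good times bounds
  \<open>\<parallel>w b - w a\<parallel>^2\<close> by an integral over \<open>[a, b]\<close>, and
  \<open>w\<close> extends from the good times by completeness of \<open>L^2\<close>.\<close>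

lemma L2_space_measurable [measurable_dest]:
  "f \<in> L2_space M \<Longrightarrow> f \<in> borel_measurable M"
  by (simp add: L2_space_def)

lemma L2_space_integrable: "f \<in> L2_space M \<Longrightarrow> integrable M (\<lambda>x. (norm (f x))\<^sup>2)"
  by (simp add: L2_space_def)

definition L2_inner :: "'a measure \<Rightarrow> ('a \<Rightarrow> 'b::euclidean_space) \<Rightarrow> ('a \<Rightarrow> 'b) \<Rightarrow> real" where
  "L2_inner M f g = (LINT x|M. f x \<bullet> g x)"

lemma integrable_L2_inner:
  assumes "f \<in> L2_space M" "g \<in> L2_space M"
  shows "integrable M (\<lambda>x. f x \<bullet> g x)"
proof (rule Bochner_Integration.integrable_bound)
  show "integrable M (\<lambda>x. (norm (f x))\<^sup>2 + (norm (g x))\<^sup>2)"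
    using assms by (intro Bochner_Integration.integrable_add L2_space_integrable)
  show "(\<lambda>x. f x \<bullet> g x) \<in> borel_measurable M"
    using assms by measurable
  have "\<bar>a \<bullet> b\<bar> \<le> (norm a)\<^sup>2 + (norm b)\<^sup>2" for a b :: 'b
  proof -
    have "\<bar>a \<bullet> b\<bar> \<le> norm a * norm b" by (rule Cauchy_Schwarz_ineq2)
    also have "\<dots> \<le> (norm a)\<^sup>2 + (norm b)\<^sup>2"
      using sum_squares_bound[of "norm a" "norm b"] mult_nonneg_nonneg[OF norm_ge_zero norm_ge_zero, of a b]
      unfolding mult.assoc by linarith
    finally show ?thesis .
  qed
  then show "AE x in M. norm (f x \<bullet> g x) \<le> norm ((norm (f x))\<^sup>2 + (norm (g x))\<^sup>2)"
    by simp
qed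

lemma L2_space_comb:
  assumes "f \<in> L2_space M" "g \<in> L2_space M"
  shows "(\<lambda>x. a *\<^sub>R f x + b *\<^sub>R g x) \<in> L2_space M"
proof -
  have "integrable M (\<lambda>x. (norm (a *\<^sub>R f x + b *\<^sub>R g x))\<^sup>2)"
  proof (rule Bochner_Integration.integrable_bound)
    show "integrable M (\<lambda>x. 2 * a\<^sup>2 * (norm (f x))\<^sup>2 + 2 * b\<^sup>2 * (norm (g x))\<^sup>2)"
      using assms by (intro Bochner_Integration.integrable_add integrable_mult_right L2_space_integrable)
    show "(\<lambda>x. (norm (a *\<^sub>R f x + b *\<^sub>R g x))\<^sup>2) \<in> borel_measurable M"
      using assms by measurable
    have "(norm (p + q))\<^sup>2 \<le> 2 * (norm p)\<^sup>2 + 2 * (norm q)\<^sup>2" for p q :: 'b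
    proof -
      have "(norm (p + q))\<^sup>2 + (norm (p - q))\<^sup>2 = 2 * (norm p)\<^sup>2 + 2 * (norm q)\<^sup>2"
        by (simp add: power2_norm_eq_inner algebra_simps inner_commute)
      then show ?thesis using zero_le_power2[of "norm (p - q)"] by linarith
    qed
    from this[of "a *\<^sub>R f _" "b *\<^sub>R g _"]
    show "AE x in M. norm ((norm (a *\<^sub>R f x + b *\<^sub>R g x))\<^sup>2)
        \<le> norm (2 * a\<^sup>2 * (norm (f x))\<^sup>2 + 2 * b\<^sup>2 * (norm (g x))\<^sup>2)"
      by (simp add: power_mult_distrib mult.assoc)
  qed
  then show ?thesis using assms by (auto simp: L2_space_def)
qed

lemma L2_space_zero: "(\<lambda>x. 0) \<in> L2_space M"
  by (simp add: L2_space_def)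

lemma L2_space_diff: "f \<in> L2_space M \<Longrightarrow> g \<in> L2_space M \<Longrightarrow> f - g \<in> L2_space M"
  using L2_space_comb[of f M g 1 "-1"] by (simp add: fun_diff_def)

lemma L2_inner_commute: "L2_inner M f g = L2_inner M g f"
  by (simp add: L2_inner_def inner_commute)

lemma L2_inner_comb:
  assumes "f \<in> L2_space M" "g \<in> L2_space M" "h \<in> L2_space M"
  shows "L2_inner M (\<lambda>x. a *\<^sub>R f x + b *\<^sub>R g x) h = a * L2_inner M f h + b * L2_inner M g h"
  using assms by (simp add: L2_inner_def inner_add_left integrable_L2_inner)

lemma L2_inner_comb_right:
  assumes "f \<in> L2_space M" "g \<in> L2_space M" "h \<in> L2_space M"
  shows "L2_inner M h (\<lambda>x. a *\<^sub>R f x + b *\<^sub>R g x) = a * L2_inner M h f + b * L2_inner M h g"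
  using L2_inner_comb[OF assms] by (simp add: L2_inner_commute[of M h])

lemma L2_inner_diff:
  assumes "f \<in> L2_space M" "g \<in> L2_space M" "h \<in> L2_space M"
  shows "L2_inner M (f - g) h = L2_inner M f h - L2_inner M g h"
  using L2_inner_comb[OF assms, of 1 "-1"] by (simp add: fun_diff_def)

lemma L2_inner_cong_AE:
  assumes "f \<in> borel_measurable M" "f' \<in> borel_measurable M"
    "g \<in> borel_measurable M" "g' \<in> borel_measurable M"
    "AE x in M. f x = f' x" "AE x in M. g x = g' x"
  shows "L2_inner M f g = L2_inner M f' g'"
  unfolding L2_inner_def using assms by (intro integral_cong_AE) auto

lemma L2_norm_nonneg [simp]: "0 \<le> L2_norm M f"
  by (simp add: L2_norm_def)

lemma L2_norm_power2: "(L2_norm M f)\<^sup>2 = L2_inner M f f"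
  by (simp add: L2_norm_def L2_inner_def power2_norm_eq_inner)

lemma L2_norm_power2_eq: "(L2_norm M f)\<^sup>2 = (LINT x|M. (norm (f x))\<^sup>2)"
  by (simp add: L2_norm_def)

lemma L2_norm_cong_AE:
  assumes "f \<in> borel_measurable M" "g \<in> borel_measurable M" "AE x in M. f x = g x"
  shows "L2_norm M f = L2_norm M g"
proof -
  have "(LINT x|M. (norm (f x))\<^sup>2) = (LINT x|M. (norm (g x))\<^sup>2)"
    using assms by (intro integral_cong_AE) auto
  then show ?thesis by (simp add: L2_norm_def)
qed

lemma L2_norm_comb_power2:
  assumes "f \<in> L2_space M" "g \<in> L2_space M"
  shows "(L2_norm M (\<lambda>x. a *\<^sub>R f x + b *\<^sub>R g x))\<^sup>2
    = a\<^sup>2 * (L2_norm M f)\<^sup>2 + 2 * a * b * L2_inner M f g + b\<^sup>2 * (L2_norm M g)\<^sup>2"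
proof -
  let ?h = "\<lambda>x. a *\<^sub>R f x + b *\<^sub>R g x"
  have h: "?h \<in> L2_space M" using assms by (rule L2_space_comb)
  have "L2_inner M ?h ?h = a * L2_inner M ?h f + b * L2_inner M ?h g"
    by (rule L2_inner_comb_right[OF assms h])
  also have "\<dots> = a * (a * L2_inner M f f + b * L2_inner M g f) + b * (a * L2_inner M f g + b * L2_inner M g g)"
    using L2_inner_comb[OF assms assms(1)] L2_inner_comb[OF assms assms(2)] by simp
  finally show ?thesis
    unfolding L2_norm_power2 using L2_inner_commute[of M f g]
    by (simp add: power2_eq_square algebra_simps)
qed

lemma L2_norm_diff_power2:
  assumes "f \<in> L2_space M" "g \<in> L2_space M"
  shows "(L2_norm M (f - g))\<^sup>2 = (L2_norm M f)\<^sup>2 - 2 * L2_inner M f g + (L2_norm M g)\<^sup>2"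
  using L2_norm_comb_power2[OF assms, of 1 "-1"] by (simp add: fun_diff_def)

lemma L2_norm_scaleR: "L2_norm M (\<lambda>x. c *\<^sub>R f x) = \<bar>c\<bar> * L2_norm M f"
  by (simp add: L2_norm_def power_mult_distrib real_sqrt_mult)

text \<open>The squared norm of \<open>s f + t g\<close> is a nonnegative quadratic form in
  \<open>s\<close> and \<open>t\<close>. The pair \<open>(b^2, - c)\<close> yields
  \<open>b^2\<close> times the component of \<open>f\<close> orthogonal to \<open>g\<close> without
  a division; only \<open>b = 0\<close> needs a separate argument.\<close>

lemma L2_Cauchy_Schwarz:
  assumes "f \<in> L2_space M" "g \<in> L2_space M"
  shows "\<bar>L2_inner M f g\<bar> \<le> L2_norm M f * L2_norm M g"
proof -
  let ?a = "L2_norm M f" and ?b = "L2_norm M g" and ?c = "L2_inner M f g"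
  have *: "0 \<le> s\<^sup>2 * ?a\<^sup>2 + 2 * s * t * ?c + t\<^sup>2 * ?b\<^sup>2" for s t
    using L2_norm_comb_power2[OF assms, of s t] by (metis zero_le_power2)
  have "?c\<^sup>2 \<le> ?a\<^sup>2 * ?b\<^sup>2"
  proof (cases "?b = 0")
    case False
    have "0 \<le> ?b\<^sup>2 * (?a\<^sup>2 * ?b\<^sup>2 - ?c\<^sup>2)"
      using *[of "?b\<^sup>2" "- ?c"] by (simp add: power2_eq_square algebra_simps)
    moreover have "0 < ?b\<^sup>2" using False by simp
    ultimately show ?thesis using zero_le_mult_iff[of "?b\<^sup>2"] by auto
  next
    case True
    have "?c = 0"
    proof (rule ccontr)
      assume "?c \<noteq> 0"
      \<comment> \<open>With \<open>?b = 0\<close> and \<open>s = 1\<close> the form is affine in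
        \<open>t\<close>, and this \<open>t\<close> gives it the value -1.\<close>
      then show False
        using *[of 1 "- (?a\<^sup>2 + 1) / (2 * ?c)"] True by (simp add: field_simps)
    qed
    then show ?thesis by simp
  qed
  then show ?thesis
    by (metis abs_le_square_iff abs_mult abs_of_nonneg L2_norm_nonneg power_mult_distrib mult_nonneg_nonneg)
qed

lemma L2_norm_triangle:
  assumes "f \<in> L2_space M" "g \<in> L2_space M"
  shows "L2_norm M (\<lambda>x. f x + g x) \<le> L2_norm M f + L2_norm M g"
proof (rule power2_le_imp_le)
  show "(L2_norm M (\<lambda>x. f x + g x))\<^sup>2 \<le> (L2_norm M f + L2_norm M g)\<^sup>2"
    using L2_norm_comb_power2[OF assms, of 1 1] L2_Cauchy_Schwarz[OF assms]
    by (simp add: power2_sum)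
qed simp

lemma L2_norm_triangle_diff:
  assumes "f \<in> L2_space M" "g \<in> L2_space M"
  shows "L2_norm M (f - g) \<le> L2_norm M f + L2_norm M g"
  using L2_norm_triangle[OF assms(1), of "\<lambda>x. (-1) *\<^sub>R g x"] L2_norm_scaleR[of M "-1" g]
    L2_space_comb[OF assms(2) assms(2), of "-1" 0]
  by (simp add: fun_diff_def)

lemma L2_norm_minus_commute: "L2_norm M (f - g) = L2_norm M (g - f)"
  by (simp add: L2_norm_def norm_minus_commute)

lemma L2_norm_triangle3:
  assumes "f \<in> L2_space M" "g \<in> L2_space M" "h \<in> L2_space M"
  shows "L2_norm M (f - h) \<le> L2_norm M (f - g) + L2_norm M (g - h)"
  using L2_norm_triangle[OF L2_space_diff[OF assms(1,2)] L2_space_diff[OF assms(2,3)]]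
  by (simp add: fun_diff_def)

lemma L2_norm_le_diff:
  assumes "f \<in> L2_space M" "g \<in> L2_space M"
  shows "\<bar>L2_norm M f - L2_norm M g\<bar> \<le> L2_norm M (f - g)"
  using L2_norm_triangle[OF L2_space_diff[OF assms] assms(2)]
    L2_norm_triangle[OF L2_space_diff[OF assms(2,1)] assms(1)] L2_norm_minus_commute[of M f g]
  by simp

lemma L2_norm_eq_0_AE:
  assumes "f \<in> L2_space M" "L2_norm M f = 0"
  shows "AE x in M. f x = 0"
proof -
  have "(LINT x|M. (norm (f x))\<^sup>2) = 0"
    using assms(2) by (simp add: L2_norm_def)
  then have "AE x in M. (norm (f x))\<^sup>2 = 0"
    using integral_nonneg_eq_0_iff_AE[OF L2_space_integrable[OF assms(1)]] by simp
  then show ?thesis by simp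
qed

lemma nn_integral_L2_norm:
  assumes "f \<in> L2_space M"
  shows "(\<integral>\<^sup>+x. ennreal ((norm (f x))\<^sup>2) \<partial>M) = ennreal ((L2_norm M f)\<^sup>2)"
  using nn_integral_eq_integral[OF L2_space_integrable[OF assms]] by (simp add: L2_norm_power2_eq)

lemma L2_norm_comb_le:
  assumes "f \<in> L2_space M" "g \<in> L2_space M"
  shows "L2_norm M (\<lambda>x. a *\<^sub>R f x + b *\<^sub>R g x) \<le> \<bar>a\<bar> * L2_norm M f + \<bar>b\<bar> * L2_norm M g"
  using L2_norm_triangle[of "\<lambda>x. a *\<^sub>R f x" M "\<lambda>x. b *\<^sub>R g x"] L2_norm_scaleR[of M a f] L2_norm_scaleR[of M b g]
    L2_space_comb[OF assms(1,1), of a 0] L2_space_comb[OF assms(2,2), of b 0] by simp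

lemma L2_norm_comb_tendsto_0:
  assumes "\<And>n. f n \<in> L2_space M" "\<And>n. g n \<in> L2_space M"
    and "(\<lambda>n. L2_norm M (f n)) \<longlonglongrightarrow> 0" "(\<lambda>n. L2_norm M (g n)) \<longlonglongrightarrow> 0"
  shows "(\<lambda>n. L2_norm M (\<lambda>x. a *\<^sub>R f n x + b *\<^sub>R g n x)) \<longlonglongrightarrow> 0"
proof (rule Lim_null_comparison)
  show "\<forall>\<^sub>F n in sequentially. norm (L2_norm M (\<lambda>x. a *\<^sub>R f n x + b *\<^sub>R g n x))
      \<le> \<bar>a\<bar> * L2_norm M (f n) + \<bar>b\<bar> * L2_norm M (g n)"
    using L2_norm_comb_le[OF assms(1,2)] by simp
  show "(\<lambda>n. \<bar>a\<bar> * L2_norm M (f n) + \<bar>b\<bar> * L2_norm M (g n)) \<longlonglongrightarrow> 0"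
    using tendsto_add[OF tendsto_mult_left[OF assms(3), of "\<bar>a\<bar>"] tendsto_mult_left[OF assms(4), of "\<bar>b\<bar>"]] by simp
qed

lemma L2_norm_diff_tendsto:
  assumes "\<And>n. f n \<in> L2_space M" "y \<in> L2_space M" "(\<lambda>n. L2_norm M (f n - y)) \<longlonglongrightarrow> 0"
  shows "(\<lambda>n. L2_norm M (f n)) \<longlonglongrightarrow> L2_norm M y"
proof (rule LIM_zero_cancel, rule Lim_null_comparison[OF _ assms(3)])
  show "\<forall>\<^sub>F n in sequentially. norm (L2_norm M (f n) - L2_norm M y) \<le> L2_norm M (f n - y)"
    using L2_norm_le_diff[OF assms(1,2)] by simp
qed

lemma L2_inner_diff_tendsto:
  assumes "\<And>n. f n \<in> L2_space M" "y \<in> L2_space M" "h \<in> L2_space M" "(\<lambda>n. L2_norm M (f n - y)) \<longlonglongrightarrow> 0"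
  shows "(\<lambda>n. L2_inner M (f n) h) \<longlonglongrightarrow> L2_inner M y h"
proof (rule LIM_zero_cancel, rule Lim_null_comparison)
  show "\<forall>\<^sub>F n in sequentially. norm (L2_inner M (f n) h - L2_inner M y h) \<le> L2_norm M (f n - y) * L2_norm M h"
    using L2_Cauchy_Schwarz[OF L2_space_diff[OF assms(1,2)] assms(3)]
    by (simp add: L2_inner_diff[OF assms(1,2,3)])
  show "(\<lambda>n. L2_norm M (f n - y) * L2_norm M h) \<longlonglongrightarrow> 0"
    using tendsto_mult_right[OF assms(4), of "L2_norm M h"] by simp
qed

lemma L2_norm_0: "L2_norm M 0 = 0"
  by (simp add: L2_norm_def)

text \<open>Along a subsequence with \<open>\<parallel>f\<^sub>k\<^sub>+\<^sub>1 - f\<^sub>k\<parallel>\<^sup>2 < 8\<^sup>-\<^sup>k\<close>, the series \<open>\<Sum> 4\<^sup>k |f\<^sub>k\<^sub>+\<^sub>1 - f\<^sub>k|\<^sup>2\<close> is integrable,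
  so the increments are pointwise \<open>O(2\<^sup>-\<^sup>k)\<close> almost everywhere.\<close>

lemma L2_complete:
  fixes f :: "nat \<Rightarrow> 'a \<Rightarrow> 'b::euclidean_space"
  assumes f: "\<And>n. f n \<in> L2_space M"
    and cauchy: "\<And>e. e > 0 \<Longrightarrow> \<exists>N. \<forall>m\<ge>N. \<forall>n\<ge>N. L2_norm M (f m - f n) < e"
  shows "\<exists>g\<in>L2_space M. (\<lambda>n. L2_norm M (f n - g)) \<longlonglongrightarrow> 0"
proof -
  have "\<exists>N. \<forall>k. \<forall>m\<ge>N k. \<forall>n\<ge>N k. L2_norm M (f m - f n) < (1/sqrt 8)^k"
    by (intro choice allI cauchy zero_less_power) simp
  then obtain N where N: "\<And>k m n. m \<ge> N k \<Longrightarrow> n \<ge> N k \<Longrightarrow> L2_norm M (f m - f n) < (1/sqrt 8)^k"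
    by blast
  \<comment> \<open>The sum keeps both \<open>r k\<close> and \<open>r (Suc k)\<close> beyond
    \<open>N k\<close>; the summand \<open>k\<close> sends \<open>r k\<close> to infinity even if
    \<open>N\<close> is bounded.\<close>
  define r where "r k = (\<Sum>j\<le>k. N j) + k" for k
  have rN: "r k \<ge> N k" for k
    unfolding r_def by (simp add: trans_le_add1 member_le_sum)
  have rSuc: "r (Suc k) \<ge> N k" for k
    using rN[of k] unfolding r_def by simp
  have rk: "r k \<ge> k" for k by (simp add: r_def)
  define d where "d k x = (norm (f (r (Suc k)) x - f (r k) x))\<^sup>2" for k x
  have fm [measurable]: "f n \<in> borel_measurable M" for n
    using f by (rule L2_space_measurable)
  have dm [measurable]: "d k \<in> borel_measurable M" for k
    unfolding d_def by measurable
  have "(\<integral>\<^sup>+x. ennreal (4^k * d k x) \<partial>M) \<le> ennreal ((1/2)^k)" for k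
  proof -
    have "(\<integral>\<^sup>+x. ennreal (4^k * d k x) \<partial>M) = ennreal (4^k) * (\<integral>\<^sup>+x. ennreal (d k x) \<partial>M)"
      by (subst nn_integral_cmult[symmetric]) (auto simp: ennreal_mult d_def)
    also have "(\<integral>\<^sup>+x. ennreal (d k x) \<partial>M) = ennreal ((L2_norm M (f (r (Suc k)) - f (r k)))\<^sup>2)"
      using nn_integral_L2_norm[OF L2_space_diff[OF f f]] by (simp add: d_def)
    also have "ennreal (4^k) * \<dots> = ennreal (4^k * (L2_norm M (f (r (Suc k)) - f (r k)))\<^sup>2)"
      by (simp add: ennreal_mult)
    also have "\<dots> \<le> ennreal ((1/2)^k)"
    proof (rule ennreal_leI)
      have "(L2_norm M (f (r (Suc k)) - f (r k)))\<^sup>2 \<le> ((1/sqrt 8)^k)\<^sup>2"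
        using N[OF rSuc rN] by (intro power_mono) (auto simp: less_imp_le)
      also have "\<dots> = (1/8)^k"
        by (simp add: power2_eq_square power_one_over flip: power_mult_distrib)
      finally have "4^k * (L2_norm M (f (r (Suc k)) - f (r k)))\<^sup>2 \<le> 4^k * (1/8)^k" by simp
      also have "\<dots> = (1/2::real)^k" by (simp flip: power_mult_distrib)
      finally show "4^k * (L2_norm M (f (r (Suc k)) - f (r k)))\<^sup>2 \<le> (1/2)^k" .
    qed
    finally show ?thesis .
  qed
  then have "(\<integral>\<^sup>+x. (\<Sum>k. ennreal (4^k * d k x)) \<partial>M) \<le> (\<Sum>k. ennreal ((1/2)^k))"
    by (subst nn_integral_suminf) (auto intro!: suminf_le)
  also have "\<dots> = ennreal (\<Sum>k. (1/2)^k)"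
    by (intro suminf_ennreal2 summable_geometric) simp_all
  also have "\<dots> < \<infinity>" by simp
  finally have "(\<integral>\<^sup>+x. (\<Sum>k. ennreal (4^k * d k x)) \<partial>M) \<noteq> \<infinity>" by simp
  then have "AE x in M. (\<Sum>k. ennreal (4^k * d k x)) \<noteq> \<infinity>"
    by (intro nn_integral_noteq_infinite) auto
  then have ae: "AE x in M. convergent (\<lambda>k. f (r k) x)"
  proof eventually_elim
    case (elim x)
    have sm: "summable (\<lambda>k. 4^k * d k x)"
      using elim by (intro summable_suminf_not_top) (auto simp: d_def)
    then obtain C where C: "\<And>k. \<bar>4^k * d k x\<bar> \<le> C"
      using summable_imp_bounded[OF sm] unfolding bounded_iff by auto
    have nb: "norm (f (r (Suc k)) x - f (r k) x) \<le> sqrt C * (1/2)^k" for k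
    proof -
      have "(2^k * norm (f (r (Suc k)) x - f (r k) x))\<^sup>2 \<le> C"
      proof -
        have "((2::real)^k)\<^sup>2 = 4^k"
          by (simp add: power2_eq_square flip: power_mult_distrib)
        then show ?thesis using C[of k] by (simp add: d_def power_mult_distrib)
      qed
      then have "2^k * norm (f (r (Suc k)) x - f (r k) x) \<le> sqrt C"
        by (rule real_le_rsqrt)
      then show ?thesis by (simp add: power_one_over field_simps)
    qed
    have "summable (\<lambda>k. f (r (Suc k)) x - f (r k) x)"
    proof (rule summable_comparison_test'[where N=0])
      show "summable (\<lambda>k. sqrt C * (1/2)^k)"
        by (intro summable_mult summable_geometric) simp
    qed (rule nb)
    then have "convergent (\<lambda>k. \<Sum>j<k. f (r (Suc j)) x - f (r j) x)"
      by (simp add: summable_iff_convergent)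
    then have "convergent (\<lambda>k. f (r k) x - f (r 0) x)"
      by (simp only: sum_lessThan_telescope[of "\<lambda>k. f (r k) x"])
    from convergent_add[OF this convergent_const[of "f (r 0) x"]] show ?case by simp
  qed
  define g where "g x = lim (\<lambda>k. f (r k) x)" for x
  have gm [measurable]: "g \<in> borel_measurable M"
    unfolding g_def using f by (intro borel_measurable_lim_metric) (auto dest: L2_space_measurable)
  have gl: "AE x in M. (\<lambda>k. f (r k) x) \<longlonglongrightarrow> g x"
    using ae by eventually_elim (simp add: g_def convergent_LIMSEQ_iff)
  \<comment> \<open>Fatou's lemma along the subsequence \<open>r\<close>. As \<open>n\<close> is an
    arbitrary index, this yields convergence of the whole sequence to \<open>g\<close> and not
    merely of the subsequence.\<close>
  have bd: "(\<integral>\<^sup>+x. ennreal ((norm (f n x - g x))\<^sup>2) \<partial>M) \<le> ennreal (e\<^sup>2)"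
    if e: "\<And>m. m \<ge> K \<Longrightarrow> L2_norm M (f n - f m) < e" for n e K
  proof -
    have "(\<integral>\<^sup>+x. ennreal ((norm (f n x - g x))\<^sup>2) \<partial>M)
        = (\<integral>\<^sup>+x. liminf (\<lambda>k. ennreal ((norm (f n x - f (r k) x))\<^sup>2)) \<partial>M)"
    proof (rule nn_integral_cong_AE)
      show "AE x in M. ennreal ((norm (f n x - g x))\<^sup>2) = liminf (\<lambda>k. ennreal ((norm (f n x - f (r k) x))\<^sup>2))"
        using gl
      proof eventually_elim
        case (elim x)
        then have "(\<lambda>k. ennreal ((norm (f n x - f (r k) x))\<^sup>2)) \<longlonglongrightarrow> ennreal ((norm (f n x - g x))\<^sup>2)"
          by (intro tendsto_intros tendsto_ennrealI)
        from lim_imp_Liminf[OF sequentially_bot this] show ?case by simp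
      qed
    qed
    also have "\<dots> \<le> liminf (\<lambda>k. \<integral>\<^sup>+x. ennreal ((norm (f n x - f (r k) x))\<^sup>2) \<partial>M)"
      by (rule nn_integral_liminf) measurable
    also have "\<dots> \<le> ennreal (e\<^sup>2)"
    proof (rule Liminf_le)
      show "\<forall>\<^sub>F k in sequentially. (\<integral>\<^sup>+x. ennreal ((norm (f n x - f (r k) x))\<^sup>2) \<partial>M) \<le> ennreal (e\<^sup>2)"
        unfolding eventually_sequentially
      proof (intro exI allI impI)
        fix k assume "K \<le> k"
        then have "L2_norm M (f n - f (r k)) < e"
          using e rk[of k] by auto
        then have "(L2_norm M (f n - f (r k)))\<^sup>2 \<le> e\<^sup>2" by (intro power_mono) auto
        then show "(\<integral>\<^sup>+x. ennreal ((norm (f n x - f (r k) x))\<^sup>2) \<partial>M) \<le> ennreal (e\<^sup>2)"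
          using nn_integral_L2_norm[OF L2_space_diff[OF f f], of n "r k"] by (simp add: ennreal_leI)
      qed
    qed simp
    finally show ?thesis .
  qed
  have diff: "f n - g \<in> L2_space M" if "\<And>m. m \<ge> K \<Longrightarrow> L2_norm M (f n - f m) < e" for n e K
  proof -
    have "integrable M (\<lambda>x. (norm (f n x - g x))\<^sup>2)"
    proof (rule integrableI_bounded)
      show "(\<integral>\<^sup>+x. ennreal (norm ((norm (f n x - g x))\<^sup>2)) \<partial>M) < \<infinity>"
        using le_less_trans[OF bd[OF that] ennreal_less_top] by simp
    qed measurable
    then show ?thesis by (simp add: L2_space_def fun_diff_def)
  qed
  obtain K where K: "\<And>m n. m \<ge> K \<Longrightarrow> n \<ge> K \<Longrightarrow> L2_norm M (f m - f n) < 1"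
    using cauchy[of 1] by auto
  have "f K - (f K - g) \<in> L2_space M"
    by (rule L2_space_diff[OF f diff[of K K 1]]) (use K in auto)
  moreover have "f K - (f K - g) = g" by (simp add: fun_eq_iff)
  ultimately have gL: "g \<in> L2_space M" by simp
  have "(\<lambda>n. L2_norm M (f n - g)) \<longlonglongrightarrow> 0"
  proof (rule LIMSEQ_I)
    fix e :: real assume "e > 0"
    then obtain K where K: "\<And>m n. m \<ge> K \<Longrightarrow> n \<ge> K \<Longrightarrow> L2_norm M (f m - f n) < e/2"
      using cauchy[of "e/2"] by auto
    show "\<exists>no. \<forall>n\<ge>no. norm (L2_norm M (f n - g) - 0) < e"
    proof (intro exI allI impI)
      fix n assume n: "n \<ge> K"
      have "ennreal ((L2_norm M (f n - g))\<^sup>2) \<le> ennreal ((e/2)\<^sup>2)"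
        using bd[of K n "e/2"] K n nn_integral_L2_norm[OF L2_space_diff[OF f gL], of n] by simp
      then have "L2_norm M (f n - g) \<le> e/2"
        using \<open>e > 0\<close> by (subst (asm) ennreal_le_iff) (auto intro: power2_le_imp_le)
      then show "norm (L2_norm M (f n - g) - 0) < e" using \<open>e > 0\<close> by simp
    qed
  qed
  with gL show ?thesis by blast
qed

text \<open>The representative is the limit of a minimising sequence for \<open>\<parallel>A z\<parallel>\<^sup>2 - 2 \<xi> z\<close>.\<close>

lemma L2_Riesz_closure:
  fixes A :: "'v \<Rightarrow> 'a \<Rightarrow> 'b::euclidean_space" and \<xi> :: "'v \<Rightarrow> real"
  assumes V: "V \<noteq> {}" and A: "\<And>z. z \<in> V \<Longrightarrow> A z \<in> L2_space M"
    and comb: "\<And>z w a b. z \<in> V \<Longrightarrow> w \<in> V \<Longrightarrow> \<exists>u\<in>V. (AE x in M. A u x = a *\<^sub>R A z x + b *\<^sub>R A w x)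
      \<and> \<xi> u = a * \<xi> z + b * \<xi> w"
    and bound: "\<And>z. z \<in> V \<Longrightarrow> \<bar>\<xi> z\<bar> \<le> C * L2_norm M (A z)"
  shows "\<exists>y\<in>L2_space M. (\<exists>z. (\<forall>n. z n \<in> V) \<and> (\<lambda>n. L2_norm M (A (z n) - y)) \<longlonglongrightarrow> 0)
    \<and> (\<forall>z\<in>V. \<xi> z = L2_inner M y (A z))"
proof -
  define P where "P z = (L2_norm M (A z))\<^sup>2 - 2 * \<xi> z" for z
  have lower: "- C\<^sup>2 \<le> P z" if "z \<in> V" for z
  proof -
    have "0 \<le> (L2_norm M (A z) - C)\<^sup>2" by simp
    then show ?thesis using bound[OF that] by (auto simp: P_def power2_diff algebra_simps)
  qed
  define m where "m = Inf (P ` V)"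
  have bdd: "bdd_below (P ` V)" using lower by (auto intro!: bdd_belowI)
  have m: "m \<le> P z" if "z \<in> V" for z
    unfolding m_def using bdd that by (intro cInf_lower) auto
  have "\<exists>z\<in>V. P z < m + inverse (real (Suc n))" for n
    using cInf_lessD[of "P ` V" "m + inverse (real (Suc n))"] V by (auto simp: m_def)
  then obtain z where zV: "\<And>n. z n \<in> V" and z: "\<And>n. P (z n) < m + inverse (real (Suc n))"
    by metis
  have comb': "\<exists>u\<in>V. (L2_norm M (A u))\<^sup>2 = a\<^sup>2 * (L2_norm M (A v))\<^sup>2 + 2 * a * b * L2_inner M (A v) (A w)
      + b\<^sup>2 * (L2_norm M (A w))\<^sup>2 \<and> \<xi> u = a * \<xi> v + b * \<xi> w" if vw: "v \<in> V" "w \<in> V" for v w a b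
  proof -
    obtain u where u: "u \<in> V" "AE x in M. A u x = a *\<^sub>R A v x + b *\<^sub>R A w x" "\<xi> u = a * \<xi> v + b * \<xi> w"
      using comb[OF vw] by blast
    have "L2_norm M (A u) = L2_norm M (\<lambda>x. a *\<^sub>R A v x + b *\<^sub>R A w x)"
      using u A vw by (intro L2_norm_cong_AE) (auto intro!: L2_space_measurable L2_space_comb)
    then have "(L2_norm M (A u))\<^sup>2 = a\<^sup>2 * (L2_norm M (A v))\<^sup>2 + 2 * a * b * L2_inner M (A v) (A w)
        + b\<^sup>2 * (L2_norm M (A w))\<^sup>2"
      by (simp only: L2_norm_comb_power2[OF A[OF vw(1)] A[OF vw(2)]])
    then show ?thesis using u(1,3) by blast
  qed
  \<comment> \<open>Parallelogram identity: with the midpoint \<open>u\<close> the left side is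
    \<open>2 * P (z k) + 2 * P (z n) - 4 * P u\<close>, the terms in \<open>\<xi>\<close>
    cancelling, and \<open>P u\<close> is at least \<open>m\<close>.\<close>
  have cauchy: "(L2_norm M (A (z k) - A (z n)))\<^sup>2 \<le> 2 * inverse (real (Suc k)) + 2 * inverse (real (Suc n))" for k n
  proof -
    obtain u where u: "u \<in> V" "(L2_norm M (A u))\<^sup>2 = (1/2)\<^sup>2 * (L2_norm M (A (z k)))\<^sup>2
        + 2 * (1/2) * (1/2) * L2_inner M (A (z k)) (A (z n)) + (1/2)\<^sup>2 * (L2_norm M (A (z n)))\<^sup>2"
      "\<xi> u = 1/2 * \<xi> (z k) + 1/2 * \<xi> (z n)"
      using comb'[OF zV zV] by blast
    show ?thesis
      unfolding L2_norm_diff_power2[OF A[OF zV] A[OF zV]]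
      using u m[OF u(1)] z[of k] z[of n] by (simp add: P_def power2_eq_square)
  qed
  have "\<exists>y\<in>L2_space M. (\<lambda>n. L2_norm M (A (z n) - y)) \<longlonglongrightarrow> 0"
  proof (rule L2_complete)
    fix e :: real assume e: "e > 0"
    obtain K where K: "inverse (real (Suc K)) < e\<^sup>2 / 4"
      using reals_Archimedean[of "e\<^sup>2 / 4"] e by auto
    show "\<exists>N. \<forall>m\<ge>N. \<forall>n\<ge>N. L2_norm M (A (z m) - A (z n)) < e"
    proof (intro exI allI impI)
      fix k n assume kn: "K \<le> k" "K \<le> n"
      have "inverse (real (Suc k)) \<le> inverse (real (Suc K))" "inverse (real (Suc n)) \<le> inverse (real (Suc K))"
        using kn by (auto intro!: le_imp_inverse_le)
      then have "(L2_norm M (A (z k) - A (z n)))\<^sup>2 < e\<^sup>2"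
        using cauchy[of k n] K by linarith
      then show "L2_norm M (A (z k) - A (z n)) < e"
        using e by (intro power2_less_imp_less[of _ e]) auto
    qed
  qed (rule A[OF zV])
  then obtain y where y: "y \<in> L2_space M" and zy: "(\<lambda>n. L2_norm M (A (z n) - y)) \<longlonglongrightarrow> 0" by blast
  have "\<xi> w = L2_inner M y (A w)" if w: "w \<in> V" for w
  proof -
    have inner_lim: "(\<lambda>n. L2_inner M (A (z n)) (A w)) \<longlonglongrightarrow> L2_inner M y (A w)"
      by (rule L2_inner_diff_tendsto[OF A[OF zV] y A[OF w] zy])
    \<comment> \<open>First variation: \<open>P\<close> at \<open>z n\<close> plus \<open>t\<close>
      times \<open>w\<close> is at least \<open>m\<close>, hence exceeds
      \<open>P (z n) - 1 / (n + 1)\<close>; then \<open>n\<close> tends to infinity.\<close>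
    have "0 \<le> t\<^sup>2 * (L2_norm M (A w))\<^sup>2 + 2 * t * (L2_inner M y (A w) - \<xi> w)" for t
    proof (rule LIMSEQ_le)
      show "(\<lambda>n. - inverse (real (Suc n))) \<longlonglongrightarrow> 0"
        using tendsto_minus[OF LIMSEQ_inverse_real_of_nat] by simp
      show "(\<lambda>n. t\<^sup>2 * (L2_norm M (A w))\<^sup>2 + 2 * t * (L2_inner M (A (z n)) (A w) - \<xi> w))
          \<longlonglongrightarrow> t\<^sup>2 * (L2_norm M (A w))\<^sup>2 + 2 * t * (L2_inner M y (A w) - \<xi> w)"
        by (intro tendsto_intros inner_lim)
      have "- inverse (real (Suc n)) \<le> t\<^sup>2 * (L2_norm M (A w))\<^sup>2 + 2 * t * (L2_inner M (A (z n)) (A w) - \<xi> w)" for n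
      proof -
        obtain u where u: "u \<in> V" "(L2_norm M (A u))\<^sup>2 = 1\<^sup>2 * (L2_norm M (A (z n)))\<^sup>2
            + 2 * 1 * t * L2_inner M (A (z n)) (A w) + t\<^sup>2 * (L2_norm M (A w))\<^sup>2"
          "\<xi> u = 1 * \<xi> (z n) + t * \<xi> w"
          using comb'[OF zV w] by blast
        show ?thesis using m[OF u(1)] z[of n] u(2,3) by (simp add: P_def algebra_simps)
      qed
      then show "\<exists>N. \<forall>n\<ge>N. - inverse (real (Suc n))
          \<le> t\<^sup>2 * (L2_norm M (A w))\<^sup>2 + 2 * t * (L2_inner M (A (z n)) (A w) - \<xi> w)" by blast
    qed
    then have q: "0 \<le> t\<^sup>2 * a + 2 * t * b" if "a = (L2_norm M (A w))\<^sup>2" "b = L2_inner M y (A w) - \<xi> w" for t a b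
      using that by simp
    have "L2_inner M y (A w) - \<xi> w = 0"
    proof (rule ccontr)
      define a b where "a = (L2_norm M (A w))\<^sup>2" and "b = L2_inner M y (A w) - \<xi> w"
      assume "L2_inner M y (A w) - \<xi> w \<noteq> 0"
      then have b: "b \<noteq> 0" by (simp add: b_def)
      have a: "a \<ge> 0" by (simp add: a_def)
      \<comment> \<open>The minimum of \<open>t^2 * a + 2 * t * b\<close> lies at
        \<open>- b / a\<close>; the denominator \<open>a + 1\<close> serves as well and also covers
        \<open>a = 0\<close>.\<close>
      have "0 \<le> (- b / (a + 1))\<^sup>2 * a + 2 * (- b / (a + 1)) * b"
        by (rule q[OF a_def b_def])
      also have "\<dots> = (b / (a + 1))\<^sup>2 * (a - 2 * (a + 1))"
      proof -
        define c where "c = b / (a + 1)"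
        have "b = c * (a + 1)" using a by (simp add: c_def)
        then show ?thesis unfolding minus_divide_left[symmetric] c_def[symmetric]
          by (simp add: power2_eq_square algebra_simps)
      qed
      also have "\<dots> < 0"
        using a b by (intro mult_pos_neg) auto
      finally show False by simp
    qed
    then show ?thesis by simp
  qed
  with y zV zy show ?thesis by blast
qed

section \<open>Smooth bump functions and weak gradients\<close>

lemma Ck_SucI:
  assumes "\<And>x. (f has_derivative D x) (at x)" "\<And>i. i \<in> Basis \<Longrightarrow> Ck k (\<lambda>x. D x i)"
  shows "Ck (Suc k) f"
proof -
  have "frechet_derivative f (at x) = D x" for x
    using frechet_derivative_at[OF assms(1)] by simp
  then show ?thesis using assms by (auto simp: differentiable_def)
qed

lemma Ck_SucD: "Ck (Suc k) f \<Longrightarrow> (f has_derivative frechet_derivative f (at x)) (at x)"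
  by (simp add: frechet_derivative_works)

lemma Ck_Suc_imp: "Ck (Suc k) f \<Longrightarrow> Ck k f"
proof (induction k arbitrary: f)
  case 0
  then have "continuous (at x) f" for x
    using Ck_SucD has_derivative_continuous by blast
  then show ?case by (simp add: continuous_at_imp_continuous_on)
next
  case (Suc k)
  from Suc.prems have "\<forall>x. f differentiable at x" "\<forall>i\<in>Basis. Ck (Suc k) (\<lambda>x. frechet_derivative f (at x) i)"
    unfolding Ck.simps(2)[of "Suc k" f] by blast+
  then show ?case using Suc.IH unfolding Ck.simps(2)[of k f] by blast
qed

lemma Ck_const: "Ck k (\<lambda>x. c)"
proof (induction k arbitrary: c)
  case (Suc k)
  show ?case by (rule Ck_SucI[where D="\<lambda>_ _. 0"]) (auto intro: Suc)
qed simp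

lemma Ck_add: "Ck k f \<Longrightarrow> Ck k g \<Longrightarrow> Ck k (\<lambda>x. f x + g x)"
proof (induction k arbitrary: f g)
  case 0
  then show ?case by (auto intro: continuous_on_add)
next
  case (Suc k)
  show ?case
  proof (rule Ck_SucI)
    show "((\<lambda>x. f x + g x) has_derivative
        (\<lambda>h. frechet_derivative f (at x) h + frechet_derivative g (at x) h)) (at x)" for x
      using Suc.prems[THEN Ck_SucD] by (intro has_derivative_add)
  qed (use Suc in auto)
qed

lemma Ck_mult: "Ck k f \<Longrightarrow> Ck k g \<Longrightarrow> Ck k (\<lambda>x. f x * g x)"
proof (induction k arbitrary: f g)
  case 0
  then show ?case by (auto intro: continuous_on_mult)
next
  case (Suc k)
  show ?case
  proof (rule Ck_SucI)
    show "((\<lambda>x. f x * g x) has_derivative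
        (\<lambda>h. f x * frechet_derivative g (at x) h + frechet_derivative f (at x) h * g x)) (at x)" for x
      using Suc.prems[THEN Ck_SucD] by (intro has_derivative_mult)
    show "Ck k (\<lambda>x. f x * frechet_derivative g (at x) i + frechet_derivative f (at x) i * g x)"
      if "i \<in> Basis" for i
      using Suc.prems Suc.prems[THEN Ck_Suc_imp] that by (intro Ck_add Suc.IH) auto
  qed
qed

lemma Ck_prod: "(\<And>i. i \<in> A \<Longrightarrow> Ck k (f i)) \<Longrightarrow> Ck k (\<lambda>x. \<Prod>i\<in>A. f i x)"
  by (induction A rule: infinite_finite_induct) (auto intro: Ck_const Ck_mult)

lemma Ck_continuous: "Ck k f \<Longrightarrow> continuous_on UNIV f"
  by (induction k) (use Ck_Suc_imp in auto)

lemma Ck_SucI_real: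
  fixes f :: "real \<Rightarrow> real"
  assumes "\<And>x. (f has_real_derivative f' x) (at x)" "Ck k f'"
  shows "Ck (Suc k) f"
proof (rule Ck_SucI)
  show "(f has_derivative (*) (f' x)) (at x)" for x
    using assms(1) by (simp add: has_field_derivative_def)
qed (use assms(2) in auto)

text \<open>The classical flat function \<open>exp (- 1 / x)\<close> times a power of
  \<open>1 / x\<close>. The exponent \<open>j\<close> makes the family closed under differentiation
  up to linear combinations, so smoothness follows by induction on the order for all
  \<open>j\<close> at once.\<close>

definition flat_exp :: "nat \<Rightarrow> real \<Rightarrow> real" where
  "flat_exp j x = (if x \<le> 0 then 0 else (1 / x) ^ j * exp (- (1 / x)))"

lemma flat_exp_has_derivative:
  "(flat_exp j has_real_derivative flat_exp (j + 2) x - real j * flat_exp (j + 1) x) (at x)"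
proof -
  consider "x < 0" | "x = 0" | "x > 0" by linarith
  then show ?thesis
  proof cases
    case 1
    have "(flat_exp j has_real_derivative 0) (at x)"
    proof (rule has_field_derivative_transform_within_open)
      show "((\<lambda>_. 0) has_real_derivative 0) (at x)" by simp
      show "open {..<0::real}" "x \<in> {..<0}" using 1 by auto
    qed (auto simp: flat_exp_def)
    then show ?thesis using 1 by (simp add: flat_exp_def)
  next
    case 2
    \<comment> \<open>From the right the quotient is \<open>flat_exp (j + 1) h\<close>; in the
      variable \<open>1 / h\<close> it is a power divided by an exponential. The limit 0 agrees with
      the claimed derivative because the whole family vanishes at 0.\<close>
    have lim: "((\<lambda>h. (flat_exp j h) / h) \<longlongrightarrow> 0) (at 0)"
    proof (rule filterlim_split_at)
      have "eventually (\<lambda>h. (flat_exp j h) / h = 0) (at_left (0::real))"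
        by (auto simp: flat_exp_def eventually_at_filter)
      then show "((\<lambda>h. (flat_exp j h) / h) \<longlongrightarrow> 0) (at_left 0)"
        by (rule tendsto_eventually)
      have "((\<lambda>h::real. (inverse h) ^ (j + 1) / exp (inverse h)) \<longlongrightarrow> 0) (at_right 0)"
        using tendsto_power_div_exp_0[of "j + 1"] filterlim_inverse_at_top_right
        by (rule filterlim_compose)
      moreover have "eventually (\<lambda>h. (inverse h) ^ (j + 1) / exp (inverse h) = flat_exp j h / h) (at_right (0::real))"
        by (auto simp: flat_exp_def eventually_at_filter exp_minus field_simps)
      ultimately show "((\<lambda>h. (flat_exp j h) / h) \<longlongrightarrow> 0) (at_right 0)"
        by (rule Lim_transform_eventually)
    qed
    show ?thesis
      using lim 2 by (simp add: DERIV_def flat_exp_def[of _ 0])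
  next
    case 3
    show ?thesis
    proof (rule has_field_derivative_transform_within_open)
      show "((\<lambda>x. (1 / x) ^ j * exp (- (1 / x))) has_real_derivative
          flat_exp (j + 2) x - real j * flat_exp (j + 1) x) (at x)"
      proof -
        have d: "((\<lambda>x. 1 / x) has_real_derivative - ((1 / x)\<^sup>2)) (at x)"
          using 3 by (auto intro!: derivative_eq_intros simp: power2_eq_square)
        have "((\<lambda>x. (1 / x) ^ j) has_real_derivative - (real j * (1 / x) ^ (j + 1))) (at x)"
          by (rule DERIV_cong[OF DERIV_power[OF d]]) (cases j; simp add: power2_eq_square)
        from DERIV_mult[OF this DERIV_fun_exp[OF DERIV_minus[OF d]]] show ?thesis
          by (rule DERIV_cong) (use 3 in \<open>simp add: flat_exp_def power2_eq_square algebra_simps\<close>)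
      qed
      show "open {0::real<..}" "x \<in> {0<..}" using 3 by auto
    qed (auto simp: flat_exp_def)
  qed
qed

lemma Ck_flat_exp:
  fixes i :: "'a::euclidean_space"
  shows "Ck k (\<lambda>x. flat_exp j (c * (x \<bullet> i) + d))"
proof (induction k arbitrary: j)
  have der: "((\<lambda>x. flat_exp j (c * (x \<bullet> i) + d)) has_derivative
    (\<lambda>h. (c * (h \<bullet> i)) * (flat_exp (j + 2) (c * (x \<bullet> i) + d) + (- real j) * flat_exp (j + 1) (c * (x \<bullet> i) + d)))) (at x)" for x j
  proof -
    have "((\<lambda>x. c * (x \<bullet> i) + d) has_derivative (\<lambda>h. c * (h \<bullet> i))) (at x)"
      by (auto intro!: derivative_eq_intros)
    from has_derivative_compose[OF this flat_exp_has_derivative[unfolded has_field_derivative_def]]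
    show ?thesis by (simp add: o_def mult.commute algebra_simps)
  qed
  {
    case 0
    show ?case
      using der[THEN has_derivative_continuous] by (simp add: continuous_at_imp_continuous_on)
  next
    case (Suc k)
    show ?case by (rule Ck_SucI[OF der]) (intro Ck_mult Ck_add Ck_const Suc)
  }
qed

text \<open>Each factor is \<open>exp (- 1 / ((n + 1) * d))\<close> in the distance \<open>d\<close>
  to a face. The factor \<open>Suc n\<close> drives the bumps to the indicator of the open box while
  the set where they are positive stays that box, for every \<open>n\<close>.\<close>

definition box_bump :: "nat \<Rightarrow> 'a::euclidean_space \<Rightarrow> 'a \<Rightarrow> 'a \<Rightarrow> real" where
  "box_bump n a b x = (\<Prod>i\<in>Basis. flat_exp 0 (real (Suc n) * ((x - a) \<bullet> i)) * flat_exp 0 (real (Suc n) * ((b - x) \<bullet> i)))"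

lemma Ck_box_bump: "Ck k (box_bump n a b)"
proof -
  have "flat_exp 0 (real (Suc n) * ((x - a) \<bullet> i)) = flat_exp 0 (real (Suc n) * (x \<bullet> i) + - real (Suc n) * (a \<bullet> i))"
    "flat_exp 0 (real (Suc n) * ((b - x) \<bullet> i)) = flat_exp 0 (- real (Suc n) * (x \<bullet> i) + real (Suc n) * (b \<bullet> i))" for x i
    by (simp_all add: algebra_simps)
  then have "box_bump n a b = (\<lambda>x. \<Prod>i\<in>Basis. flat_exp 0 (real (Suc n) * (x \<bullet> i) + - real (Suc n) * (a \<bullet> i))
     * flat_exp 0 (- real (Suc n) * (x \<bullet> i) + real (Suc n) * (b \<bullet> i)))"
    by (intro ext) (simp only: box_bump_def)
  then show ?thesis by (simp only: Ck_prod Ck_mult Ck_flat_exp)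
qed

lemma flat_exp_0_bounds: "0 \<le> flat_exp 0 x" "flat_exp 0 x \<le> 1"
  by (auto simp: flat_exp_def)

lemma box_bump_bounds: "0 \<le> box_bump n a b x" "box_bump n a b x \<le> 1"
  unfolding box_bump_def using flat_exp_0_bounds
  by (auto intro!: prod_nonneg prod_le_1 mult_le_one)

lemma box_bump_outside: "x \<notin> box a b \<Longrightarrow> box_bump n a b x = 0"
proof -
  assume "x \<notin> box a b"
  then obtain i where "i \<in> Basis" "x \<bullet> i \<le> a \<bullet> i \<or> b \<bullet> i \<le> x \<bullet> i"
    by (auto simp: mem_box not_less)
  then show ?thesis
    unfolding box_bump_def
    by (intro prod_zero bexI[of _ i]) (auto simp: flat_exp_def inner_diff_left mult_le_0_iff)
qed

lemma box_bump_pos: "x \<in> box a b \<Longrightarrow> 0 < box_bump n a b x"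
  unfolding box_bump_def
  by (intro prod_pos) (auto simp: flat_exp_def mem_box inner_diff_left zero_less_mult_iff not_le)

lemma box_bump_tendsto: "(\<lambda>n. box_bump n a b x) \<longlonglongrightarrow> indicator (box a b) x"
proof (cases "x \<in> box a b")
  case True
  have *: "(\<lambda>n. flat_exp 0 (real (Suc n) * d)) \<longlonglongrightarrow> 1" if "d > 0" for d
  proof -
    have "(\<lambda>n. exp (- (inverse (real (Suc n)) * inverse d))) \<longlonglongrightarrow> exp (- (0 * inverse d))"
      by (intro tendsto_intros LIMSEQ_inverse_real_of_nat)
    moreover have "flat_exp 0 (real (Suc n) * d) = exp (- (inverse (real (Suc n)) * inverse d))" for n
      using that by (simp add: flat_exp_def not_le zero_less_mult_iff inverse_eq_divide)
    ultimately show ?thesis by simp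
  qed
  have "(\<lambda>n. box_bump n a b x) \<longlonglongrightarrow> (\<Prod>i\<in>(Basis::'a set). 1 * 1)"
    unfolding box_bump_def using True
    by (intro tendsto_prod tendsto_mult *) (auto simp: mem_box inner_diff_left)
  with True show ?thesis by simp
qed (simp add: box_bump_outside)

lemma box_bump_test_function:
  assumes "cbox a b \<subseteq> U"
  shows "box_bump n a b \<in> test_functions U"
proof -
  have "{x. box_bump n a b x \<noteq> 0} \<subseteq> cbox a b"
    using box_bump_outside box_subset_cbox by blast
  then have "closure {x. box_bump n a b x \<noteq> 0} \<subseteq> cbox a b"
    by (rule closure_minimal[OF _ closed_cbox])
  moreover from this have "compact (closure {x. box_bump n a b x \<noteq> 0})"
    by (meson bounded_cbox bounded_subset closed_closure compact_eq_bounded_closed)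
  ultimately show ?thesis using assms Ck_box_bump by (auto simp: test_functions_def)
qed

section \<open>The fundamental lemma of the calculus of variations\<close>

lemma integrable_lebesgue_on_subset:
  fixes f :: "'a::euclidean_space \<Rightarrow> 'b::euclidean_space"
  assumes "integrable (lebesgue_on S) f" "T \<subseteq> S" "S \<in> sets lebesgue" "T \<in> sets lebesgue"
  shows "integrable (lebesgue_on T) f"
  using assms set_integrable_subset[of lebesgue S f T]
  by (simp add: set_integrable_def integrable_restrict_space)

text \<open>Bumps converging to the indicator of a box show, by dominated convergence, that
  \<open>F\<close> has integral zero over every closed box in \<open>U\<close>. The Lebesgue
  differentiation theorem on small cubes then gives the claim in each box, and countably many boxes
  cover \<open>U\<close>.\<close>

lemma AE_eq_0_if_test_integrals_0:
  fixes F :: "'a::euclidean_space \<Rightarrow> real"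
  assumes U: "open U"
    and F: "\<And>a b. cbox a b \<subseteq> U \<Longrightarrow> integrable (lebesgue_on (cbox a b)) F"
    and test: "\<And>\<phi>. \<phi> \<in> test_functions U \<Longrightarrow> (LINT x|lebesgue_on U. F x * \<phi> x) = 0"
  shows "AE x in lebesgue_on U. F x = 0"
proof -
  have Us: "U \<in> sets lebesgue" using U by auto
  have int0: "integral (cbox a b) F = 0" if ab: "cbox a b \<subseteq> U" for a b
  proof -
    have FI: "integrable lebesgue (\<lambda>x. indicator (cbox a b) x *\<^sub>R F x)"
      using F[OF ab] by (subst (asm) integrable_restrict_space) auto
    have FM [measurable]: "(\<lambda>x. indicator (cbox a b) x *\<^sub>R F x) \<in> borel_measurable lebesgue"
      using FI by (rule borel_measurable_integrable)
    have bm [measurable]: "box_bump n a b \<in> borel_measurable lebesgue" for n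
      using Ck_continuous[OF Ck_box_bump, of n a b] by (simp add: borel_measurable_continuous_onI measurable_completion)
    have "(\<lambda>n. LINT x|lebesgue. (indicator (cbox a b) x *\<^sub>R F x) * box_bump n a b x)
      \<longlonglongrightarrow> (LINT x|lebesgue. (indicator (cbox a b) x *\<^sub>R F x) * indicator (box a b) x)"
    proof (rule integral_dominated_convergence)
      show "integrable lebesgue (\<lambda>x. norm (indicator (cbox a b) x *\<^sub>R F x))"
        using FI by (rule integrable_norm)
      show "AE x in lebesgue. norm ((indicator (cbox a b) x *\<^sub>R F x) * box_bump n a b x)
         \<le> norm (indicator (cbox a b) x *\<^sub>R F x)" for n
        using box_bump_bounds[of n a b] by (auto simp: abs_mult intro!: mult_left_le)
      show "AE x in lebesgue. (\<lambda>n. (indicator (cbox a b) x *\<^sub>R F x) * box_bump n a b x)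
        \<longlonglongrightarrow> (indicator (cbox a b) x *\<^sub>R F x) * indicator (box a b) x"
        by (intro AE_I2 tendsto_intros box_bump_tendsto)
      have [measurable]: "indicat_real (box a b) \<in> borel_measurable lebesgue"
        by (intro borel_measurable_indicator) auto
      show "(\<lambda>x. (indicator (cbox a b) x *\<^sub>R F x) * indicator (box a b) x) \<in> borel_measurable lebesgue"
        "(\<lambda>x. (indicator (cbox a b) x *\<^sub>R F x) * box_bump n a b x) \<in> borel_measurable lebesgue" for n
        by (intro borel_measurable_times FM bm; measurable)+
    qed
    moreover have "(LINT x|lebesgue. (indicator (cbox a b) x *\<^sub>R F x) * box_bump n a b x) = 0" for n
    proof -
      have "(LINT x|lebesgue. (indicator (cbox a b) x *\<^sub>R F x) * box_bump n a b x)
          = (LINT x|lebesgue. indicator U x *\<^sub>R (F x * box_bump n a b x))"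
        using ab box_subset_cbox[of a b] by (intro Bochner_Integration.integral_cong) (auto simp: indicator_def intro!: box_bump_outside)
      also have "\<dots> = (LINT x|lebesgue_on U. F x * box_bump n a b x)"
        using Us by (simp add: integral_restrict_space)
      finally show ?thesis using test[OF box_bump_test_function[OF ab]] by simp
    qed
    ultimately have "(LINT x|lebesgue. (indicator (cbox a b) x *\<^sub>R F x) * indicator (box a b) x) = 0"
      by (simp add: LIMSEQ_const_iff)
    also have "(LINT x|lebesgue. (indicator (cbox a b) x *\<^sub>R F x) * indicator (box a b) x)
        = (LINT x|lebesgue. indicator (box a b) x *\<^sub>R F x)"
      using box_subset_cbox[of a b] by (intro Bochner_Integration.integral_cong) (auto simp: indicator_def)
    also have "\<dots> = (LINT x|lebesgue_on (box a b). F x)"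
      by (simp add: integral_restrict_space)
    also have "\<dots> = integral (box a b) F"
      using integrable_lebesgue_on_subset[OF F[OF ab] box_subset_cbox]
      by (intro lebesgue_integral_eq_integral) auto
    finally show ?thesis
      by (simp add: integral_open_interval)
  qed
  have ae_box: "AE x in lebesgue. x \<in> box p q \<longrightarrow> F x = 0" if pq: "cbox p q \<subseteq> U" for p q
  proof -
    \<comment> \<open>The extension by zero is integrable over every box, as the differentiation
      theorem demands, and agrees with \<open>F\<close> on the cubes used below.\<close>
    define G where "G x = (if x \<in> cbox p q then F x else 0)" for x
    have Fpq: "integrable (lebesgue_on (cbox p q)) F" by (rule F[OF pq])
    then have "F integrable_on cbox p q" by (intro integrable_on_lebesgue_on) auto
    then have "G integrable_on UNIV" unfolding G_def by (simp add: integrable_restrict_UNIV)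
    then have Gi: "G integrable_on cbox a b" for a b
      by (rule integrable_on_subcbox) simp
    obtain N where N: "negligible N" and Nd: "\<And>x e. \<lbrakk>x \<notin> N; 0 < e\<rbrakk> \<Longrightarrow>
        \<exists>d>0. \<forall>h. 0 < h \<and> h < d \<longrightarrow> norm(integral (cbox x (x + h *\<^sub>R One)) G /\<^sub>R h ^ DIM('a) - G x) < e"
      using integrable_ccontinuous_explicit[OF Gi] by metis
    have "F x = 0" if x: "x \<in> box p q" "x \<notin> N" for x
    proof (rule ccontr)
      assume "F x \<noteq> 0"
      then obtain d where d: "d > 0" "\<And>h. 0 < h \<Longrightarrow> h < d \<Longrightarrow>
          norm (integral (cbox x (x + h *\<^sub>R One)) G /\<^sub>R h ^ DIM('a) - G x) < \<bar>F x\<bar>"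
        using Nd[OF x(2), of "\<bar>F x\<bar>"] by auto
      obtain r where r: "r > 0" "cball x r \<subseteq> box p q"
        using open_contains_cball[of "box p q"] x(1) by auto
      \<comment> \<open>The first bound serves the differentiation estimate; the second keeps the
        far corner of the cube, at distance \<open>h * norm One\<close>, in the ball of radius
        \<open>r\<close> and so the cube in the box.\<close>
      define h where "h = min (d/2) (r / (norm (One::'a) + 1))"
      have pos: "0 < norm (One::'a) + 1" using norm_ge_zero[of "One::'a"] by linarith
      have h: "0 < h" "h < d" using d(1) r(1) pos unfolding h_def by auto
      have hr: "h * norm (One::'a) \<le> r"
      proof -
        have "h * norm (One::'a) \<le> r / (norm (One::'a) + 1) * norm (One::'a)"
          by (intro mult_right_mono) (auto simp: h_def)
        also have "\<dots> \<le> r"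
          using r(1) pos mult_left_mono[of "norm (One::'a)" "norm (One::'a) + 1" r] by (simp add: pos_divide_le_eq)
        finally show ?thesis .
      qed
      have sub: "cbox x (x + h *\<^sub>R One) \<subseteq> cbox p q"
      proof
        fix y assume y: "y \<in> cbox x (x + h *\<^sub>R One)"
        have "x \<in> cbox p q" "x + h *\<^sub>R One \<in> cbox p q"
          using x r hr h box_subset_cbox[of p q] by (auto simp: subset_iff dist_norm)
        then show "y \<in> cbox p q" using y unfolding mem_box by (meson order_trans)
      qed
      have "integral (cbox x (x + h *\<^sub>R One)) G = integral (cbox x (x + h *\<^sub>R One)) F"
        using sub by (intro integral_cong) (auto simp: G_def)
      also have "\<dots> = 0" using sub pq by (intro int0) auto
      finally show False
        using d(2)[OF h] x box_subset_cbox[of p q] by (auto simp: G_def)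
    qed
    moreover have "AE x in lebesgue. x \<notin> N"
      using N by (simp add: negligible_iff_null_sets AE_not_in)
    ultimately show ?thesis by (auto elim!: eventually_mono)
  qed
  obtain \<D> where D: "countable \<D>" "\<D> \<subseteq> Pow U" "\<And>X. X \<in> \<D> \<Longrightarrow> \<exists>a b. X = cbox a b" "\<Union>\<D> = U"
    using open_countable_Union_open_cbox[OF U] by metis
  have "AE x in lebesgue. x \<in> X \<longrightarrow> F x = 0" if X: "X \<in> \<D>" for X
  proof -
    obtain a b where ab: "X = cbox a b" using D(3)[OF X] by blast
    have "AE x in lebesgue. x \<notin> cbox a b - box a b"
      by (intro AE_not_in) (simp add: negligible_iff_null_sets[symmetric] negligible_frontier_interval)
    moreover have "AE x in lebesgue. x \<in> box a b \<longrightarrow> F x = 0"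
      using ae_box[of a b] D(2) X by (auto simp: ab)
    ultimately show ?thesis by eventually_elim (auto simp: ab)
  qed
  then have "AE x in lebesgue. \<forall>X\<in>\<D>. x \<in> X \<longrightarrow> F x = 0"
    using D(1) by (subst AE_ball_countable) auto
  then have "AE x in lebesgue. x \<in> U \<longrightarrow> F x = 0"
    by eventually_elim (use D(4) in blast)
  then show ?thesis using Us by (simp add: AE_restrict_space_iff)
qed


section \<open>Test functions in \<open>L2_space\<close>; uniqueness and linearity of weak
  gradients\<close>

lemma L2_space_integrable_finite:
  assumes "f \<in> L2_space M" "finite_measure M"
  shows "integrable M f"
proof (rule Bochner_Integration.integrable_bound)
  interpret finite_measure M by fact
  show "integrable M (\<lambda>x. 1 + (norm (f x))\<^sup>2)"
    using assms by (intro Bochner_Integration.integrable_add L2_space_integrable) auto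
  have "r \<le> 1 + r\<^sup>2" if "r \<ge> 0" for r :: real
    using sum_squares_bound[of 1 r] that by simp
  then show "AE x in M. norm (f x) \<le> norm (1 + (norm (f x))\<^sup>2)" by simp
qed (use assms in \<open>auto dest: L2_space_measurable\<close>)

lemma L2_space_lebesgue_on_subset:
  fixes f :: "'a::euclidean_space \<Rightarrow> 'b::euclidean_space"
  assumes "f \<in> L2_space (lebesgue_on S)" "T \<subseteq> S" "S \<in> sets lebesgue" "T \<in> sets lebesgue"
  shows "f \<in> L2_space (lebesgue_on T)"
proof -
  have "f \<in> borel_measurable (lebesgue_on T)"
    using assms by (auto simp: L2_space_def intro: measurable_restrict_mono)
  then show ?thesis
    using assms integrable_lebesgue_on_subset[of S "\<lambda>x. (norm (f x))\<^sup>2" T] by (auto simp: L2_space_def)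
qed

lemma finite_measure_lebesgue_on_cbox: "finite_measure (lebesgue_on (cbox a b))"
  by (rule finite_measure_lebesgue_on) auto

lemma test_function_continuous: "\<phi> \<in> test_functions U \<Longrightarrow> continuous_on S \<phi>"
proof -
  assume "\<phi> \<in> test_functions U"
  then have "Ck 0 \<phi>" unfolding test_functions_def by blast
  then show ?thesis by (auto intro: continuous_on_subset)
qed

lemma test_function_measurable:
  "\<phi> \<in> test_functions U \<Longrightarrow> \<phi> \<in> borel_measurable (lebesgue_on S)"
proof -
  assume "\<phi> \<in> test_functions U"
  then have "continuous_on UNIV \<phi>" by (rule test_function_continuous)
  then have "\<phi> \<in> borel_measurable lebesgue"
    by (simp add: borel_measurable_continuous_onI measurable_completion)
  then show ?thesis by (rule measurable_restrict_space1)
qed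

lemma test_function_bounded:
  assumes "\<phi> \<in> test_functions U"
  shows "\<exists>C. \<forall>x. \<bar>\<phi> x\<bar> \<le> C"
proof -
  let ?K = "closure {x. \<phi> x \<noteq> 0}"
  have "compact ?K" using assms unfolding test_functions_def by blast
  then have "bounded (\<phi> ` ?K)"
    by (intro compact_imp_bounded compact_continuous_image test_function_continuous[OF assms])
  then obtain C where C: "\<And>x. x \<in> ?K \<Longrightarrow> \<bar>\<phi> x\<bar> \<le> C" by (auto simp: bounded_iff)
  have "\<bar>\<phi> x\<bar> \<le> max C 0" for x
    using C[of x] closure_subset[of "{x. \<phi> x \<noteq> 0}"] by (cases "\<phi> x = 0") fastforce+
  then show ?thesis by blast
qed

lemma integrable_mult_bounded:
  fixes f \<phi> :: "'a \<Rightarrow> real"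
  assumes "integrable M f" "\<phi> \<in> borel_measurable M" "\<And>x. \<bar>\<phi> x\<bar> \<le> C"
  shows "integrable M (\<lambda>x. f x * \<phi> x)"
proof (rule Bochner_Integration.integrable_bound)
  show "integrable M (\<lambda>x. C * \<bar>f x\<bar>)" using assms by auto
  show "AE x in M. norm (f x * \<phi> x) \<le> norm (C * \<bar>f x\<bar>)"
  proof (intro AE_I2)
    fix x
    have "0 \<le> C" using assms(3)[of x] by linarith
    then show "norm (f x * \<phi> x) \<le> norm (C * \<bar>f x\<bar>)"
      using mult_right_mono[OF assms(3)[of x], of "\<bar>f x\<bar>"] by (simp add: abs_mult mult.commute)
  qed
qed (use assms in auto)

lemma integrable_mult_test_function:
  assumes "integrable (lebesgue_on S) f" "\<phi> \<in> test_functions U"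
  shows "integrable (lebesgue_on S) (\<lambda>t. f t * \<phi> t)"
  using test_function_bounded[OF assms(2)] integrable_mult_bounded[OF assms(1) test_function_measurable[OF assms(2)]]
  by blast

lemma integrable_test_function:
  assumes "\<phi> \<in> test_functions U"
  shows "integrable lebesgue \<phi>"
proof -
  have m: "\<phi> \<in> borel_measurable lebesgue"
    using test_function_measurable[OF assms, of UNIV] by (simp add: lebesgue_on_UNIV_eq)
  obtain C where C: "\<And>x. \<bar>\<phi> x\<bar> \<le> C" using test_function_bounded[OF assms] by blast
  let ?K = "closure {x. \<phi> x \<noteq> 0}"
  have K: "?K \<in> lmeasurable" using assms by (simp add: test_functions_def lmeasurable_compact)
  have "integrable lebesgue (indicat_real ?K)" using K by (simp add: fmeasurable_def)
  from integrable_mult_bounded[OF this m C]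
  have "integrable lebesgue (\<lambda>x. indicator ?K x * \<phi> x)" .
  moreover have "indicator ?K x * \<phi> x = \<phi> x" for x
    using closure_subset[of "{x. \<phi> x \<noteq> 0}"] by (auto simp: indicator_def)
  ultimately show ?thesis by simp
qed

lemma L2_space_test_function:
  assumes "\<phi> \<in> test_functions U" "S \<in> sets lebesgue"
  shows "\<phi> \<in> L2_space (lebesgue_on S)"
proof -
  have "integrable (lebesgue_on S) \<phi>"
    using integrable_lebesgue_on_subset[of UNIV \<phi> S] integrable_test_function[OF assms(1)] assms(2)
    by (simp add: lebesgue_on_UNIV_eq)
  from integrable_mult_test_function[OF this assms(1)] show ?thesis using test_function_measurable[OF assms(1)] by (simp add: L2_space_def power2_eq_square)
qed

text \<open>The components of \<open>g - h\<close> integrate to zero against all test functions. As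
  \<open>wgrad\<close> is a \<open>SOME\<close> choice, this is what makes it linear up to null
  sets.\<close>

lemma has_weak_grad_unique:
  fixes f :: "'a::euclidean_space \<Rightarrow> real"
  assumes U: "open U" and g: "has_weak_grad U f g" and h: "has_weak_grad U f h"
  shows "AE x in lebesgue_on U. g x = h x"
proof -
  have Us: "U \<in> sets lebesgue" using U by auto
  have gh: "g \<in> L2_space (lebesgue_on U)" "h \<in> L2_space (lebesgue_on U)"
    using g h by (auto simp: has_weak_grad_def)
  have inner_L2: "(\<lambda>x. k x \<bullet> i) \<in> L2_space (lebesgue_on S)"
    if k: "k \<in> L2_space (lebesgue_on S)" and i: "i \<in> Basis" for k :: "'a \<Rightarrow> 'a" and i S
  proof -
    have "integrable (lebesgue_on S) (\<lambda>x. (norm (k x \<bullet> i))\<^sup>2)"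
    proof (rule Bochner_Integration.integrable_bound[OF L2_space_integrable[OF k]])
      show "AE x in lebesgue_on S. norm ((norm (k x \<bullet> i))\<^sup>2) \<le> norm ((norm (k x))\<^sup>2)"
        using Basis_le_norm[OF i] by (simp add: abs_le_square_iff[symmetric])
    qed (use k in \<open>auto dest!: L2_space_measurable\<close>)
    then show ?thesis using k by (auto simp: L2_space_def)
  qed
  have "AE x in lebesgue_on U. (g - h) x \<bullet> i = 0" if i: "i \<in> Basis" for i
  proof (rule AE_eq_0_if_test_integrals_0[OF U])
    fix a b assume ab: "cbox a b \<subseteq> U"
    have "g - h \<in> L2_space (lebesgue_on (cbox a b))"
      using L2_space_lebesgue_on_subset[OF L2_space_diff[OF gh] ab Us] by simp
    then show "integrable (lebesgue_on (cbox a b)) (\<lambda>x. (g - h) x \<bullet> i)"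
      by (intro L2_space_integrable_finite inner_L2 i finite_measure_lebesgue_on_cbox)
  next
    fix \<phi> assume \<phi>: "\<phi> \<in> test_functions U"
    have "(LINT x|lebesgue_on U. (g - h) x \<bullet> i * \<phi> x)
        = (LINT x|lebesgue_on U. (g x \<bullet> i) * \<phi> x - (h x \<bullet> i) * \<phi> x)"
      by (simp add: inner_diff_left algebra_simps)
    also have "\<dots> = (LINT x|lebesgue_on U. (g x \<bullet> i) * \<phi> x) - (LINT x|lebesgue_on U. (h x \<bullet> i) * \<phi> x)"
      using integrable_L2_inner[OF inner_L2[OF gh(1) i] L2_space_test_function[OF \<phi> Us]]
        integrable_L2_inner[OF inner_L2[OF gh(2) i] L2_space_test_function[OF \<phi> Us]]
      by (intro Bochner_Integration.integral_diff) auto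
    also have "\<dots> = 0" using g h \<phi> i by (simp add: has_weak_grad_def)
    finally show "(LINT x|lebesgue_on U. (g - h) x \<bullet> i * \<phi> x) = 0" .
  qed
  then have "AE x in lebesgue_on U. \<forall>i\<in>Basis. (g - h) x \<bullet> i = 0"
    by (intro AE_finite_allI) auto
  then show ?thesis
    by eventually_elim (auto intro: euclidean_eqI simp: inner_diff_left)
qed

lemma frechet_derivative_test_function:
  assumes "\<phi> \<in> test_functions U" "i \<in> Basis"
  shows "(\<lambda>x. frechet_derivative \<phi> (at x) i) \<in> test_functions U"
proof -
  let ?d = "\<lambda>x. frechet_derivative \<phi> (at x) i"
  let ?K = "closure {x. \<phi> x \<noteq> 0}"
  have Ck: "Ck (Suc k) \<phi>" for k using assms(1) unfolding test_functions_def by blast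
  have "?d x = 0" if x: "x \<notin> ?K" for x
  proof -
    have "(\<phi> has_derivative (\<lambda>_. 0)) (at x)"
    proof (rule has_derivative_transform_within_open)
      show "((\<lambda>_. 0) has_derivative (\<lambda>_. 0)) (at x)" by simp
      show "open (- ?K)" "x \<in> - ?K" using x by auto
      show "0 = \<phi> y" if "y \<in> - ?K" for y
        using that closure_subset[of "{x. \<phi> x \<noteq> 0}"] by auto
    qed
    from frechet_derivative_at[OF this] show ?thesis by (metis)
  qed
  then have sub: "{x. ?d x \<noteq> 0} \<subseteq> ?K" by blast
  then have cl: "closure {x. ?d x \<noteq> 0} \<subseteq> ?K" by (rule closure_minimal) simp
  then have "compact (closure {x. ?d x \<noteq> 0})"
    using assms(1) by (auto simp: test_functions_def compact_eq_bounded_closed intro: bounded_subset)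
  then show ?thesis
    using Ck cl assms by (auto simp: test_functions_def)
qed

lemma has_weak_grad_comb:
  assumes U: "U \<in> sets lebesgue" and f: "has_weak_grad U f f'" and g: "has_weak_grad U g g'"
  shows "has_weak_grad U (\<lambda>x. a * f x + b * g x) (\<lambda>x. a *\<^sub>R f' x + b *\<^sub>R g' x)"
  unfolding has_weak_grad_def
proof (intro conjI ballI)
  have L2: "f \<in> L2_space (lebesgue_on U)" "g \<in> L2_space (lebesgue_on U)"
    "f' \<in> L2_space (lebesgue_on U)" "g' \<in> L2_space (lebesgue_on U)"
    using f g by (auto simp: has_weak_grad_def)
  show "(\<lambda>x. a * f x + b * g x) \<in> L2_space (lebesgue_on U)"
    using L2_space_comb[OF L2(1,2)] by simp
  show "(\<lambda>x. a *\<^sub>R f' x + b *\<^sub>R g' x) \<in> L2_space (lebesgue_on U)"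
    using L2_space_comb[OF L2(3,4)] .
  fix \<phi> :: "'a \<Rightarrow> real" and i :: 'a assume \<phi>: "\<phi> \<in> test_functions U" and i: "i \<in> Basis"
  let ?d = "\<lambda>x. frechet_derivative \<phi> (at x) i"
  have d: "?d \<in> L2_space (lebesgue_on U)"
    using L2_space_test_function[OF frechet_derivative_test_function[OF \<phi> i] U] .
  have p: "(\<lambda>x. \<phi> x *\<^sub>R i) \<in> L2_space (lebesgue_on U)"
    using L2_space_test_function[OF \<phi> U] i by (auto simp: L2_space_def intro!: borel_measurable_scaleR)
  have "(LINT x|lebesgue_on U. (a * f x + b * g x) * ?d x) = L2_inner (lebesgue_on U) (\<lambda>x. a *\<^sub>R f x + b *\<^sub>R g x) ?d"
    by (simp add: L2_inner_def)
  also have "\<dots> = a * L2_inner (lebesgue_on U) f ?d + b * L2_inner (lebesgue_on U) g ?d"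
    by (rule L2_inner_comb[OF L2(1,2) d])
  also have "L2_inner (lebesgue_on U) f ?d = - L2_inner (lebesgue_on U) f' (\<lambda>x. \<phi> x *\<^sub>R i)"
    using f \<phi> i by (simp add: has_weak_grad_def L2_inner_def mult.commute)
  also have "L2_inner (lebesgue_on U) g ?d = - L2_inner (lebesgue_on U) g' (\<lambda>x. \<phi> x *\<^sub>R i)"
    using g \<phi> i by (simp add: has_weak_grad_def L2_inner_def mult.commute)
  also have "a * - L2_inner (lebesgue_on U) f' (\<lambda>x. \<phi> x *\<^sub>R i) + b * - L2_inner (lebesgue_on U) g' (\<lambda>x. \<phi> x *\<^sub>R i)
      = - L2_inner (lebesgue_on U) (\<lambda>x. a *\<^sub>R f' x + b *\<^sub>R g' x) (\<lambda>x. \<phi> x *\<^sub>R i)"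
    by (simp only: L2_inner_comb[OF L2(3,4) p])
  also have "\<dots> = - (LINT x|lebesgue_on U. ((a *\<^sub>R f' x + b *\<^sub>R g' x) \<bullet> i) * \<phi> x)"
    by (simp add: L2_inner_def mult.commute)
  finally show "(LINT x|lebesgue_on U. (a * f x + b * g x) * ?d x)
      = - (LINT x|lebesgue_on U. ((a *\<^sub>R f' x + b *\<^sub>R g' x) \<bullet> i) * \<phi> x)" .
qed

lemma has_weak_grad_wgrad: "f \<in> W12 U \<Longrightarrow> has_weak_grad U f (wgrad U f)"
  unfolding W12_def wgrad_def mem_Collect_eq by (rule someI_ex[where P = "has_weak_grad U f"])

lemma W12_comb:
  "U \<in> sets lebesgue \<Longrightarrow> f \<in> W12 U \<Longrightarrow> g \<in> W12 U \<Longrightarrow> (\<lambda>x. a * f x + b * g x) \<in> W12 U"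
  using has_weak_grad_comb unfolding W12_def by blast

lemma wgrad_comb_AE:
  assumes "open U" "f \<in> W12 U" "g \<in> W12 U"
  shows "AE x in lebesgue_on U. wgrad U (\<lambda>x. a * f x + b * g x) x = a *\<^sub>R wgrad U f x + b *\<^sub>R wgrad U g x"
proof (rule has_weak_grad_unique[OF assms(1)])
  have U: "U \<in> sets lebesgue" using assms(1) by auto
  show "has_weak_grad U (\<lambda>x. a * f x + b * g x) (wgrad U (\<lambda>x. a * f x + b * g x))"
    by (rule has_weak_grad_wgrad[OF W12_comb[OF U assms(2,3)]])
  show "has_weak_grad U (\<lambda>x. a * f x + b * g x) (\<lambda>x. a *\<^sub>R wgrad U f x + b *\<^sub>R wgrad U g x)"
    using has_weak_grad_comb[OF U] has_weak_grad_wgrad assms(2,3) by blast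
qed

lemma W12_L2: "f \<in> W12 U \<Longrightarrow> f \<in> L2_space (lebesgue_on U)"
  and wgrad_L2: "f \<in> W12 U \<Longrightarrow> wgrad U f \<in> L2_space (lebesgue_on U)"
  using has_weak_grad_wgrad by (auto simp: has_weak_grad_def)

section \<open>The spaces \<open>V\<close> and \<open>V'\<close>\<close>

locale evolution_triple =
  fixes \<Omega> \<Gamma>D :: "'a::euclidean_space set"
  assumes open_\<Omega>: "open \<Omega>"
begin

abbreviation "\<mu> \<equiv> lebesgue_on \<Omega>"
abbreviation "V \<equiv> W12_D \<Omega> \<Gamma>D"
abbreviation "V' \<equiv> V_dual \<Omega> \<Gamma>D"
abbreviation "normV \<equiv> V_norm \<Omega>"
abbreviation "normV' \<equiv> V_dual_norm \<Omega> \<Gamma>D"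
abbreviation "grad \<equiv> wgrad \<Omega>"

section \<open>\<open>V\<close> as a linear space with a seminorm\<close>

lemma sets_\<Omega>: "\<Omega> \<in> sets lebesgue"
  using open_\<Omega> by auto

lemma L2_norm_wgrad_comb:
  assumes "z \<in> W12 \<Omega>" "w \<in> W12 \<Omega>" "k \<in> L2_space \<mu>"
  shows "L2_norm \<mu> (grad (\<lambda>x. a * z x + b * w x) - k) = L2_norm \<mu> ((\<lambda>x. a *\<^sub>R grad z x + b *\<^sub>R grad w x) - k)"
proof (rule L2_norm_cong_AE)
  show "grad (\<lambda>x. a * z x + b * w x) - k \<in> borel_measurable \<mu>"
    by (intro L2_space_measurable L2_space_diff wgrad_L2 W12_comb assms sets_\<Omega>)
  show "(\<lambda>x. a *\<^sub>R grad z x + b *\<^sub>R grad w x) - k \<in> borel_measurable \<mu>"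
    by (intro L2_space_measurable L2_space_diff L2_space_comb wgrad_L2 assms)
  show "AE x in \<mu>. (grad (\<lambda>x. a * z x + b * w x) - k) x = ((\<lambda>x. a *\<^sub>R grad z x + b *\<^sub>R grad w x) - k) x"
    using wgrad_comb_AE[OF open_\<Omega> assms(1,2)] by eventually_elim simp
qed

lemma V_W12: "z \<in> V \<Longrightarrow> z \<in> W12 \<Omega>"
  by (simp add: W12_D_def)

lemma V_L2: "z \<in> V \<Longrightarrow> z \<in> L2_space \<mu>"
  and grad_L2: "z \<in> V \<Longrightarrow> grad z \<in> L2_space \<mu>"
  by (auto intro: W12_L2 wgrad_L2 V_W12)

text \<open>The approximating sequences are combined termwise. Gradients need care:
  \<open>grad\<close> of a combination is the combination of the gradients only almost everywhere,
  so the norms are rewritten on both sides of the difference. This makes \<open>V\<close> a linear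
  space.\<close>

lemma has_trace_comb:
  assumes "has_trace \<Omega> v g" "has_trace \<Omega> w h"
  shows "has_trace \<Omega> (\<lambda>x. a * v x + b * w x) (\<lambda>x. a * g x + b * h x)"
proof -
  let ?S = "surface_measure \<Omega>"
  have v: "v \<in> W12 \<Omega>" "g \<in> L2_space ?S" and w: "w \<in> W12 \<Omega>" "h \<in> L2_space ?S"
    using assms by (auto simp: has_trace_def)
  obtain \<phi> where \<phi>: "\<And>n. \<phi> n \<in> W12 \<Omega>" "\<And>n. continuous_on (closure \<Omega>) (\<phi> n)" "\<And>n. \<phi> n \<in> L2_space ?S"
    "(\<lambda>n. L2_norm \<mu> (\<phi> n - v)) \<longlonglongrightarrow> 0" "(\<lambda>n. L2_norm \<mu> (grad (\<phi> n) - grad v)) \<longlonglongrightarrow> 0"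
    "(\<lambda>n. L2_norm ?S (\<phi> n - g)) \<longlonglongrightarrow> 0"
    using assms(1) unfolding has_trace_def by blast
  obtain \<psi> where \<psi>: "\<And>n. \<psi> n \<in> W12 \<Omega>" "\<And>n. continuous_on (closure \<Omega>) (\<psi> n)" "\<And>n. \<psi> n \<in> L2_space ?S"
    "(\<lambda>n. L2_norm \<mu> (\<psi> n - w)) \<longlonglongrightarrow> 0" "(\<lambda>n. L2_norm \<mu> (grad (\<psi> n) - grad w)) \<longlonglongrightarrow> 0"
    "(\<lambda>n. L2_norm ?S (\<psi> n - h)) \<longlonglongrightarrow> 0"
    using assms(2) unfolding has_trace_def by blast
  define \<theta> where "\<theta> n = (\<lambda>x. a * \<phi> n x + b * \<psi> n x)" for n
  have eq: "\<theta> n - (\<lambda>x. a * v x + b * w x) = (\<lambda>x. a *\<^sub>R (\<phi> n - v) x + b *\<^sub>R (\<psi> n - w) x)"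
    "\<theta> n - (\<lambda>x. a * g x + b * h x) = (\<lambda>x. a *\<^sub>R (\<phi> n - g) x + b *\<^sub>R (\<psi> n - h) x)" for n
    by (auto simp: \<theta>_def fun_eq_iff algebra_simps)
  have 1: "(\<lambda>n. L2_norm \<mu> (\<theta> n - (\<lambda>x. a * v x + b * w x))) \<longlonglongrightarrow> 0"
    unfolding eq by (intro L2_norm_comb_tendsto_0 L2_space_diff W12_L2 \<phi> \<psi> v w)
  have 2: "(\<lambda>n. L2_norm ?S (\<theta> n - (\<lambda>x. a * g x + b * h x))) \<longlonglongrightarrow> 0"
    unfolding eq by (intro L2_norm_comb_tendsto_0 L2_space_diff \<phi> \<psi> v w)
  have "L2_norm \<mu> (grad (\<theta> n) - grad (\<lambda>x. a * v x + b * w x))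
      = L2_norm \<mu> (\<lambda>x. a *\<^sub>R (grad (\<phi> n) - grad v) x + b *\<^sub>R (grad (\<psi> n) - grad w) x)" for n
  proof -
    have "L2_norm \<mu> (grad (\<theta> n) - grad (\<lambda>x. a * v x + b * w x))
        = L2_norm \<mu> ((\<lambda>x. a *\<^sub>R grad v x + b *\<^sub>R grad w x) - grad (\<theta> n))"
      unfolding \<theta>_def
      by (subst L2_norm_minus_commute) (intro L2_norm_wgrad_comb v w wgrad_L2 W12_comb sets_\<Omega> \<phi> \<psi>)
    also have "\<dots> = L2_norm \<mu> (grad (\<theta> n) - (\<lambda>x. a *\<^sub>R grad v x + b *\<^sub>R grad w x))"
      by (rule L2_norm_minus_commute)
    also have "\<dots> = L2_norm \<mu> ((\<lambda>x. a *\<^sub>R grad (\<phi> n) x + b *\<^sub>R grad (\<psi> n) x) - (\<lambda>x. a *\<^sub>R grad v x + b *\<^sub>R grad w x))"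
      unfolding \<theta>_def
      by (intro L2_norm_wgrad_comb v w wgrad_L2 L2_space_comb \<phi> \<psi>)
    finally show ?thesis by (simp add: fun_diff_def algebra_simps)
  qed
  then have 3: "(\<lambda>n. L2_norm \<mu> (grad (\<theta> n) - grad (\<lambda>x. a * v x + b * w x))) \<longlonglongrightarrow> 0"
    by (simp only:) (intro L2_norm_comb_tendsto_0 L2_space_diff wgrad_L2 \<phi> \<psi> v w)
  have "\<theta> n \<in> W12 \<Omega>" "continuous_on (closure \<Omega>) (\<theta> n)" "\<theta> n \<in> L2_space ?S" for n
    using L2_space_comb[OF \<phi>(3) \<psi>(3)]
    by (auto simp: \<theta>_def intro!: W12_comb sets_\<Omega> \<phi> \<psi> continuous_intros)
  then show ?thesis
    using 1 2 3 v w W12_comb[OF sets_\<Omega>] L2_space_comb[OF v(2) w(2)]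
    unfolding has_trace_def by auto
qed

lemma V_comb:
  assumes "z \<in> V" "w \<in> V"
  shows "(\<lambda>x. a * z x + b * w x) \<in> V"
proof -
  obtain g h where gh: "has_trace \<Omega> z g" "has_trace \<Omega> w h"
    "AE x in surface_measure \<Omega>. x \<in> \<Gamma>D \<longrightarrow> g x = 0" "AE x in surface_measure \<Omega>. x \<in> \<Gamma>D \<longrightarrow> h x = 0"
    using assms by (auto simp: W12_D_def)
  have "AE x in surface_measure \<Omega>. x \<in> \<Gamma>D \<longrightarrow> a * g x + b * h x = 0"
    using gh(3,4) by eventually_elim simp
  moreover have "(\<lambda>x. a * z x + b * w x) \<in> W12 \<Omega>"
    using has_trace_comb[OF gh(1,2)] by (simp add: has_trace_def)
  ultimately show ?thesis
    using has_trace_comb[OF gh(1,2)] unfolding W12_D_def by blast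
qed

lemma V_zero: "(\<lambda>x. 0) \<in> V"
proof -
  have W: "(\<lambda>x. 0) \<in> W12 \<Omega>"
    unfolding W12_def by (auto simp: has_weak_grad_def L2_space_zero intro!: exI[of _ "\<lambda>x. 0"])
  have "has_trace \<Omega> (\<lambda>x. 0) (\<lambda>x. 0)"
    unfolding has_trace_def using W by (auto simp: L2_space_zero L2_norm_0 intro!: exI[of _ "\<lambda>n x. 0"])
  then show ?thesis using W by (auto simp: W12_D_def)
qed

lemma V_diff: "z \<in> V \<Longrightarrow> w \<in> V \<Longrightarrow> z - w \<in> V"
  and V_add: "z \<in> V \<Longrightarrow> w \<in> V \<Longrightarrow> (\<lambda>x. z x + w x) \<in> V"
  using V_comb[of z w 1 "-1"] V_comb[of z w 1 1] by (simp_all add: fun_diff_def)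

lemma grad_comb_AE:
  "z \<in> V \<Longrightarrow> w \<in> V \<Longrightarrow> AE x in \<mu>. grad (\<lambda>x. a * z x + b * w x) x = a *\<^sub>R grad z x + b *\<^sub>R grad w x"
  using wgrad_comb_AE open_\<Omega> V_W12 by blast

lemma grad_diff_AE:
  "z \<in> V \<Longrightarrow> w \<in> V \<Longrightarrow> AE x in \<mu>. grad (z - w) x = (grad z - grad w) x"
  using grad_comb_AE[of z w 1 "-1"] by (simp add: fun_diff_def)

lemma normV_comb: "z \<in> V \<Longrightarrow> w \<in> V \<Longrightarrow>
    normV (\<lambda>x. a * z x + b * w x) = L2_norm \<mu> (\<lambda>x. a *\<^sub>R grad z x + b *\<^sub>R grad w x)"
  unfolding V_norm_def using grad_comb_AE
  by (intro L2_norm_cong_AE) (auto intro!: L2_space_measurable L2_space_comb grad_L2 V_comb)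

lemma normV_diff: "z \<in> V \<Longrightarrow> w \<in> V \<Longrightarrow> normV (z - w) = L2_norm \<mu> (grad z - grad w)"
  using normV_comb[of z w 1 "-1"] by (simp add: fun_diff_def)

lemma normV_scale: "z \<in> V \<Longrightarrow> normV (\<lambda>x. c * z x) = \<bar>c\<bar> * normV z"
  using normV_comb[of z z c 0] by (simp add: V_norm_def L2_norm_scaleR)

lemma normV_nonneg: "0 \<le> normV z"
  by (simp add: V_norm_def)

lemma normV_zero: "normV (\<lambda>x. 0) = 0"
  using normV_scale[OF V_zero, of 0] by simp

section \<open>The dual space \<open>V'\<close> and its norm\<close>

lemma V'_comb:
  assumes "\<xi> \<in> V'" "z \<in> V" "w \<in> V"
  shows "\<xi> (\<lambda>x. a * z x + b * w x) = a * \<xi> z + b * \<xi> w"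
proof -
  have "(\<lambda>x. a * z x) \<in> V" "(\<lambda>x. b * w x) \<in> V"
    using V_comb[OF assms(2,2), of a 0] V_comb[OF assms(3,3), of b 0] by simp_all
  then have "\<xi> (\<lambda>x. a * z x + b * w x) = \<xi> (\<lambda>x. a * z x) + \<xi> (\<lambda>x. b * w x)"
    using assms(1) by (simp add: V_dual_def)
  also have "\<dots> = a * \<xi> z + b * \<xi> w" using assms by (simp add: V_dual_def)
  finally show ?thesis .
qed

lemma V'_diff: "\<xi> \<in> V' \<Longrightarrow> z \<in> V \<Longrightarrow> w \<in> V \<Longrightarrow> \<xi> (z - w) = \<xi> z - \<xi> w"
  using V'_comb[of \<xi> z w 1 "-1"] by (simp add: fun_diff_def)

lemma V'_add: "\<xi> \<in> V' \<Longrightarrow> z \<in> V \<Longrightarrow> w \<in> V \<Longrightarrow> \<xi> (\<lambda>x. z x + w x) = \<xi> z + \<xi> w"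
  using V'_comb[of \<xi> z w 1 1] by simp

text \<open>A real \<open>SUP\<close> has its meaning only for a set that is bounded above; bounding
  \<open>\<bar>\<xi> z\<bar>\<close> by \<open>normV'\<close> rests on this.\<close>

lemma V'_bdd_above:
  assumes "\<xi> \<in> V'"
  shows "bdd_above ((\<lambda>z. \<bar>\<xi> z\<bar>) ` {z \<in> V. normV z \<le> 1})"
proof -
  obtain C where C: "\<And>z. z \<in> V \<Longrightarrow> \<bar>\<xi> z\<bar> \<le> C * normV z"
    using assms unfolding V_dual_def by blast
  show ?thesis
  proof (rule bdd_aboveI2)
    fix z assume z: "z \<in> {z \<in> V. normV z \<le> 1}"
    have "C * normV z \<le> \<bar>C\<bar> * 1"
      using z normV_nonneg[of z] by (intro mult_mono) auto
    then show "\<bar>\<xi> z\<bar> \<le> \<bar>C\<bar>" using C[of z] z by simp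
  qed
qed

lemma V'_unit_le: "\<xi> \<in> V' \<Longrightarrow> z \<in> V \<Longrightarrow> normV z \<le> 1 \<Longrightarrow> \<bar>\<xi> z\<bar> \<le> normV' \<xi>"
  unfolding V_dual_norm_def by (rule cSUP_upper2[OF V'_bdd_above, of _ z]) auto

lemma normV'_nonneg: "\<xi> \<in> V' \<Longrightarrow> 0 \<le> normV' \<xi>"
  using V'_unit_le[OF _ V_zero] normV_zero by (metis abs_ge_zero order_trans zero_le_one)

lemma V'_le:
  assumes "\<xi> \<in> V'" "z \<in> V"
  shows "\<bar>\<xi> z\<bar> \<le> normV' \<xi> * normV z"
proof (cases "normV z = 0")
  \<comment> \<open>Scaling \<open>z\<close> to norm 1 is impossible here, but the constant in the
    definition of \<open>V_dual\<close> forces \<open>\<xi> z = 0\<close>.\<close>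
  case True
  then show ?thesis using assms by (auto simp: V_dual_def)
next
  case False
  let ?c = "normV z"
  have c: "0 < ?c" using False normV_nonneg[of z] by simp
  have "(\<lambda>x. (1 / ?c) * z x) \<in> V" using V_comb[OF assms(2,2), of "1 / ?c" 0] by simp
  then have "\<bar>\<xi> (\<lambda>x. (1 / ?c) * z x)\<bar> \<le> normV' \<xi>"
    using c normV_scale[OF assms(2), of "1 / ?c"] by (intro V'_unit_le assms(1)) auto
  moreover have "\<xi> (\<lambda>x. (1 / ?c) * z x) = (1 / ?c) * \<xi> z"
    using V'_comb[OF assms(1,2,2), of "1 / ?c" 0] by simp
  ultimately show ?thesis using c by (simp add: abs_mult pos_divide_le_eq)
qed

lemma normV'_le:
  assumes "0 \<le> B" "\<And>z. z \<in> V \<Longrightarrow> \<bar>\<xi> z\<bar> \<le> B * normV z"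
  shows "normV' \<xi> \<le> B"
  unfolding V_dual_norm_def
proof (rule cSUP_least)
  show "{z \<in> V. normV z \<le> 1} \<noteq> {}" using V_zero normV_zero by auto
  fix z assume "z \<in> {z \<in> V. normV z \<le> 1}"
  then show "\<bar>\<xi> z\<bar> \<le> B" using assms(2)[of z] mult_left_le[OF _ assms(1), of "normV z"] by auto
qed

lemma normV'_cong: "(\<And>z. z \<in> V \<Longrightarrow> \<xi> z = \<eta> z) \<Longrightarrow> normV' \<xi> = normV' \<eta>"
  unfolding V_dual_norm_def by (intro SUP_cong) auto

lemma V'_cong:
  assumes "\<xi> \<in> V'" "\<And>z. z \<in> V \<Longrightarrow> \<xi> z = \<eta> z"
  shows "\<eta> \<in> V'"
proof -
  have "\<eta> (\<lambda>x. z x + w x) = \<eta> z + \<eta> w" if "z \<in> V" "w \<in> V" for z w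
    using that assms V_add[OF that] V'_add by metis
  moreover have "\<eta> (\<lambda>x. c * z x) = c * \<eta> z" if "z \<in> V" for c z
    using that assms V_comb[OF that that, of c 0] V'_comb[OF assms(1) that that, of c 0] by simp
  ultimately show ?thesis using assms by (auto simp: V_dual_def)
qed

lemma V'_lin_comb:
  assumes "\<xi> \<in> V'" "\<eta> \<in> V'"
  shows "(\<lambda>z. a * \<xi> z + b * \<eta> z) \<in> V'"
    and "normV' (\<lambda>z. a * \<xi> z + b * \<eta> z) \<le> \<bar>a\<bar> * normV' \<xi> + \<bar>b\<bar> * normV' \<eta>"
proof -
  have le: "\<bar>a * \<xi> z + b * \<eta> z\<bar> \<le> (\<bar>a\<bar> * normV' \<xi> + \<bar>b\<bar> * normV' \<eta>) * normV z" if z: "z \<in> V" for z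
  proof -
    have "\<bar>a * \<xi> z + b * \<eta> z\<bar> \<le> \<bar>a\<bar> * \<bar>\<xi> z\<bar> + \<bar>b\<bar> * \<bar>\<eta> z\<bar>"
      using abs_triangle_ineq[of "a * \<xi> z" "b * \<eta> z"] by (simp add: abs_mult)
    also have "\<dots> \<le> \<bar>a\<bar> * (normV' \<xi> * normV z) + \<bar>b\<bar> * (normV' \<eta> * normV z)"
      using V'_le[OF assms(1) z] V'_le[OF assms(2) z] by (intro add_mono mult_left_mono) auto
    finally show ?thesis by (simp add: algebra_simps)
  qed
  show "normV' (\<lambda>z. a * \<xi> z + b * \<eta> z) \<le> \<bar>a\<bar> * normV' \<xi> + \<bar>b\<bar> * normV' \<eta>"
    using le assms by (intro normV'_le) (auto intro!: add_nonneg_nonneg mult_nonneg_nonneg normV'_nonneg)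
  show "(\<lambda>z. a * \<xi> z + b * \<eta> z) \<in> V'"
    unfolding V_dual_def
  proof (intro CollectI conjI ballI allI exI)
    show "\<bar>a * \<xi> z + b * \<eta> z\<bar> \<le> (\<bar>a\<bar> * normV' \<xi> + \<bar>b\<bar> * normV' \<eta>) * normV z" if "z \<in> V" for z
      by (rule le[OF that])
  qed (use V'_add[OF assms(1)] V'_add[OF assms(2)] V'_comb[OF assms(1), of _ _ _ 0] V'_comb[OF assms(2), of _ _ _ 0]
    in \<open>auto simp: algebra_simps\<close>)
qed

lemma V'_minus: "\<xi> \<in> V' \<Longrightarrow> \<eta> \<in> V' \<Longrightarrow> \<xi> - \<eta> \<in> V'"
  using V'_lin_comb(1)[of \<xi> \<eta> 1 "-1"] by (simp add: fun_diff_def)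

lemma normV'_minus: "\<xi> \<in> V' \<Longrightarrow> \<eta> \<in> V' \<Longrightarrow> normV' (\<xi> - \<eta>) \<le> normV' \<xi> + normV' \<eta>"
  using V'_lin_comb(2)[of \<xi> \<eta> 1 "-1"] by (simp add: fun_diff_def)

lemma V'_zero_fun: "(\<lambda>z. 0) \<in> V'"
  using normV_nonneg by (auto simp: V_dual_def intro!: exI[of _ 0])

lemma normV'_zero_fun: "normV' (\<lambda>z. 0) = 0"
  using normV'_le[of 0 "\<lambda>z. 0"] normV'_nonneg[OF V'_zero_fun] by simp

section \<open>The adjoint of the gradient and the Riesz isometry\<close>

lemma grad_adj_eq: "grad_adj \<Omega> y z = L2_inner \<mu> y (grad z)"
  by (simp add: grad_adj_def L2_inner_def)

lemma grad_adj_V':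
  assumes y: "y \<in> L2_space \<mu>"
  shows "grad_adj \<Omega> y \<in> V'" "normV' (grad_adj \<Omega> y) \<le> L2_norm \<mu> y"
proof -
  have le: "\<bar>grad_adj \<Omega> y z\<bar> \<le> L2_norm \<mu> y * normV z" if "z \<in> V" for z
    unfolding grad_adj_eq V_norm_def using that by (intro L2_Cauchy_Schwarz y grad_L2)
  have comb: "grad_adj \<Omega> y (\<lambda>x. a * z x + b * w x) = a * grad_adj \<Omega> y z + b * grad_adj \<Omega> y w"
    if zw: "z \<in> V" "w \<in> V" for a b z w
  proof -
    have "grad_adj \<Omega> y (\<lambda>x. a * z x + b * w x) = L2_inner \<mu> y (\<lambda>x. a *\<^sub>R grad z x + b *\<^sub>R grad w x)"
      unfolding grad_adj_eq using grad_comb_AE[OF zw] zw y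
      by (intro L2_inner_cong_AE) (auto intro!: L2_space_measurable grad_L2 V_comb L2_space_comb)
    also have "\<dots> = a * grad_adj \<Omega> y z + b * grad_adj \<Omega> y w"
      unfolding grad_adj_eq using zw by (intro L2_inner_comb_right grad_L2 y)
    finally show ?thesis .
  qed
  show "grad_adj \<Omega> y \<in> V'"
    using le comb[of _ _ 1 1] comb[of _ _ _ 0] by (auto simp: V_dual_def)
  show "normV' (grad_adj \<Omega> y) \<le> L2_norm \<mu> y"
    using le by (intro normV'_le) auto
qed

definition closed_grads :: "('a \<Rightarrow> 'a) set" where
  "closed_grads = {y \<in> L2_space \<mu>. \<exists>z. (\<forall>n. z n \<in> V) \<and> (\<lambda>n. L2_norm \<mu> (grad (z n) - y)) \<longlonglongrightarrow> 0}"

lemma closed_grads_L2: "y \<in> closed_grads \<Longrightarrow> y \<in> L2_space \<mu>"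
  by (simp add: closed_grads_def)

lemma grad_closed_grads: "z \<in> V \<Longrightarrow> grad z \<in> closed_grads"
  by (auto simp: closed_grads_def grad_L2 L2_norm_def intro!: exI[of _ "\<lambda>n. z"])

lemma closed_grads_comb:
  assumes "y \<in> closed_grads" "q \<in> closed_grads"
  shows "(\<lambda>x. a *\<^sub>R y x + b *\<^sub>R q x) \<in> closed_grads"
proof -
  have L2: "y \<in> L2_space \<mu>" "q \<in> L2_space \<mu>" using assms by (auto simp: closed_grads_def)
  obtain z where z: "\<And>n. z n \<in> V" "(\<lambda>n. L2_norm \<mu> (grad (z n) - y)) \<longlonglongrightarrow> 0"
    using assms(1) by (auto simp: closed_grads_def)
  obtain w where w: "\<And>n. w n \<in> V" "(\<lambda>n. L2_norm \<mu> (grad (w n) - q)) \<longlonglongrightarrow> 0"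
    using assms(2) by (auto simp: closed_grads_def)
  have "L2_norm \<mu> (grad (\<lambda>x. a * z n x + b * w n x) - (\<lambda>x. a *\<^sub>R y x + b *\<^sub>R q x))
      = L2_norm \<mu> (\<lambda>x. a *\<^sub>R (grad (z n) - y) x + b *\<^sub>R (grad (w n) - q) x)" for n
    using L2_norm_wgrad_comb[OF V_W12[OF z(1)] V_W12[OF w(1)] L2_space_comb[OF L2]]
    by (simp add: fun_diff_def algebra_simps)
  moreover have "(\<lambda>n. L2_norm \<mu> (\<lambda>x. a *\<^sub>R (grad (z n) - y) x + b *\<^sub>R (grad (w n) - q) x)) \<longlonglongrightarrow> 0"
    by (intro L2_norm_comb_tendsto_0 L2_space_diff grad_L2 z w L2)
  ultimately show ?thesis
    unfolding closed_grads_def using V_comb[OF z(1) w(1)] L2_space_comb[OF L2]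
    by (auto intro!: exI[of _ "\<lambda>n x. a * z n x + b * w n x"])
qed

text \<open>The upper bound holds for every square integrable \<open>y\<close>. For the lower one
  \<open>y\<close> itself is the extremal direction: gradients converging to it are inserted as
  arguments, and one factor \<open>L2_norm \<mu> y\<close> is cancelled in the limit.\<close>

lemma normV'_grad_adj:
  assumes "y \<in> closed_grads"
  shows "normV' (grad_adj \<Omega> y) = L2_norm \<mu> y"
proof (rule antisym)
  have y: "y \<in> L2_space \<mu>" using assms by (rule closed_grads_L2)
  show "normV' (grad_adj \<Omega> y) \<le> L2_norm \<mu> y" by (rule grad_adj_V'[OF y])
  obtain z where z: "\<And>n. z n \<in> V" "(\<lambda>n. L2_norm \<mu> (grad (z n) - y)) \<longlonglongrightarrow> 0"
    using assms by (auto simp: closed_grads_def)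
  have "(L2_norm \<mu> y)\<^sup>2 \<le> normV' (grad_adj \<Omega> y) * L2_norm \<mu> y"
  proof (rule LIMSEQ_le)
    show "(\<lambda>n. L2_inner \<mu> (grad (z n)) y) \<longlonglongrightarrow> (L2_norm \<mu> y)\<^sup>2"
      unfolding L2_norm_power2 by (rule L2_inner_diff_tendsto[OF grad_L2[OF z(1)] y y z(2)])
    show "(\<lambda>n. normV' (grad_adj \<Omega> y) * L2_norm \<mu> (grad (z n))) \<longlonglongrightarrow> normV' (grad_adj \<Omega> y) * L2_norm \<mu> y"
      by (intro tendsto_intros L2_norm_diff_tendsto grad_L2 z y)
    have "L2_inner \<mu> (grad (z n)) y \<le> normV' (grad_adj \<Omega> y) * L2_norm \<mu> (grad (z n))" for n
      using V'_le[OF grad_adj_V'(1)[OF y] z(1)[of n]] L2_inner_commute[of \<mu> y]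
      by (auto simp: grad_adj_eq V_norm_def)
    then show "\<exists>N. \<forall>n\<ge>N. L2_inner \<mu> (grad (z n)) y \<le> normV' (grad_adj \<Omega> y) * L2_norm \<mu> (grad (z n))"
      by blast
  qed
  then show "L2_norm \<mu> y \<le> normV' (grad_adj \<Omega> y)"
    using normV'_nonneg[OF grad_adj_V'(1)[OF y]] L2_norm_nonneg[of \<mu> y]
    by (cases "L2_norm \<mu> y = 0") (auto simp: power2_eq_square)
qed

lemma Riesz_V':
  assumes "\<xi> \<in> V'"
  shows "\<exists>y\<in>closed_grads. \<forall>z\<in>V. \<xi> z = grad_adj \<Omega> y z"
proof -
  have "\<exists>y\<in>L2_space \<mu>. (\<exists>z. (\<forall>n. z n \<in> V) \<and> (\<lambda>n. L2_norm \<mu> (grad (z n) - y)) \<longlonglongrightarrow> 0)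
    \<and> (\<forall>z\<in>V. \<xi> z = L2_inner \<mu> y (grad z))"
  proof (rule L2_Riesz_closure)
    show "V \<noteq> {}" using V_zero by blast
    show "\<exists>u\<in>V. (AE x in \<mu>. grad u x = a *\<^sub>R grad z x + b *\<^sub>R grad w x) \<and> \<xi> u = a * \<xi> z + b * \<xi> w"
      if "z \<in> V" "w \<in> V" for z w a b
      using that V_comb grad_comb_AE V'_comb[OF assms] by blast
    show "\<bar>\<xi> z\<bar> \<le> normV' \<xi> * L2_norm \<mu> (grad z)" if "z \<in> V" for z
      using V'_le[OF assms that] by (simp add: V_norm_def)
  qed (rule grad_L2)
  then show ?thesis by (auto simp: closed_grads_def grad_adj_eq)
qed

definition riesz :: "(('a \<Rightarrow> real) \<Rightarrow> real) \<Rightarrow> 'a \<Rightarrow> 'a" where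
  "riesz \<xi> = (SOME y. y \<in> closed_grads \<and> (\<forall>z\<in>V. \<xi> z = grad_adj \<Omega> y z))"

lemma riesz:
  assumes "\<xi> \<in> V'"
  shows "riesz \<xi> \<in> closed_grads" "riesz \<xi> \<in> L2_space \<mu>" "\<And>z. z \<in> V \<Longrightarrow> grad_adj \<Omega> (riesz \<xi>) z = \<xi> z"
proof -
  have "\<exists>y. y \<in> closed_grads \<and> (\<forall>z\<in>V. \<xi> z = grad_adj \<Omega> y z)" using Riesz_V'[OF assms] by blast
  from someI_ex[OF this] have *: "riesz \<xi> \<in> closed_grads \<and> (\<forall>z\<in>V. \<xi> z = grad_adj \<Omega> (riesz \<xi>) z)"
    unfolding riesz_def .
  then show "riesz \<xi> \<in> closed_grads" "riesz \<xi> \<in> L2_space \<mu>" "\<And>z. z \<in> V \<Longrightarrow> grad_adj \<Omega> (riesz \<xi>) z = \<xi> z"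
    using closed_grads_L2 by auto
qed

lemma L2_norm_riesz_diff:
  assumes "\<xi> \<in> V'" "\<eta> \<in> V'"
  shows "L2_norm \<mu> (riesz \<xi> - riesz \<eta>) = normV' (\<xi> - \<eta>)"
proof -
  have c: "riesz \<xi> - riesz \<eta> \<in> closed_grads"
    using closed_grads_comb[OF riesz(1)[OF assms(1)] riesz(1)[OF assms(2)], of 1 "-1"] by (simp add: fun_diff_def)
  have "normV' (\<xi> - \<eta>) = normV' (grad_adj \<Omega> (riesz \<xi> - riesz \<eta>))"
    using assms riesz
    by (intro normV'_cong) (simp add: grad_adj_eq L2_inner_diff grad_L2)
  then show ?thesis using normV'_grad_adj[OF c] by simp
qed

lemma L2_norm_riesz: "\<xi> \<in> V' \<Longrightarrow> L2_norm \<mu> (riesz \<xi>) = normV' \<xi>"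
  using normV'_grad_adj[OF riesz(1)] normV'_cong[of "grad_adj \<Omega> (riesz \<xi>)" \<xi>] riesz(3) by metis

lemma neg_laplace_V': "w \<in> V \<Longrightarrow> neg_laplace \<Omega> w \<in> V'"
  unfolding neg_laplace_def by (intro grad_adj_V' grad_L2)

text \<open>Both representatives lie in \<open>closed_grads\<close>, so the dual norm of the sum is
  an \<open>L^2\<close> norm and can be expanded. The mixed term is \<open>\<xi> w\<close> because
  \<open>riesz \<xi>\<close> is paired there with a gradient.\<close>

lemma normV'_add_neg_laplace:
  assumes "\<xi> \<in> V'" "w \<in> V"
  shows "(normV' (\<lambda>z. \<xi> z + neg_laplace \<Omega> w z))\<^sup>2 = (normV' \<xi>)\<^sup>2 + 2 * \<xi> w + (normV w)\<^sup>2"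
proof -
  let ?y = "\<lambda>x. 1 *\<^sub>R riesz \<xi> x + 1 *\<^sub>R grad w x"
  have y: "?y \<in> closed_grads"
    by (intro closed_grads_comb riesz grad_closed_grads assms)
  have "normV' (\<lambda>z. \<xi> z + neg_laplace \<Omega> w z) = normV' (grad_adj \<Omega> ?y)"
  proof (rule normV'_cong)
    fix z assume z: "z \<in> V"
    have "grad_adj \<Omega> ?y z = grad_adj \<Omega> (riesz \<xi>) z + neg_laplace \<Omega> w z"
      using L2_inner_comb[OF riesz(2)[OF assms(1)] grad_L2[OF assms(2)] grad_L2[OF z], of 1 1]
      by (simp add: grad_adj_eq neg_laplace_def)
    then show "\<xi> z + neg_laplace \<Omega> w z = grad_adj \<Omega> ?y z" using riesz(3)[OF assms(1) z] by simp
  qed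
  also have "\<dots> = L2_norm \<mu> ?y" by (rule normV'_grad_adj[OF y])
  finally have "(normV' (\<lambda>z. \<xi> z + neg_laplace \<Omega> w z))\<^sup>2
      = (L2_norm \<mu> (riesz \<xi>))\<^sup>2 + 2 * L2_inner \<mu> (riesz \<xi>) (grad w) + (normV w)\<^sup>2"
    using L2_norm_comb_power2[OF riesz(2)[OF assms(1)] grad_L2[OF assms(2)], of 1 1] by (simp add: V_norm_def)
  moreover have "L2_inner \<mu> (riesz \<xi>) (grad w) = \<xi> w"
    using riesz(3)[OF assms] by (simp add: grad_adj_eq)
  moreover have "L2_norm \<mu> (riesz \<xi>) = normV' \<xi>"
    by (rule L2_norm_riesz[OF assms(1)])
  ultimately show ?thesis by simp
qed

end

section \<open>Integrals over intervals and the lemma of du Bois-Reymond\<close>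

lemma integrable_on_subinterval_open:
  fixes f :: "real \<Rightarrow> real"
  assumes "integrable (lebesgue_on {a<..<b}) f" "a \<le> s" "t \<le> b"
  shows "f integrable_on {s..t}"
proof -
  have "f integrable_on {a<..<b}" using assms(1) by (intro integrable_on_lebesgue_on) auto
  then have "f integrable_on {a..b}" by (simp add: integrable_on_open_interval_real)
  then show ?thesis by (rule integrable_on_subinterval) (use assms in auto)
qed

lemma LINT_open_interval:
  fixes f :: "real \<Rightarrow> real"
  assumes "integrable (lebesgue_on {a<..<b}) f"
  shows "(LINT t|lebesgue_on {a<..<b}. f t) = integral {a..b} f"
  using lebesgue_integral_eq_integral[OF assms] by (simp add: integral_open_interval_real)

lemma integrable_lebesgue_on_open_subinterval:
  fixes f :: "real \<Rightarrow> real"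
  assumes "integrable (lebesgue_on {a<..<b}) f" "a \<le> s" "t \<le> b"
  shows "integrable (lebesgue_on {s<..<t}) f"
  by (rule integrable_lebesgue_on_subset[OF assms(1)]) (use assms in auto)

lemma AE_lebesgue_on_subset:
  assumes "AE x in lebesgue_on S. P x" "T \<subseteq> S" "S \<in> sets lebesgue" "T \<in> sets lebesgue"
  shows "AE x in lebesgue_on T. P x"
proof -
  have "AE x in lebesgue. x \<in> S \<longrightarrow> P x" using assms by (simp add: AE_restrict_space_iff)
  then have "AE x in lebesgue. x \<in> T \<longrightarrow> P x" by eventually_elim (use assms in blast)
  then show ?thesis using assms by (simp add: AE_restrict_space_iff)
qed

lemma finite_measure_lebesgue_on_interval: "finite_measure (lebesgue_on {a<..<b::real})"
  by (rule finite_measure_lebesgue_on) simp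

lemma AE_interval_imp_ex:
  assumes "a < (b::real)" "AE x in lebesgue_on {a<..<b}. P x"
  shows "\<exists>x\<in>{a<..<b}. P x"
proof (rule ccontr)
  assume n: "\<not> ?thesis"
  have "AE x in lebesgue_on {a<..<b}. False"
    using assms(2) AE_space by eventually_elim (use n in auto)
  then obtain M where M: "{x \<in> space (lebesgue_on {a<..<b}). \<not> False} \<subseteq> M"
    "emeasure (lebesgue_on {a<..<b}) M = 0" "M \<in> sets (lebesgue_on {a<..<b})" by (rule AE_E)
  then have "emeasure (lebesgue_on {a<..<b}) {a<..<b} \<le> emeasure (lebesgue_on {a<..<b}) M"
    by (intro emeasure_mono) auto
  then show False using assms(1) M(2) by (simp add: emeasure_restrict_space)
qed

text \<open>Otherwise \<open>E\<close> would exceed its average almost everywhere, although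
  \<open>E\<close> minus its average has integral zero. The predicate \<open>P\<close> lets the
  point be taken in a prescribed set of full measure.\<close>

lemma exists_le_average:
  fixes E :: "real \<Rightarrow> real"
  assumes ab: "a < b" and E: "integrable (lebesgue_on {a<..<b}) E" and P: "AE x in lebesgue_on {a<..<b}. P x"
  shows "\<exists>x\<in>{a<..<b}. P x \<and> (b - a) * E x \<le> integral {a..b} E"
proof (rule ccontr)
  assume n: "\<not> ?thesis"
  let ?m = "lebesgue_on {a<..<b}"
  interpret finite_measure ?m by (rule finite_measure_lebesgue_on_interval)
  define A where "A = integral {a..b} E / (b - a)"
  have gt: "AE x in ?m. E x > A"
    using P AE_space
    by eventually_elim (use n ab in \<open>auto simp: A_def pos_divide_less_eq mult.commute not_le\<close>)
  have i: "integrable ?m (\<lambda>x. E x - A)" using E by simp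
  have "(LINT x|?m. E x - A) = (LINT x|?m. E x) - measure ?m (space ?m) * A"
    using E by simp
  also have "measure ?m (space ?m) = b - a" using ab by (simp add: measure_restrict_space)
  also have "(LINT x|?m. E x) - (b - a) * A = 0"
    using LINT_open_interval[OF E] ab by (simp add: A_def)
  finally have "(LINT x|?m. E x - A) = 0" .
  moreover have "AE x in ?m. 0 \<le> E x - A" using gt by eventually_elim simp
  ultimately have "AE x in ?m. E x - A = 0"
    using integral_nonneg_eq_0_iff_AE[OF i] by blast
  with gt have "AE x in ?m. False" by eventually_elim simp
  then show False using AE_interval_imp_ex[OF ab] by blast
qed

text \<open>One point is picked in each of \<open>n\<close> equal cells such that \<open>E\<close> is at most its cell average there.\<close>

lemma chain_bound:
  fixes F E G :: "real \<Rightarrow> real"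
  assumes N: "AE t in lebesgue_on {a<..<b}. t \<in> N" "N \<subseteq> {a<..<b}"
    and E: "integrable (lebesgue_on {a<..<b}) E" "\<And>t. 0 \<le> E t"
    and G: "integrable (lebesgue_on {a<..<b}) G"
    and \<delta>: "0 < \<delta>"
    and step: "\<And>s t. s \<in> N \<Longrightarrow> t \<in> N \<Longrightarrow> s < t \<Longrightarrow> t - s < \<delta> \<Longrightarrow>
      \<bar>F t - F s\<bar> \<le> integral {s..t} G + (t - s) * (E s + E t)"
    and st: "s \<in> N" "t \<in> N" "s < t"
  shows "\<bar>F t - F s\<bar> \<le> integral {s..t} G + 4 * integral {a..b} E"
proof -
  have sab: "a < s" "s < b" "a < t" "t < b" using st N(2) by auto
  have Gi: "G integrable_on {x..y}" and Ei: "E integrable_on {x..y}" if "a \<le> x" "y \<le> b" for x y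
    using that integrable_on_subinterval_open[OF G] integrable_on_subinterval_open[OF E(1)] by auto
  have *: "\<bar>F t - F s\<bar> \<le> integral {s..t} G + 4 * integral {a..b} E + (t - s) / real n * (E s + E t)"
    if n: "2 * (t - s) / \<delta> < real n" "0 < n" for n
  proof -
    define h where "h = (t - s) / real n"
    have h: "0 < h" "2 * h < \<delta>" "real n * h = t - s" using n st \<delta> by (auto simp: h_def field_simps)
    define c where "c i = s + real i * h" for i
    have c: "c 0 = s" "c n = t" "\<And>i. c (Suc i) = c i + h" "\<And>i. s \<le> c i"
      using h by (auto simp: c_def algebra_simps)
    have cn: "c i \<le> t" if "i \<le> n" for i
      using that h mult_right_mono[of "real i" "real n" h] by (simp add: c_def)
    have "\<exists>x\<in>{c i<..<c (Suc i)}. x \<in> N \<and> h * E x \<le> integral {c i..c (Suc i)} E" if "i < n" for i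
    proof -
      have sub: "a \<le> c i" "c (Suc i) \<le> b" using c(4)[of i] cn[of "Suc i"] that sab by auto
      have "AE x in lebesgue_on {c i<..<c (Suc i)}. x \<in> N"
        by (rule AE_lebesgue_on_subset[OF N(1)]) (use sub in auto)
      from exists_le_average[OF _ integrable_lebesgue_on_open_subinterval[OF E(1) sub] this]
      show ?thesis using h c(3)[of i] by simp
    qed
    then obtain r where r: "\<And>i. i < n \<Longrightarrow> r i \<in> {c i<..<c (Suc i)}" "\<And>i. i < n \<Longrightarrow> r i \<in> N"
      "\<And>i. i < n \<Longrightarrow> h * E (r i) \<le> integral {c i..c (Suc i)} E" by metis
    have sumE: "(\<Sum>j<i. h * E (r j)) \<le> integral {s..c i} E" if "i \<le> n" for i
      using that
    proof (induction i)
      case 0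
      then show ?case using c by simp
    next
      case (Suc i)
      have "integral {s..c i} E + integral {c i..c (Suc i)} E = integral {s..c (Suc i)} E"
        using c(4)[of i] c(3)[of i] h cn[OF Suc.prems] sab
        by (intro Henstock_Kurzweil_Integration.integral_combine Ei) auto
      then show ?case using Suc r(3)[of i] by simp
    qed
    have gap: "\<bar>F y - F x\<bar> \<le> integral {x..y} G + 2 * h * (E x + E y)"
      if "x \<in> N" "y \<in> N" "x < y" "y - x \<le> 2 * h" for x y
    proof -
      have "(y - x) * (E x + E y) \<le> 2 * h * (E x + E y)"
        using that E(2) by (intro mult_right_mono) auto
      then show ?thesis using step[of x y] that h by auto
    qed
    have comb: "integral {s..x} G + integral {x..y} G = integral {s..y} G" if "s \<le> x" "x \<le> y" "y \<le> t" for x y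
      using that sab by (intro Henstock_Kurzweil_Integration.integral_combine Gi) auto
    \<comment> \<open>Points in neighbouring cells are at most \<open>2 * h\<close> apart, so each
      \<open>E (r j)\<close> enters through two gaps with weight at most \<open>2 * h\<close>: this
      is the factor 4. The last point has met only one gap so far, and \<open>E s\<close> carries
      the weight \<open>h\<close> since \<open>r 0\<close> lies in the first cell.\<close>
    have main: "\<bar>F (r i) - F s\<bar> \<le> integral {s..r i} G + h * E s + 4 * (\<Sum>j<i. h * E (r j)) + 2 * (h * E (r i))"
      if "i < n" for i using that
    proof (induction i)
      case 0
      have r0: "s < r 0" "r 0 - s < h" using r(1)[OF 0] c by auto
      have "(r 0 - s) * (E s + E (r 0)) \<le> h * (E s + E (r 0))"
        using r0 E(2) by (intro mult_right_mono) auto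
      moreover have "0 \<le> h * E (r 0)" using h E(2) by simp
      ultimately show ?case
        using step[OF st(1) r(2)[OF 0] r0(1)] r0 h by (simp add: algebra_simps)
    next
      case (Suc i)
      have ri: "r i < r (Suc i)" "r (Suc i) - r i \<le> 2 * h" "s \<le> r i" "r (Suc i) \<le> t"
        using r(1)[of i] r(1)[of "Suc i"] Suc.prems c(3,4)[of i] c(3)[of "Suc i"] cn[of "Suc (Suc i)"] by auto
      have "\<bar>F (r (Suc i)) - F (r i)\<bar> \<le> integral {r i..r (Suc i)} G + 2 * h * (E (r i) + E (r (Suc i)))"
        using Suc.prems r(2) ri by (intro gap) auto
      moreover have "integral {s..r i} G + integral {r i..r (Suc i)} G = integral {s..r (Suc i)} G"
        using ri by (intro comb) auto
      ultimately show ?case using Suc by (simp add: algebra_simps)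
    qed
    obtain k where k: "n = Suc k" using n(2) gr0_implies_Suc by blast
    have "c k < r k" "r k < c k + h" using r(1)[of k] k c(3)[of k] by auto
    moreover have "c k + h = t" using c(2,3) k by metis
    ultimately have rk: "r k < t" "t - r k < h" "s \<le> r k" using c(4)[of k] by linarith+
    have "(t - r k) * (E (r k) + E t) \<le> h * (E (r k) + E t)"
      using rk E(2) by (intro mult_right_mono) auto
    then have "\<bar>F t - F (r k)\<bar> \<le> integral {r k..t} G + h * (E (r k) + E t)"
      using step[of "r k" t] rk r(2)[of k] k st h by auto
    moreover have "integral {s..r k} G + integral {r k..t} G = integral {s..t} G"
      using rk by (intro comb) auto
    moreover have "0 \<le> h * E (r k)" using h E(2) by simp
    ultimately have "\<bar>F t - F s\<bar> \<le> integral {s..t} G + h * E s + 4 * (\<Sum>j<n. h * E (r j)) + h * E t"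
      using main[of k] k by (simp add: algebra_simps)
    also have "(\<Sum>j<n. h * E (r j)) \<le> integral {s..t} E" using sumE[of n] c by simp
    also have "integral {s..t} E \<le> integral {a..b} E"
      using sab E(2) by (intro integral_subset_le Ei) auto
    finally have "\<bar>F t - F s\<bar> \<le> integral {s..t} G + h * E s + 4 * integral {a..b} E + h * E t" by simp
    moreover have "(t - s) / real n * (E s + E t) = h * E s + h * E t" by (simp add: h_def distrib_left)
    ultimately show ?thesis by linarith
  qed
  \<comment> \<open>The end points are given and not chosen, so \<open>E s\<close> and
    \<open>E t\<close> cannot be compared with averages; their weight \<open>(t - s) / n\<close>
    vanishes as \<open>n\<close> grows.\<close>
  show ?thesis
  proof (rule field_le_epsilon)
    fix e :: real assume e: "0 < e"
    define C where "C = (t - s) * (E s + E t)"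
    obtain n where n: "max (2 * (t - s) / \<delta>) (max 0 (C / e)) < real n" using reals_Archimedean2 by blast
    then have "0 < n" by auto
    moreover have "(t - s) / real n * (E s + E t) \<le> e"
      using n e \<open>0 < n\<close> by (simp add: C_def field_simps)
    ultimately show "\<bar>F t - F s\<bar> \<le> integral {s..t} G + 4 * integral {a..b} E + e"
      using *[of n] n by simp
  qed
qed

text \<open>\<open>measurable_on\<close> supplies continuous functions converging almost everywhere.
  Truncating them at the bound \<open>K\<close> leaves the limit unchanged and permits dominated
  convergence.\<close>

lemma continuous_L1_approx:
  fixes k :: "real \<Rightarrow> real"
  assumes k: "k \<in> borel_measurable (lebesgue_on {a<..<b})" "\<And>t. t \<in> {a<..<b} \<Longrightarrow> \<bar>k t\<bar> \<le> K" and e: "e > 0"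
  shows "\<exists>c. continuous_on UNIV c \<and> integrable (lebesgue_on {a<..<b}) (\<lambda>t. \<bar>k t - c t\<bar>)
    \<and> (LINT t|lebesgue_on {a<..<b}. \<bar>k t - c t\<bar>) < e"
proof -
  let ?I = "{a<..<b}"
  let ?m = "lebesgue_on ?I"
  interpret finite_measure ?m by (rule finite_measure_lebesgue_on_interval)
  have "(\<lambda>t. if t \<in> ?I then k t else 0) \<in> borel_measurable lebesgue"
    using k(1) by (intro borel_measurable_if_I) auto
  then have "(\<lambda>t. if t \<in> ?I then k t else 0) measurable_on ?I"
    by (rule lebesgue_measurable_imp_measurable_on_real) auto
  then obtain N g where N: "negligible N" "\<And>n. continuous_on UNIV (g n)"
    "\<And>x. x \<notin> N \<Longrightarrow> (\<lambda>n. g n x) \<longlonglongrightarrow> (if x \<in> ?I then if x \<in> ?I then k x else 0 else 0)"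
    unfolding measurable_on_def by blast
  define c where "c n x = max (- K) (min K (g n x))" for n x
  have cc: "continuous_on UNIV (c n)" for n unfolding c_def by (intro continuous_intros N)
  have cm [measurable]: "c n \<in> borel_measurable ?m" for n
    using cc[of n] by (intro measurable_restrict_space1 measurable_completion) (simp add: borel_measurable_continuous_onI)
  note k(1) [measurable]
  have lim: "(\<lambda>n. LINT t|?m. \<bar>k t - c n t\<bar>) \<longlonglongrightarrow> (LINT t|?m. 0)"
  proof (rule integral_dominated_convergence)
    show "integrable ?m (\<lambda>t. 2 * \<bar>K\<bar>)" by simp
    have "AE t in lebesgue. t \<notin> N" using N(1) by (simp add: negligible_iff_null_sets AE_not_in)
    then have "AE t in ?m. t \<notin> N" by (auto simp: AE_restrict_space_iff elim!: eventually_mono)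
    then show "AE t in ?m. (\<lambda>n. \<bar>k t - c n t\<bar>) \<longlonglongrightarrow> 0"
      using AE_space
    proof eventually_elim
      case (elim t)
      then have t: "t \<in> ?I" by simp
      have "(\<lambda>n. c n t) \<longlonglongrightarrow> max (- K) (min K (k t))"
        unfolding c_def using N(3)[OF elim(1)] t by (intro tendsto_intros) simp
      also have "max (- K) (min K (k t)) = k t" using k(2)[OF t] by auto
      finally have "(\<lambda>n. \<bar>k t - c n t\<bar>) \<longlonglongrightarrow> \<bar>k t - k t\<bar>" by (intro tendsto_intros)
      then show ?case by simp
    qed
    show "AE t in ?m. norm \<bar>k t - c n t\<bar> \<le> 2 * \<bar>K\<bar>" for n
      using AE_space
    proof eventually_elim
      case (elim t)
      then have "\<bar>k t\<bar> \<le> K" using k(2) by simp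
      moreover have "\<bar>c n t\<bar> \<le> \<bar>K\<bar>" unfolding c_def by (auto simp: max_def min_def)
      ultimately show ?case by auto
    qed
  qed measurable
  then obtain n where n: "\<bar>LINT t|?m. \<bar>k t - c n t\<bar>\<bar> < e"
    using LIMSEQ_D[OF lim e] by auto
  have "integrable ?m (\<lambda>t. \<bar>k t - c n t\<bar>)"
  proof (rule integrable_const_bound[where B="2 * \<bar>K\<bar>"])
    show "AE t in ?m. norm \<bar>k t - c n t\<bar> \<le> 2 * \<bar>K\<bar>"
      using AE_space
    proof eventually_elim
      case (elim t)
      then have "\<bar>k t\<bar> \<le> K" using k(2) by simp
      moreover have "\<bar>c n t\<bar> \<le> \<bar>K\<bar>" unfolding c_def by (auto simp: max_def min_def)
      ultimately show ?case by auto
    qed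
  qed measurable
  with n cc show ?thesis by auto
qed

section \<open>Integration by parts for primitives and the lemma of du Bois-Reymond\<close>

lemma test_functions_comb:
  assumes "\<phi> \<in> test_functions U" "\<psi> \<in> test_functions U"
  shows "(\<lambda>x. a * \<phi> x + b * \<psi> x) \<in> test_functions U"
proof -
  let ?\<theta> = "\<lambda>x. a * \<phi> x + b * \<psi> x"
  let ?K = "closure {x. \<phi> x \<noteq> 0} \<union> closure {x. \<psi> x \<noteq> 0}"
  have K: "compact ?K" "?K \<subseteq> U" using assms by (auto simp: test_functions_def)
  have "x \<in> ?K" if "?\<theta> x \<noteq> 0" for x
  proof -
    from that have "\<phi> x \<noteq> 0 \<or> \<psi> x \<noteq> 0" by auto
    then show ?thesis
      using closure_subset[of "{x. \<phi> x \<noteq> 0}"] closure_subset[of "{x. \<psi> x \<noteq> 0}"] by blast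
  qed
  then have "{x. ?\<theta> x \<noteq> 0} \<subseteq> ?K" by blast
  then have cl: "closure {x. ?\<theta> x \<noteq> 0} \<subseteq> ?K" by (rule closure_minimal) auto
  then have "compact (closure {x. ?\<theta> x \<noteq> 0})"
    using K(1) by (meson bounded_subset closed_closure compact_eq_bounded_closed)
  moreover have "Ck k ?\<theta>" for k
    using assms unfolding test_functions_def by (intro Ck_add Ck_mult Ck_const) auto
  ultimately show ?thesis using cl K(2) by (auto simp: test_functions_def)
qed

lemma test_function_support_interval:
  fixes \<theta> :: "real \<Rightarrow> real"
  assumes "\<theta> \<in> test_functions {0<..<T}" "0 < T"
  shows "\<exists>a b. 0 < a \<and> a \<le> b \<and> b < T \<and> (\<forall>x. \<theta> x \<noteq> 0 \<longrightarrow> a \<le> x \<and> x \<le> b)"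
proof (cases "{x. \<theta> x \<noteq> 0} = {}")
  case True
  then show ?thesis using assms(2) by (intro exI[of _ "T/2"]) auto
next
  case False
  let ?K = "closure {x. \<theta> x \<noteq> 0}"
  have K: "compact ?K" "?K \<subseteq> {0<..<T}" "?K \<noteq> {}" using assms False by (auto simp: test_functions_def)
  obtain a where a: "a \<in> ?K" "\<And>x. x \<in> ?K \<Longrightarrow> a \<le> x" using compact_attains_inf[OF K(1,3)] by blast
  obtain b where b: "b \<in> ?K" "\<And>x. x \<in> ?K \<Longrightarrow> x \<le> b" using compact_attains_sup[OF K(1,3)] by blast
  have "a \<le> x \<and> x \<le> b" if "\<theta> x \<noteq> 0" for x
    using a b that closure_subset[of "{x. \<theta> x \<noteq> 0}"] by blast
  moreover have "0 < a" "b < T" "a \<le> b" using a b K(2) by auto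
  ultimately show ?thesis by blast
qed

text \<open>The primitive from 0 is zero to the left of the support of \<open>\<theta>\<close>; to
  the right of it the primitive equals the total integral, so mean zero is exactly what gives it
  compact support.\<close>

lemma test_function_antiderivative:
  fixes \<theta> :: "real \<Rightarrow> real"
  assumes \<theta>: "\<theta> \<in> test_functions {0<..<T}" and T: "0 < T" and zero: "integral {0..T} \<theta> = 0"
  shows "\<exists>\<phi>\<in>test_functions {0<..<T}. \<forall>t. (\<phi> has_real_derivative \<theta> t) (at t)"
proof -
  obtain a b where ab: "0 < a" "a \<le> b" "b < T" "\<And>x. \<theta> x \<noteq> 0 \<Longrightarrow> a \<le> x \<and> x \<le> b"
    using test_function_support_interval[OF \<theta> T] by blast
  have cont: "continuous_on S \<theta>" for S by (rule test_function_continuous[OF \<theta>])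
  define \<phi> where "\<phi> t = integral {0..t} \<theta>" for t
  have left: "\<phi> t = 0" if "t < a" for t
  proof -
    have "integral {0..t} \<theta> = integral {0..t} (\<lambda>_. 0)"
      using ab(4) that by (intro integral_cong) fastforce
    then show ?thesis by (simp add: \<phi>_def)
  qed
  have right: "\<phi> t = 0" if t: "b < t" for t
  proof -
    have "integral {0..b} \<theta> + integral {b..x} \<theta> = integral {0..x} \<theta>" if "b < x" for x
      using ab that by (intro Henstock_Kurzweil_Integration.integral_combine integrable_continuous_real cont) auto
    moreover have "integral {b..x} \<theta> = 0" if "b < x" for x
    proof -
      have "integral {b<..<x} \<theta> = integral {b<..<x} (\<lambda>_. 0)"
        using ab(4) by (intro integral_cong) fastforce
      then show ?thesis by (simp add: integral_open_interval_real)
    qed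
    ultimately show ?thesis using zero t ab by (metis \<phi>_def add.right_neutral)
  qed
  have der: "(\<phi> has_real_derivative \<theta> t) (at t)" for t
  proof (cases "t < a")
    case True
    have "(\<phi> has_real_derivative 0) (at t)"
    proof (rule has_field_derivative_transform_within_open)
      show "((\<lambda>_. 0) has_real_derivative 0) (at t)" by simp
      show "open {..<a}" "t \<in> {..<a}" using True by auto
    qed (use left in auto)
    moreover have "\<theta> t = 0" using ab(4)[of t] True by auto
    ultimately show ?thesis by simp
  next
    case False
    have "(\<phi> has_real_derivative \<theta> t) (at t within {0..t+1})"
      unfolding \<phi>_def using False ab by (intro integral_has_real_derivative cont) auto
    then have "(\<phi> has_real_derivative \<theta> t) (at t within {0<..<t+1})"
      by (rule DERIV_subset) auto
    moreover have "at t within {0<..<t+1} = at t"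
      using False ab by (intro at_within_open) auto
    ultimately show ?thesis by simp
  qed
  have Ck: "Ck k \<phi>" for k
  proof (cases k)
    case 0
    then show ?thesis using DERIV_continuous[OF der] by (simp add: continuous_at_imp_continuous_on)
  next
    case (Suc j)
    have "Ck j \<theta>" using \<theta> by (simp add: test_functions_def)
    then show ?thesis using Ck_SucI_real[OF der] Suc by simp
  qed
  have "{x. \<phi> x \<noteq> 0} \<subseteq> {a..b}" using left right by (force simp: not_less[symmetric])
  then have cl: "closure {x. \<phi> x \<noteq> 0} \<subseteq> {a..b}" by (rule closure_minimal) auto
  then have "compact (closure {x. \<phi> x \<noteq> 0})"
    by (meson bounded_closed_interval bounded_subset closed_closure compact_eq_bounded_closed)
  then have "\<phi> \<in> test_functions {0<..<T}" using cl ab Ck by (auto simp: test_functions_def)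
  then show ?thesis using der by blast
qed

text \<open>As \<open>q\<close> is merely integrable, integration by parts is done by Fubini's
  theorem for \<open>q s * \<phi>' t\<close> on the triangle \<open>s < t\<close>. Integrating out
  \<open>s\<close> gives the primitive times \<open>\<phi>'\<close>; integrating out
  \<open>t\<close> gives \<open>- q s * \<phi> s\<close>, because
  \<open>\<phi> T = 0\<close>.\<close>

lemma integral_primitive_mult_deriv:
  fixes q \<phi> \<phi>' :: "real \<Rightarrow> real"
  assumes q: "integrable (lebesgue_on {0<..<T}) q" and T: "0 < T"
    and \<phi>: "\<And>t. (\<phi> has_real_derivative \<phi>' t) (at t)" "\<phi> T = 0"
    and \<phi>': "continuous_on UNIV \<phi>'"
  shows "integrable (lebesgue_on {0<..<T}) (\<lambda>t. integral {0..t} q * \<phi>' t)"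
    and "(LINT t|lebesgue_on {0<..<T}. integral {0..t} q * \<phi>' t) = - (LINT t|lebesgue_on {0<..<T}. q t * \<phi> t)"
proof -
  let ?I = "{0<..<T}"
  let ?m = "lebesgue_on ?I"
  interpret m: finite_measure ?m by (rule finite_measure_lebesgue_on_interval)
  interpret mm: pair_sigma_finite ?m ?m ..
  have "bounded (\<phi>' ` {0..T})"
    by (intro compact_imp_bounded compact_continuous_image continuous_on_subset[OF \<phi>']) auto
  then obtain C where "\<forall>x\<in>\<phi>' ` {0..T}. norm x \<le> C" unfolding bounded_iff by blast
  then have C: "\<And>t. t \<in> {0..T} \<Longrightarrow> \<bar>\<phi>' t\<bar> \<le> C" by auto
  have [measurable]: "\<phi>' \<in> borel_measurable ?m"
    using \<phi>' by (intro measurable_restrict_space1 measurable_completion) (simp add: borel_measurable_continuous_onI)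
  have [measurable]: "(\<lambda>x. x) \<in> borel_measurable ?m"
    by (intro measurable_restrict_space1 measurable_completion) simp
  note borel_measurable_integrable[OF q, measurable]
  let ?f = "\<lambda>s t. if s < t then q s * \<phi>' t else 0"
  have fm [measurable]: "case_prod ?f \<in> borel_measurable (?m \<Otimes>\<^sub>M ?m)"
  proof -
    have [measurable]: "(\<lambda>p. fst p) \<in> borel_measurable (?m \<Otimes>\<^sub>M ?m)" "(\<lambda>p. snd p) \<in> borel_measurable (?m \<Otimes>\<^sub>M ?m)"
      using measurable_compose[OF measurable_fst \<open>(\<lambda>x. x) \<in> borel_measurable ?m\<close>]
        measurable_compose[OF measurable_snd \<open>(\<lambda>x. x) \<in> borel_measurable ?m\<close>] by auto
    have [measurable]: "(\<lambda>p. q (fst p)) \<in> borel_measurable (?m \<Otimes>\<^sub>M ?m)" "(\<lambda>p. \<phi>' (snd p)) \<in> borel_measurable (?m \<Otimes>\<^sub>M ?m)"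
      by measurable
    have "{p \<in> space (?m \<Otimes>\<^sub>M ?m). fst p < snd p} \<in> sets (?m \<Otimes>\<^sub>M ?m)"
      by (intro borel_measurable_less) auto
    then have "(\<lambda>p. if fst p < snd p then q (fst p) * \<phi>' (snd p) else 0) \<in> borel_measurable (?m \<Otimes>\<^sub>M ?m)"
      by (intro measurable_If) auto
    then show ?thesis by (simp add: case_prod_unfold)
  qed
  have fle: "\<bar>?f s t\<bar> \<le> C * \<bar>q s\<bar>" if "t \<in> ?I" for s t
    using C[of t] that mult_right_mono[of "\<bar>\<phi>' t\<bar>" C "\<bar>q s\<bar>"] mult_nonneg_nonneg[of C "\<bar>q s\<bar>"]
    by (auto simp: abs_mult mult.commute)
  have fint: "integrable (?m \<Otimes>\<^sub>M ?m) (case_prod ?f)"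
  proof (rule mm.Fubini_integrable[OF fm])
    have i2: "integrable ?m (\<lambda>t. case_prod ?f (s, t))" for s
    proof (rule m.integrable_const_bound[where B="C * \<bar>q s\<bar>"])
      show "AE t in ?m. norm (case_prod ?f (s, t)) \<le> C * \<bar>q s\<bar>"
        using AE_space by eventually_elim (use fle[of _ s] in simp)
    qed auto
    then show "AE s in ?m. integrable ?m (\<lambda>t. case_prod ?f (s, t))" by simp
    show "integrable ?m (\<lambda>s. LINT t|?m. norm (case_prod ?f (s, t)))"
    proof (rule Bochner_Integration.integrable_bound)
      show "integrable ?m (\<lambda>s. T * C * \<bar>q s\<bar>)" using q by auto
      show "(\<lambda>s. LINT t|?m. norm (case_prod ?f (s, t))) \<in> borel_measurable ?m"
        by (rule m.borel_measurable_lebesgue_integral) (use fm in measurable)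
      have "(LINT t|?m. norm (case_prod ?f (s, t))) \<le> (LINT t|?m. C * \<bar>q s\<bar>)" for s
        using i2[of s] fle by (intro integral_mono) auto
      also have "(LINT t|?m. C * \<bar>q s\<bar>) = T * C * \<bar>q s\<bar>" for s
        using T by (simp add: measure_restrict_space)
      finally show "AE s in ?m. norm (LINT t|?m. norm (case_prod ?f (s, t))) \<le> norm (T * C * \<bar>q s\<bar>)"
        by (intro AE_I2) (auto intro: order_trans[OF _ abs_ge_self])
    qed
  qed
  have inner1: "(LINT s|?m. ?f s t) = integral {0..t} q * \<phi>' t" if t: "t \<in> ?I" for t
  proof -
    have "(LINT s|?m. ?f s t) = (LINT s|lebesgue. indicator {0<..<t} s *\<^sub>R q s) * \<phi>' t"
      using t by (subst integral_restrict_space) (auto simp: indicator_def mult.commute[of _ "\<phi>' t"] simp flip: integral_mult_right_zero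
        intro!: Bochner_Integration.integral_cong)
    also have "(LINT s|lebesgue. indicator {0<..<t} s *\<^sub>R q s) = (LINT s|lebesgue_on {0<..<t}. q s)"
      by (subst integral_restrict_space) auto
    also have "\<dots> = integral {0..t} q"
      using t by (intro LINT_open_interval integrable_lebesgue_on_open_subinterval[OF q]) auto
    finally show ?thesis .
  qed
  have inner2: "(LINT t|?m. ?f s t) = - (q s * \<phi> s)" if s: "s \<in> ?I" for s
  proof -
    have "integrable (lebesgue_on {s..T}) \<phi>'"
      by (intro continuous_imp_integrable_real continuous_on_subset[OF \<phi>']) auto
    then have i: "integrable (lebesgue_on {s<..<T}) \<phi>'"
      by (rule integrable_lebesgue_on_subset) auto
    have "(LINT t|?m. ?f s t) = q s * (LINT t|lebesgue. indicator {s<..<T} t *\<^sub>R \<phi>' t)"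
      using s by (subst integral_restrict_space) (auto simp: indicator_def simp flip: integral_mult_right_zero
        intro!: Bochner_Integration.integral_cong)
    also have "(LINT t|lebesgue. indicator {s<..<T} t *\<^sub>R \<phi>' t) = (LINT t|lebesgue_on {s<..<T}. \<phi>' t)"
      by (subst integral_restrict_space) auto
    also have "\<dots> = integral {s..T} \<phi>'" by (rule LINT_open_interval[OF i])
    also have "\<dots> = \<phi> T - \<phi> s"
      using s \<phi>(1) by (intro integral_unique fundamental_theorem_of_calculus)
        (auto simp: has_real_derivative_iff_has_vector_derivative[symmetric] intro: has_field_derivative_at_within)
    finally show ?thesis using \<phi>(2) by simp
  qed
  have "integrable ?m (\<lambda>t. LINT s|?m. ?f s t)" using mm.integrable_snd[OF fint] .
  then show "integrable ?m (\<lambda>t. integral {0..t} q * \<phi>' t)"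
    using inner1 by (subst (asm) Bochner_Integration.integrable_cong[OF refl]) auto
  have "(LINT t|?m. integral {0..t} q * \<phi>' t) = (LINT t|?m. (LINT s|?m. ?f s t))"
    using inner1 by (intro Bochner_Integration.integral_cong) auto
  also have "\<dots> = (LINT s|?m. (LINT t|?m. ?f s t))" using mm.Fubini_integral[OF fint] .
  also have "\<dots> = (LINT s|?m. - (q s * \<phi> s))"
    using inner2 by (intro Bochner_Integration.integral_cong) auto
  finally show "(LINT t|?m. integral {0..t} q * \<phi>' t) = - (LINT t|?m. q t * \<phi> t)" by simp
qed

text \<open>A test function of mean zero is the derivative of a test function. Integration by parts
  thus shows that \<open>p\<close> minus the primitive of \<open>q\<close> annihilates all test
  functions of mean zero, and such a function is constant.\<close>

lemma du_Bois_Reymond: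
  fixes p q :: "real \<Rightarrow> real"
  assumes T: "0 < T" and p: "integrable (lebesgue_on {0<..<T}) p" and q: "integrable (lebesgue_on {0<..<T}) q"
    and weak: "\<And>\<phi>. \<phi> \<in> test_functions {0<..<T} \<Longrightarrow>
      (LINT t|lebesgue_on {0<..<T}. p t * deriv \<phi> t) = - (LINT t|lebesgue_on {0<..<T}. q t * \<phi> t)"
  shows "\<exists>c. AE t in lebesgue_on {0<..<T}. p t = c + integral {0..t} q"
proof -
  let ?I = "{0<..<T}"
  let ?m = "lebesgue_on ?I"
  interpret m: finite_measure ?m by (rule finite_measure_lebesgue_on_interval)
  define Q where "Q t = integral {0..t} q" for t
  have "continuous_on {0..T} Q"
    unfolding Q_def by (intro indefinite_integral_continuous_1 integrable_on_subinterval_open[OF q]) auto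
  then have "continuous_on ?I Q" "bounded (Q ` {0..T})"
    by (auto intro: continuous_on_subset compact_imp_bounded compact_continuous_image)
  then obtain B where B: "\<And>t. t \<in> ?I \<Longrightarrow> \<bar>Q t\<bar> \<le> B" by (force simp: bounded_iff)
  have "Q \<in> borel_measurable ?m"
    using \<open>continuous_on ?I Q\<close> by (intro continuous_imp_measurable_on_sets_lebesgue) auto
  then have Qi: "integrable ?m Q"
    using B by (intro m.integrable_const_bound[where B=B] AE_I2) auto
  define \<psi> where "\<psi> t = p t - Q t" for t
  have \<psi>i: "integrable ?m \<psi>" unfolding \<psi>_def using p Qi by auto
  have tI: "integrable ?m \<theta>" if \<theta>: "\<theta> \<in> test_functions ?I" for \<theta>
    using integrable_lebesgue_on_subset[of UNIV \<theta> ?I] integrable_test_function[OF \<theta>]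
    by (simp add: lebesgue_on_UNIV_eq)
  have mI: "integrable ?m (\<lambda>t. k t * \<theta> t)" if "integrable ?m k" "\<theta> \<in> test_functions ?I" for k \<theta>
    using that by (rule integrable_mult_test_function)
  have zero: "(LINT t|?m. \<psi> t * \<theta> t) = 0" if \<theta>: "\<theta> \<in> test_functions ?I" "(LINT t|?m. \<theta> t) = 0" for \<theta>
  proof -
    have "integral {0..T} \<theta> = 0" using LINT_open_interval[OF tI[OF \<theta>(1)]] \<theta>(2) by simp
    from test_function_antiderivative[OF \<theta>(1) T this]
    obtain \<phi> where \<phi>: "\<phi> \<in> test_functions ?I" "\<And>t. (\<phi> has_real_derivative \<theta> t) (at t)" by blast
    have "\<phi> T = 0"
      using test_function_support_interval[OF \<phi>(1) T] by force
    note parts = integral_primitive_mult_deriv[OF q T \<phi>(2) this test_function_continuous[OF \<theta>(1)]]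
    have "deriv \<phi> t = \<theta> t" for t by (rule DERIV_imp_deriv[OF \<phi>(2)])
    then have "(LINT t|?m. p t * \<theta> t) = (LINT t|?m. Q t * \<theta> t)"
      using weak[OF \<phi>(1)] parts(2) by (simp add: Q_def)
    then show ?thesis
      unfolding \<psi>_def using mI[OF p \<theta>(1)] mI[OF Qi \<theta>(1)] by (simp add: left_diff_distrib)
  qed
  define \<rho> where "\<rho> = box_bump 0 (T/3) (T/2)"
  have \<rho>: "\<rho> \<in> test_functions ?I"
    unfolding \<rho>_def using T by (intro box_bump_test_function) auto
  define R where "R = (LINT t|?m. \<rho> t)"
  have "R \<noteq> 0"
  proof
    assume "R = 0"
    moreover have "AE t in ?m. 0 \<le> \<rho> t" by (simp add: \<rho>_def box_bump_bounds)
    ultimately have "AE t in ?m. \<rho> t = 0"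
      using integral_nonneg_eq_0_iff_AE[OF tI[OF \<rho>]] by (simp add: R_def)
    then have ae: "AE t in lebesgue_on {T/3<..<T/2}. \<rho> t = 0"
      by (rule AE_lebesgue_on_subset) (use T in auto)
    have "T/3 < T/2" using T by simp
    from AE_interval_imp_ex[OF this ae] obtain t where "t \<in> {T/3<..<T/2}" "\<rho> t = 0" by blast
    then show False using box_bump_pos[of t "T/3" "T/2" 0] by (simp add: \<rho>_def box_real)
  qed
  \<comment> \<open>\<open>\<rho>\<close> is a reference function with integral \<open>R\<close>.
    Every test function \<open>\<eta>\<close> with integral \<open>S\<close> differs from
    \<open>(S / R) * \<rho>\<close> by one of mean zero, so this \<open>c\<close> makes
    \<open>\<psi> - c\<close> annihilate every \<open>\<eta>\<close>.\<close>
  define c where "c = (LINT t|?m. \<psi> t * \<rho> t) / R"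
  have "AE t in ?m. \<psi> t - c = 0"
  proof (rule AE_eq_0_if_test_integrals_0)
    show "open ?I" by simp
    show "integrable (lebesgue_on (cbox a b)) (\<lambda>t. \<psi> t - c)" if "cbox a b \<subseteq> ?I" for a b
      by (rule integrable_lebesgue_on_subset[OF _ that]) (use \<psi>i in auto)
    fix \<eta> assume \<eta>: "\<eta> \<in> test_functions ?I"
    define S where "S = (LINT t|?m. \<eta> t)"
    have "(LINT t|?m. 1 * \<eta> t + (- S / R) * \<rho> t) = S + (- S / R) * R"
      using tI[OF \<eta>] tI[OF \<rho>] by (simp add: S_def R_def)
    also have "\<dots> = 0" using \<open>R \<noteq> 0\<close> by simp
    finally have "(LINT t|?m. \<psi> t * (1 * \<eta> t + (- S / R) * \<rho> t)) = 0"
      by (intro zero test_functions_comb \<eta> \<rho>)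
    also have "(LINT t|?m. \<psi> t * (1 * \<eta> t + (- S / R) * \<rho> t))
        = (LINT t|?m. \<psi> t * \<eta> t + (- S / R) * (\<psi> t * \<rho> t))"
      by (simp add: algebra_simps)
    also have "\<dots> = (LINT t|?m. \<psi> t * \<eta> t) + (- S / R) * (LINT t|?m. \<psi> t * \<rho> t)"
      using mI[OF \<psi>i \<eta>] mI[OF \<psi>i \<rho>] by simp
    also have "\<dots> = (LINT t|?m. \<psi> t * \<eta> t) - c * S" by (simp add: c_def)
    also have "\<dots> = (LINT t|?m. (\<psi> t - c) * \<eta> t)"
      using mI[OF \<psi>i \<eta>] tI[OF \<eta>] by (simp add: left_diff_distrib S_def)
    finally show "(LINT t|?m. (\<psi> t - c) * \<eta> t) = 0" .
  qed
  then have "AE t in ?m. p t = c + integral {0..t} q"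
    by eventually_elim (simp add: \<psi>_def Q_def)
  then show ?thesis by blast
qed

section \<open>Strongly measurable functions\<close>

text \<open>Rests on the completeness of Lebesgue measure. It lets integrals be compared when
  measurability is known for one side only.\<close>

lemma borel_measurable_lebesgue_on_AE:
  fixes f g :: "'a::euclidean_space \<Rightarrow> 'b::euclidean_space"
  assumes S: "S \<in> sets lebesgue" and f: "f \<in> borel_measurable (lebesgue_on S)"
    and ae: "AE x in lebesgue_on S. f x = g x"
  shows "g \<in> borel_measurable (lebesgue_on S)"
proof -
  have "(\<lambda>x. if x \<in> S then f x else 0) \<in> borel_measurable lebesgue"
    using f S by (intro borel_measurable_if_I) auto
  moreover have "AE x in lebesgue. (if x \<in> S then f x else 0) = (if x \<in> S then g x else 0)"
    using ae S by (auto simp: AE_restrict_space_iff)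
  ultimately have "(\<lambda>x. if x \<in> S then g x else 0) \<in> borel_measurable lebesgue"
    by (rule borel_measurable_AE)
  then show ?thesis using S by (simp add: borel_measurable_if)
qed

lemma integrable_lebesgue_on_cong_AE:
  fixes f g :: "'a::euclidean_space \<Rightarrow> 'b::euclidean_space"
  assumes S: "S \<in> sets lebesgue" and f: "integrable (lebesgue_on S) f"
    and ae: "AE x in lebesgue_on S. f x = g x"
  shows "integrable (lebesgue_on S) g"
  using integrable_cong_AE[OF borel_measurable_integrable[OF f] borel_measurable_lebesgue_on_AE[OF S borel_measurable_integrable[OF f] ae] ae] f
  by simp

text \<open>Common frame for \<open>W12_D\<close>, \<open>V_dual\<close> and
  \<open>L2_space\<close>, which are sets of representatives with a seminorm inside a function type.
  Differences are taken as the basic operation because \<open>bochner_L2\<close> expresses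
  convergence through them.\<close>

locale seminormed_set =
  fixes X :: "'x::ab_group_add set" and nrm :: "'x \<Rightarrow> real"
  assumes zero_in: "0 \<in> X"
    and diff_in: "x \<in> X \<Longrightarrow> y \<in> X \<Longrightarrow> x - y \<in> X"
    and nrm_nonneg: "x \<in> X \<Longrightarrow> 0 \<le> nrm x"
    and nrm_zero: "nrm 0 = 0"
    and nrm_diff: "x \<in> X \<Longrightarrow> y \<in> X \<Longrightarrow> nrm (x - y) \<le> nrm x + nrm y"
begin

lemma nrm_uminus_le: "x \<in> X \<Longrightarrow> nrm (- x) \<le> nrm x"
  using nrm_diff[OF zero_in, of x] nrm_zero by simp

lemma nrm_minus_commute: "x \<in> X \<Longrightarrow> y \<in> X \<Longrightarrow> nrm (x - y) = nrm (y - x)"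
  using nrm_uminus_le[OF diff_in, of x y] nrm_uminus_le[OF diff_in, of y x] by simp

lemma nrm_triangle: "x \<in> X \<Longrightarrow> y \<in> X \<Longrightarrow> z \<in> X \<Longrightarrow> nrm (x - z) \<le> nrm (x - y) + nrm (y - z)"
  using nrm_diff[OF diff_in diff_in, of x y z y] nrm_minus_commute[of y z] by simp

lemma nrm_reverse: "x \<in> X \<Longrightarrow> y \<in> X \<Longrightarrow> \<bar>nrm x - nrm y\<bar> \<le> nrm (x - y)"
  using nrm_triangle[of x y 0] nrm_triangle[of y x 0] nrm_minus_commute[of x y] zero_in by simp

text \<open>Strong measurability without null sets: all values lie in \<open>X\<close>, even outside
  \<open>I\<close>, and the approximants converge at every point of \<open>I\<close>. Pointwise
  estimates thus need no exceptional sets.\<close>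

definition approx :: "real set \<Rightarrow> (nat \<Rightarrow> real \<Rightarrow> 'x) \<Rightarrow> (real \<Rightarrow> 'x) \<Rightarrow> bool" where
  "approx I s w \<longleftrightarrow> (\<forall>n. simple_function (lebesgue_on I) (s n)) \<and> (\<forall>n t. s n t \<in> X) \<and> (\<forall>t. w t \<in> X) \<and>
    (\<forall>t\<in>I. (\<lambda>n. nrm (s n t - w t)) \<longlonglongrightarrow> 0) \<and> integrable (lebesgue_on I) (\<lambda>t. (nrm (w t))\<^sup>2)"

text \<open>All conditions that hold almost everywhere fail within one measurable null set
  \<open>N\<close>. There, and outside \<open>I\<close>, both the function and its approximants are
  replaced by 0, which stays in \<open>X\<close> and keeps the approximants simple.\<close>

lemma bochner_L2_approx:
  assumes w: "w \<in> bochner_L2 I X nrm"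
  shows "\<exists>s w'. approx I s w' \<and> (AE t in lebesgue_on I. w' t = w t)"
proof -
  let ?m = "lebesgue_on I"
  obtain s where s: "\<And>n. simple_function ?m (s n)" "\<And>n. s n ` I \<subseteq> X"
    "AE t in ?m. (\<lambda>n. nrm (s n t - w t)) \<longlonglongrightarrow> 0"
    and wX: "AE t in ?m. w t \<in> X" and wi: "integrable ?m (\<lambda>t. (nrm (w t))\<^sup>2)"
    using w unfolding bochner_L2_def by blast
  have "AE t in ?m. w t \<in> X \<and> (\<lambda>n. nrm (s n t - w t)) \<longlonglongrightarrow> 0" using s(3) wX by auto
  then obtain N where N: "{t \<in> space ?m. \<not> (w t \<in> X \<and> (\<lambda>n. nrm (s n t - w t)) \<longlonglongrightarrow> 0)} \<subseteq> N"
    "emeasure ?m N = 0" "N \<in> sets ?m" by (rule AE_E)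
  define w' where "w' t = (if t \<in> N then 0 else if t \<in> I then w t else 0)" for t
  define s' where "s' n t = (if t \<in> N then 0 else if t \<in> I then s n t else 0)" for n t
  have sp: "space ?m = I" by simp
  have ae: "AE t in ?m. w' t = w t"
  proof -
    have "AE t in ?m. t \<notin> N" using N by (intro AE_not_in) auto
    then show ?thesis using AE_space by eventually_elim (auto simp: w'_def)
  qed
  have "simple_function ?m (s' n)" for n
  proof -
    have "simple_function ?m (\<lambda>t. if t \<in> N then 0 else s n t)"
      using N(3) s(1) sets.sets_into_space[OF N(3)] by (intro simple_function_If_set) (auto simp: Int_absorb2)
    then show ?thesis by (rule simple_function_cong[THEN iffD1, rotated]) (auto simp: s'_def)
  qed
  moreover have "s' n t \<in> X" "w' t \<in> X" for n t
    using zero_in s(2)[of n] N(1) by (auto simp: s'_def w'_def)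
  moreover have "(\<lambda>n. nrm (s' n t - w' t)) \<longlonglongrightarrow> 0" if "t \<in> I" for t
    using N(1) that nrm_zero by (auto simp: s'_def w'_def)
  moreover have "integrable ?m (\<lambda>t. (nrm (w' t))\<^sup>2)"
  proof -
    have "(\<lambda>t. if t \<in> N then 0 else (nrm (w t))\<^sup>2) \<in> borel_measurable ?m"
      using N(3) borel_measurable_integrable[OF wi] by (intro measurable_If_set) (auto simp: sets.Int_space_eq2)
    then have "(\<lambda>t. (nrm (w' t))\<^sup>2) \<in> borel_measurable ?m"
      by (rule measurable_cong[THEN iffD1, rotated]) (auto simp: w'_def nrm_zero)
    moreover have "AE t in ?m. (nrm (w t))\<^sup>2 = (nrm (w' t))\<^sup>2"
      using ae by eventually_elim simp
    ultimately show ?thesis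
      using integrable_cong_AE[of "\<lambda>t. (nrm (w t))\<^sup>2" ?m "\<lambda>t. (nrm (w' t))\<^sup>2"] wi borel_measurable_integrable[OF wi] by blast
  qed
  ultimately have "approx I s' w'" unfolding approx_def by blast
  with ae show ?thesis by blast
qed

lemma approx_in: "approx I s w \<Longrightarrow> s n t \<in> X" "approx I s w \<Longrightarrow> w t \<in> X"
  and approx_simple: "approx I s w \<Longrightarrow> simple_function (lebesgue_on I) (s n)"
  and approx_tendsto: "approx I s w \<Longrightarrow> t \<in> I \<Longrightarrow> (\<lambda>n. nrm (s n t - w t)) \<longlonglongrightarrow> 0"
  and approx_integrable: "approx I s w \<Longrightarrow> integrable (lebesgue_on I) (\<lambda>t. (nrm (w t))\<^sup>2)"
  by (auto simp: approx_def)

lemma approx_nrm_tendsto: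
  assumes "approx I s w" "t \<in> I"
  shows "(\<lambda>n. nrm (s n t)) \<longlonglongrightarrow> nrm (w t)"
proof (rule LIM_zero_cancel, rule Lim_null_comparison[OF _ approx_tendsto[OF assms]])
  show "\<forall>\<^sub>F n in sequentially. norm (nrm (s n t) - nrm (w t)) \<le> nrm (s n t - w t)"
    using nrm_reverse[OF approx_in[OF assms(1)]] by simp
qed

lemma approx_nrm_measurable:
  assumes "approx I s w"
  shows "(\<lambda>t. nrm (w t)) \<in> borel_measurable (lebesgue_on I)"
proof (rule borel_measurable_LIMSEQ_metric)
  show "(\<lambda>t. nrm (s n t)) \<in> borel_measurable (lebesgue_on I)" for n
    by (rule borel_measurable_simple_function[OF simple_function_compose1[OF approx_simple[OF assms]]])
  show "(\<lambda>n. nrm (s n t)) \<longlonglongrightarrow> nrm (w t)" if "t \<in> space (lebesgue_on I)" for t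
    using approx_nrm_tendsto[OF assms] that by simp
qed

lemma nrm_diff_power2_le: "x \<in> X \<Longrightarrow> y \<in> X \<Longrightarrow> (nrm (x - y))\<^sup>2 \<le> 2 * (nrm x)\<^sup>2 + 2 * (nrm y)\<^sup>2"
proof -
  assume xy: "x \<in> X" "y \<in> X"
  have "(nrm (x - y))\<^sup>2 \<le> (nrm x + nrm y)\<^sup>2"
    using xy by (intro power_mono nrm_diff nrm_nonneg diff_in)
  also have "\<dots> \<le> 2 * (nrm x)\<^sup>2 + 2 * (nrm y)\<^sup>2"
    using sum_squares_bound[of "nrm x" "nrm y"] by (simp add: power2_sum)
  finally show ?thesis .
qed

lemma approx_diff:
  assumes "approx I s v" "approx I r w"
  shows "approx I (\<lambda>n t. s n t - r n t) (\<lambda>t. v t - w t)"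
proof -
  note [simp] = approx_in[OF assms(1)] approx_in[OF assms(2)] diff_in
  have lim: "(\<lambda>n. nrm ((s n t - r n t) - (v t - w t))) \<longlonglongrightarrow> 0" if "t \<in> I" for t
  proof (rule Lim_null_comparison)
    have "norm (nrm ((s n t - r n t) - (v t - w t))) \<le> nrm (s n t - v t) + nrm (r n t - w t)" for n
    proof -
      have "(s n t - r n t) - (v t - w t) = (s n t - v t) - (r n t - w t)" by (simp add: algebra_simps)
      moreover have "0 \<le> nrm ((s n t - r n t) - (v t - w t))" by (intro nrm_nonneg) simp
      moreover have "nrm ((s n t - v t) - (r n t - w t)) \<le> nrm (s n t - v t) + nrm (r n t - w t)"
        by (intro nrm_diff) simp_all
      ultimately show ?thesis by (metis abs_of_nonneg real_norm_def)
    qed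
    then show "\<forall>\<^sub>F n in sequentially. norm (nrm ((s n t - r n t) - (v t - w t))) \<le> nrm (s n t - v t) + nrm (r n t - w t)"
      by simp
    show "(\<lambda>n. nrm (s n t - v t) + nrm (r n t - w t)) \<longlonglongrightarrow> 0"
      using tendsto_add[OF approx_tendsto[OF assms(1) that] approx_tendsto[OF assms(2) that]] by simp
  qed
  have sf: "simple_function (lebesgue_on I) (\<lambda>t. s n t - r n t)" for n
    by (rule simple_function_compose2[where h="(-)", OF approx_simple[OF assms(1)] approx_simple[OF assms(2)]])
  have meas: "(\<lambda>t. nrm (v t - w t)) \<in> borel_measurable (lebesgue_on I)"
  proof (rule borel_measurable_LIMSEQ_metric)
    show "(\<lambda>t. nrm (s n t - r n t)) \<in> borel_measurable (lebesgue_on I)" for n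
      by (rule borel_measurable_simple_function[OF simple_function_compose1[OF sf]])
    show "(\<lambda>n. nrm (s n t - r n t)) \<longlonglongrightarrow> nrm (v t - w t)" if "t \<in> space (lebesgue_on I)" for t
    proof (rule LIM_zero_cancel, rule Lim_null_comparison[OF _ lim])
      show "\<forall>\<^sub>F n in sequentially. norm (nrm (s n t - r n t) - nrm (v t - w t)) \<le> nrm ((s n t - r n t) - (v t - w t))"
        using nrm_reverse[of "s _ t - r _ t" "v t - w t"] by simp
    qed (use that in simp)
  qed
  have "integrable (lebesgue_on I) (\<lambda>t. (nrm (v t - w t))\<^sup>2)"
  proof (rule Bochner_Integration.integrable_bound)
    show "integrable (lebesgue_on I) (\<lambda>t. 2 * (nrm (v t))\<^sup>2 + 2 * (nrm (w t))\<^sup>2)"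
      using approx_integrable[OF assms(1)] approx_integrable[OF assms(2)]
      by (intro Bochner_Integration.integrable_add integrable_mult_right)
    show "(\<lambda>t. (nrm (v t - w t))\<^sup>2) \<in> borel_measurable (lebesgue_on I)"
      by (intro borel_measurable_power meas)
    show "AE t in lebesgue_on I. norm ((nrm (v t - w t))\<^sup>2) \<le> norm (2 * (nrm (v t))\<^sup>2 + 2 * (nrm (w t))\<^sup>2)"
      using nrm_diff_power2_le[OF approx_in(2)[OF assms(1)] approx_in(2)[OF assms(2)]] by (intro AE_I2) simp
  qed
  with lim sf show ?thesis unfolding approx_def by (intro conjI allI ballI) simp_all
qed

lemma approx_imp_bochner_L2:
  assumes I: "I \<in> sets lebesgue" and "approx I s w'" and ae: "AE t in lebesgue_on I. w' t = w t"
  shows "w \<in> bochner_L2 I X nrm"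
  unfolding bochner_L2_def
proof (intro CollectI conjI exI allI)
  show "AE t in lebesgue_on I. w t \<in> X"
    using ae by eventually_elim (use approx_in[OF assms(2)] in metis)
  show "AE t in lebesgue_on I. (\<lambda>n. nrm (s n t - w t)) \<longlonglongrightarrow> 0"
    using ae AE_space
  proof eventually_elim
    case (elim t)
    then show ?case using approx_tendsto[OF assms(2), of t] by simp
  qed
  have "AE t in lebesgue_on I. (nrm (w' t))\<^sup>2 = (nrm (w t))\<^sup>2" using ae by eventually_elim simp
  then show "integrable (lebesgue_on I) (\<lambda>t. (nrm (w t))\<^sup>2)"
    by (rule integrable_lebesgue_on_cong_AE[OF I approx_integrable[OF assms(2)]])
  show "simple_function (lebesgue_on I) (s n)" "s n ` I \<subseteq> X" for n
    using approx_in(1)[OF assms(2), of n] approx_simple[OF assms(2), of n] by blast+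
qed

lemma bochner_L2_diff:
  assumes "I \<in> sets lebesgue" "v \<in> bochner_L2 I X nrm" "w \<in> bochner_L2 I X nrm"
  shows "(\<lambda>t. v t - w t) \<in> bochner_L2 I X nrm"
proof -
  obtain s v' where s: "approx I s v'" "AE t in lebesgue_on I. v' t = v t" using bochner_L2_approx[OF assms(2)] by blast
  obtain r w' where r: "approx I r w'" "AE t in lebesgue_on I. w' t = w t" using bochner_L2_approx[OF assms(3)] by blast
  have "AE t in lebesgue_on I. v' t - w' t = v t - w t" using s(2) r(2) by eventually_elim simp
  then show ?thesis by (rule approx_imp_bochner_L2[OF assms(1) approx_diff[OF s(1) r(1)]])
qed

lemma bochner_L2_const:
  assumes "I \<in> lmeasurable" "x \<in> X"
  shows "(\<lambda>t. x) \<in> bochner_L2 I X nrm"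
proof -
  interpret finite_measure "lebesgue_on I" by (rule finite_measure_lebesgue_on[OF assms(1)])
  have "approx I (\<lambda>n t. x) (\<lambda>t. x)" using assms(2) nrm_zero by (auto simp: approx_def)
  then show ?thesis using assms(1) by (intro approx_imp_bochner_L2) (auto simp: fmeasurableD)
qed

text \<open>The approximants are truncated at twice the norm of the limit, so that they also converge in
  \<open>L\<^sup>2\<close>.\<close>

lemma approx_L2_simple:
  assumes w: "approx {a<..<b} s w" and e: "0 < e"
  shows "\<exists>p. simple_function (lebesgue_on {a<..<b}) p \<and> (\<forall>t. p t \<in> X) \<and>
    integrable (lebesgue_on {a<..<b}) (\<lambda>t. (nrm (p t - w t))\<^sup>2) \<and>
    (LINT t|lebesgue_on {a<..<b}. (nrm (p t - w t))\<^sup>2) < e"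
proof -
  let ?I = "{a<..<b}"
  let ?m = "lebesgue_on ?I"
  note wX = approx_in[OF w] and [measurable] = approx_nrm_measurable[OF w]
  define A where "A n = {t \<in> ?I. nrm (s n t) \<le> 2 * nrm (w t)}" for n
  define p where "p n t = (if t \<in> A n then s n t else 0)" for n t
  have [measurable]: "(\<lambda>t. nrm (s n t)) \<in> borel_measurable ?m" for n
    by (rule borel_measurable_simple_function[OF simple_function_compose1[OF approx_simple[OF w]]])
  have "{t \<in> space ?m. nrm (s n t) \<le> 2 * nrm (w t)} \<in> sets ?m" for n by measurable
  then have A: "A n \<in> sets ?m" for n by (simp add: A_def)
  have ps: "simple_function ?m (p n)" for n
    unfolding p_def using A[of n] approx_simple[OF w]
    by (intro simple_function_If_set) (auto simp: sets.Int_space_eq2)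
  have pX: "p n t \<in> X" for n t using wX zero_in by (simp add: p_def)
  have le: "nrm (p n t - w t) \<le> 3 * nrm (w t)" if "t \<in> ?I" for n t
    using nrm_diff[OF pX wX(2), of n t t] that nrm_zero nrm_nonneg[OF wX(2), of t] by (auto simp: p_def A_def split: if_splits)
  have lim: "(\<lambda>n. nrm (p n t - w t)) \<longlonglongrightarrow> 0" if t: "t \<in> ?I" for t
  proof (rule Lim_null_comparison[OF _ approx_tendsto[OF w t]])
    \<comment> \<open>If \<open>nrm (w t) = 0\<close>, the truncation may act for every
      \<open>n\<close>, but the value 0 it produces is then already exact in the seminorm.\<close>
    have "\<forall>\<^sub>F n in sequentially. nrm (w t) = 0 \<or> nrm (s n t) \<le> 2 * nrm (w t)"
    proof (cases "nrm (w t) = 0")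
      case False
      then have "nrm (w t) < 2 * nrm (w t)" using nrm_nonneg[OF wX(2), of t] by simp
      from order_tendstoD(2)[OF approx_nrm_tendsto[OF w t] this] show ?thesis by eventually_elim simp
    qed simp
    then show "\<forall>\<^sub>F n in sequentially. norm (nrm (p n t - w t)) \<le> nrm (s n t - w t)"
    proof eventually_elim
      case (elim n)
      have n0: "0 \<le> nrm (p n t - w t)" "0 \<le> nrm (s n t - w t)" using nrm_nonneg diff_in pX wX by auto
      show ?case
      proof (cases "t \<in> A n")
        case False
        then have "nrm (w t) = 0" using elim t by (auto simp: A_def)
        then have "nrm (p n t - w t) \<le> 0" using le[OF t, of n] by simp
        then show ?thesis using n0 by simp
      qed (use n0 in \<open>simp add: p_def\<close>)
    qed
  qed
  have meas: "(\<lambda>t. nrm (p n t - w t)) \<in> borel_measurable ?m" for n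
  proof (rule borel_measurable_LIMSEQ_metric)
    show "(\<lambda>t. nrm (p n t - s k t)) \<in> borel_measurable ?m" for k
      by (rule borel_measurable_simple_function[OF simple_function_compose2[where h="\<lambda>x y. nrm (x - y)", OF ps approx_simple[OF w]]])
    show "(\<lambda>k. nrm (p n t - s k t)) \<longlonglongrightarrow> nrm (p n t - w t)" if "t \<in> space ?m" for t
    proof (rule LIM_zero_cancel, rule Lim_null_comparison)
      show "\<forall>\<^sub>F k in sequentially. norm (nrm (p n t - s k t) - nrm (p n t - w t)) \<le> nrm (s k t - w t)"
        using nrm_reverse[OF diff_in[OF pX wX(1)] diff_in[OF pX wX(2)], of n t _ t n t t] nrm_minus_commute[OF wX]
        by (simp add: nrm_minus_commute[OF wX(1) wX(2)])
      show "(\<lambda>k. nrm (s k t - w t)) \<longlonglongrightarrow> 0" using approx_tendsto[OF w] that by simp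
    qed
  qed
  have dom: "norm ((nrm (p n t - w t))\<^sup>2) \<le> 9 * (nrm (w t))\<^sup>2" if "t \<in> ?I" for n t
  proof -
    have "(nrm (p n t - w t))\<^sup>2 \<le> (3 * nrm (w t))\<^sup>2"
      using le[OF that] nrm_nonneg[OF diff_in[OF pX wX(2)]] by (intro power_mono)
    then show ?thesis by (simp add: power_mult_distrib)
  qed
  have wi: "integrable ?m (\<lambda>t. 9 * (nrm (w t))\<^sup>2)" using approx_integrable[OF w] by auto
  have pi: "integrable ?m (\<lambda>t. (nrm (p n t - w t))\<^sup>2)" for n
    by (rule Bochner_Integration.integrable_bound[OF wi]) (use meas dom in \<open>auto intro!: AE_I2\<close>)
  have "(\<lambda>n. LINT t|?m. (nrm (p n t - w t))\<^sup>2) \<longlonglongrightarrow> (LINT t|?m. 0)"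
  proof (rule integral_dominated_convergence[OF _ _ wi])
    show "AE t in ?m. (\<lambda>n. (nrm (p n t - w t))\<^sup>2) \<longlonglongrightarrow> 0"
      using tendsto_power[OF lim, of _ 2] by (auto intro!: AE_I2)
  qed (use meas dom in \<open>auto intro!: AE_I2\<close>)
  then obtain n where "\<bar>LINT t|?m. (nrm (p n t - w t))\<^sup>2\<bar> < e"
    using LIMSEQ_D[of "\<lambda>n. LINT t|?m. (nrm (p n t - w t))\<^sup>2" 0 e] e by auto
  then show ?thesis using ps pX pi by (intro exI[of _ "p n"]) auto
qed

text \<open>A substitute for the continuity of translations in \<open>L\<^sup>2\<close>.  A simple function is encoded by an
  integer-valued one, which is approximated in \<open>L\<^sup>1\<close> by a continuous function.\<close>

lemma approx_L2_modulus:
  assumes w: "approx {a<..<b} s w" and e: "0 < e"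
  shows "\<exists>E \<delta>. 0 < \<delta> \<and> integrable (lebesgue_on {a<..<b}) E \<and> (\<forall>t. 0 \<le> E t) \<and>
    (LINT t|lebesgue_on {a<..<b}. E t) < e \<and>
    (\<forall>t\<in>{a<..<b}. \<forall>\<tau>\<in>{a<..<b}. \<bar>t - \<tau>\<bar> < \<delta> \<longrightarrow> (nrm (w t - w \<tau>))\<^sup>2 \<le> E t + E \<tau> + e)"
proof -
  let ?I = "{a<..<b}"
  let ?m = "lebesgue_on ?I"
  note wX = approx_in(2)[OF w]
  have "0 < e / 6" using e by simp
  from approx_L2_simple[OF w this] obtain p where p: "simple_function ?m p" "\<And>t. p t \<in> X"
    "integrable ?m (\<lambda>t. (nrm (p t - w t))\<^sup>2)" "(LINT t|?m. (nrm (p t - w t))\<^sup>2) < e / 6" by blast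
  have fin: "finite (p ` ?I)" using simple_functionD(1)[OF p(1)] by simp
  then obtain f :: "'x \<Rightarrow> nat" and n where f: "inj_on f (p ` ?I)" "f ` p ` ?I = {i. i < n}"
    using finite_imp_inj_to_nat_seg[OF fin] by metis
  define k where "k t = real (f (p t))" for t
  have km: "k \<in> borel_measurable ?m"
    unfolding k_def by (rule borel_measurable_simple_function[OF simple_function_compose1[OF p(1)]])
  have kb: "\<bar>k t\<bar> \<le> real n" if "t \<in> ?I" for t
  proof -
    have "f (p t) \<in> {i. i < n}" using f(2) that by blast
    then show ?thesis by (simp add: k_def)
  qed
  \<comment> \<open>\<open>C\<close> dominates the squared distance of any two values of
    \<open>p\<close>. Distinct values have distinct integer codes, hence codes at least 1 apart,
    which makes \<open>C\<close> a Lipschitz type constant from codes to values.\<close>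
  define C where "C = 1 + (\<Sum>(x, y)\<in>p ` ?I \<times> p ` ?I. (nrm (x - y))\<^sup>2)"
  have C1: "1 \<le> C" unfolding C_def by (auto intro!: sum_nonneg)
  have pk: "(nrm (p t - p \<tau>))\<^sup>2 \<le> C * \<bar>k t - k \<tau>\<bar>" if t: "t \<in> ?I" "\<tau> \<in> ?I" for t \<tau>
  proof (cases "p t = p \<tau>")
    case True
    then show ?thesis using nrm_zero C1 by simp
  next
    case False
    then have "f (p t) \<noteq> f (p \<tau>)" using f(1) t by (auto simp: inj_on_def)
    then have "1 \<le> \<bar>k t - k \<tau>\<bar>" by (simp add: k_def)
    moreover have "(nrm (p t - p \<tau>))\<^sup>2 \<le> C"
      using member_le_sum[of "(p t, p \<tau>)" "p ` ?I \<times> p ` ?I" "\<lambda>(x, y). (nrm (x - y))\<^sup>2"] t fin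
      by (auto simp: C_def)
    moreover have "C * 1 \<le> C * \<bar>k t - k \<tau>\<bar>" using calculation(1) C1 by (intro mult_left_mono) auto
    ultimately show ?thesis by linarith
  qed
  have "0 < e / (6 * C)" using e C1 by simp
  from continuous_L1_approx[OF km kb this] obtain c where c: "continuous_on UNIV c"
    "integrable ?m (\<lambda>t. \<bar>k t - c t\<bar>)" "(LINT t|?m. \<bar>k t - c t\<bar>) < e / (6 * C)" by blast
  have "uniformly_continuous_on {a..b} c"
    by (rule compact_uniformly_continuous[OF continuous_on_subset[OF c(1)]]) auto
  moreover have "0 < e / (3 * C)" using e C1 by simp
  ultimately obtain \<delta> where \<delta>: "0 < \<delta>" "\<And>t \<tau>. t \<in> {a..b} \<Longrightarrow> \<tau> \<in> {a..b} \<Longrightarrow> \<bar>t - \<tau>\<bar> < \<delta> \<Longrightarrow> \<bar>c t - c \<tau>\<bar> < e / (3 * C)"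
    unfolding uniformly_continuous_on_def dist_real_def by metis
  \<comment> \<open>The factor 3 is that of \<open>(x + y + z)^2 <= 3 * (x^2 + y^2 + z^2)\<close>.
    The tolerances \<open>e / 6\<close> and \<open>e / (6 * C)\<close> make the integral of
    \<open>E\<close> less than \<open>e\<close>, and \<open>e / (3 * C)\<close> makes the remainder
    equal to \<open>e\<close>.\<close>
  define E where "E t = 3 * (nrm (p t - w t))\<^sup>2 + 3 * C * \<bar>k t - c t\<bar>" for t
  have Ei: "integrable ?m E" unfolding E_def using p(3) c(2) by auto
  have "(LINT t|?m. E t) = 3 * (LINT t|?m. (nrm (p t - w t))\<^sup>2) + 3 * C * (LINT t|?m. \<bar>k t - c t\<bar>)"
    unfolding E_def using p(3) c(2) by simp
  also have "\<dots> < 3 * (e / 6) + 3 * C * (e / (6 * C))"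
    using p(4) c(3) C1 by (intro add_strict_mono mult_strict_left_mono) auto
  also have "\<dots> = e" using C1 by simp
  finally have El: "(LINT t|?m. E t) < e" .
  have "(nrm (w t - w \<tau>))\<^sup>2 \<le> E t + E \<tau> + e" if t: "t \<in> ?I" "\<tau> \<in> ?I" "\<bar>t - \<tau>\<bar> < \<delta>" for t \<tau>
  proof -
    let ?x = "nrm (p t - w t)" and ?y = "nrm (p t - p \<tau>)" and ?z = "nrm (p \<tau> - w \<tau>)"
    have "nrm (w t - w \<tau>) \<le> ?x + ?y + ?z"
      using nrm_triangle[OF wX[of t] p(2)[of t] wX[of \<tau>]] nrm_triangle[OF p(2)[of t] p(2)[of \<tau>] wX[of \<tau>]]
        nrm_minus_commute[OF wX[of t] p(2)[of t]] by simp
    then have "(nrm (w t - w \<tau>))\<^sup>2 \<le> (?x + ?y + ?z)\<^sup>2"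
      by (intro power_mono nrm_nonneg diff_in wX)
    also have "\<dots> \<le> 3 * ?x\<^sup>2 + 3 * ?y\<^sup>2 + 3 * ?z\<^sup>2"
      using sum_squares_bound[of ?x ?y] sum_squares_bound[of ?x ?z] sum_squares_bound[of ?y ?z]
      by (simp add: power2_eq_square algebra_simps)
    also have "?y\<^sup>2 \<le> C * \<bar>k t - k \<tau>\<bar>" by (rule pk[OF t(1,2)])
    also have "\<bar>k t - k \<tau>\<bar> \<le> \<bar>k t - c t\<bar> + \<bar>k \<tau> - c \<tau>\<bar> + e / (3 * C)"
      using \<delta>(2)[of t \<tau>] t by auto
    also have "3 * ?x\<^sup>2 + 3 * (C * (\<bar>k t - c t\<bar> + \<bar>k \<tau> - c \<tau>\<bar> + e / (3 * C))) + 3 * ?z\<^sup>2 = E t + E \<tau> + e"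
      using C1 by (simp add: E_def field_simps)
    finally show ?thesis using C1 by simp
  qed
  then show ?thesis
    using \<delta>(1) Ei El C1 by (intro exI[of _ E] exI[of _ \<delta>]) (auto simp: E_def)
qed

end

text \<open>\<open>J\<close> carries simple approximants to simple approximants. The assumption
  concerns norms of differences and not linearity, so that it fits \<open>riesz\<close>, which is
  chosen by \<open>SOME\<close>.\<close>

lemma bochner_L2_isometry:
  assumes I: "I \<in> sets lebesgue" and w: "w \<in> bochner_L2 I X nrm"
    and J: "\<And>x. x \<in> X \<Longrightarrow> J x \<in> X2" "\<And>x. x \<in> X \<Longrightarrow> nrm2 (J x) = nrm x"
      "\<And>x y. x \<in> X \<Longrightarrow> y \<in> X \<Longrightarrow> nrm2 (J x - J y) = nrm (x - y)"
  shows "(\<lambda>t. J (w t)) \<in> bochner_L2 I X2 nrm2"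
proof -
  let ?m = "lebesgue_on I"
  obtain s where s: "\<And>n. simple_function ?m (s n)" "\<And>n. s n ` I \<subseteq> X"
    "AE t in ?m. (\<lambda>n. nrm (s n t - w t)) \<longlonglongrightarrow> 0"
    and wX: "AE t in ?m. w t \<in> X" and wi: "integrable ?m (\<lambda>t. (nrm (w t))\<^sup>2)"
    using w unfolding bochner_L2_def by blast
  have "AE t in ?m. J (w t) \<in> X2" using wX by eventually_elim (rule J)
  moreover have "simple_function ?m (\<lambda>t. J (s n t))" "(\<lambda>t. J (s n t)) ` I \<subseteq> X2" for n
    using simple_function_compose1[OF s(1), of J n] s(2)[of n] J(1) by auto
  moreover have "AE t in ?m. (\<lambda>n. nrm2 (J (s n t) - J (w t))) \<longlonglongrightarrow> 0"
    using s(3) wX AE_space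
  proof eventually_elim
    case (elim t)
    then have "nrm2 (J (s n t) - J (w t)) = nrm (s n t - w t)" for n
      using s(2)[of n] by (intro J) auto
    then show ?case using elim by simp
  qed
  moreover have "integrable ?m (\<lambda>t. (nrm2 (J (w t)))\<^sup>2)"
  proof (rule integrable_lebesgue_on_cong_AE[OF I wi])
    show "AE t in ?m. (nrm (w t))\<^sup>2 = (nrm2 (J (w t)))\<^sup>2" using wX by eventually_elim (simp add: J)
  qed
  ultimately show ?thesis unfolding bochner_L2_def by (intro CollectI conjI exI[of _ "\<lambda>n t. J (s n t)"]) auto
qed

section \<open>Energy identity and continuous representatives\<close>

lemma seminormed_set_L2: "seminormed_set (L2_space M) (L2_norm M)"
proof
  show "0 \<in> L2_space M" using L2_space_zero[of M] by (simp add: zero_fun_def)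
qed (auto intro: L2_space_diff L2_norm_triangle_diff simp: L2_norm_0)

lemma LINT_lebesgue_on_cong_AE:
  fixes f g :: "'a::euclidean_space \<Rightarrow> 'b::euclidean_space"
  assumes "S \<in> sets lebesgue" "f \<in> borel_measurable (lebesgue_on S)" "AE x in lebesgue_on S. f x = g x"
  shows "(LINT x|lebesgue_on S. f x) = (LINT x|lebesgue_on S. g x)"
  using assms by (intro integral_cong_AE borel_measurable_lebesgue_on_AE[OF assms])

lemma mult_le_add_power2: "a * b \<le> a\<^sup>2 + (b::real)\<^sup>2"
proof -
  have "2 * (a * b) \<le> a\<^sup>2 + b\<^sup>2" using sum_squares_bound[of a b] by (simp add: mult.assoc)
  moreover have "0 \<le> a\<^sup>2 + b\<^sup>2" by simp
  ultimately show ?thesis by linarith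
qed

context evolution_triple
begin

sublocale Vsp: seminormed_set "W12_D \<Omega> \<Gamma>D" "V_norm \<Omega>"
proof
  show "0 \<in> V" "normV 0 = 0" using V_zero normV_zero by (simp_all add: zero_fun_def)
  show "normV (z - w) \<le> normV z + normV w" if "z \<in> V" "w \<in> V" for z w
    using L2_norm_triangle_diff[OF grad_L2 grad_L2, OF that] normV_diff[OF that] by (simp only: V_norm_def)
qed (auto intro: V_diff normV_nonneg)

sublocale Vdu: seminormed_set "V_dual \<Omega> \<Gamma>D" "V_dual_norm \<Omega> \<Gamma>D"
proof
  show "0 \<in> V'" "normV' 0 = 0" using V'_zero_fun normV'_zero_fun by (simp_all add: zero_fun_def)
qed (auto intro: V'_minus normV'_nonneg normV'_minus)

section \<open>The duality pairing in time and the weak time derivative in integrated form\<close>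

lemma pairing_measurable:
  assumes g: "Vdu.approx I r g" and w: "Vsp.approx I s w"
  shows "(\<lambda>t. g t (w t)) \<in> borel_measurable (lebesgue_on I)"
proof (rule borel_measurable_LIMSEQ_metric)
  show "(\<lambda>t. r n t (s n t)) \<in> borel_measurable (lebesgue_on I)" for n
    by (rule borel_measurable_simple_function[OF simple_function_compose2[where h="\<lambda>\<xi> z. \<xi> z",
      OF Vdu.approx_simple[OF g] Vsp.approx_simple[OF w]]])
  fix t assume "t \<in> space (lebesgue_on I)"
  then have t: "t \<in> I" by simp
  note X = Vdu.approx_in[OF g] Vsp.approx_in[OF w]
  show "(\<lambda>n. r n t (s n t)) \<longlonglongrightarrow> g t (w t)"
  proof (rule LIM_zero_cancel, rule Lim_null_comparison)
    have "norm (r n t (s n t) - g t (w t)) \<le> normV' (r n t - g t) * normV (s n t) + normV' (g t) * normV (s n t - w t)" for n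
    proof -
      have "r n t (s n t) - g t (w t) = (r n t - g t) (s n t) + g t (s n t - w t)"
        using V'_diff[OF X(2)[of t] X(3)[of n t] X(4)[of t]] by simp
      moreover have "\<bar>(r n t - g t) (s n t)\<bar> \<le> normV' (r n t - g t) * normV (s n t)"
        by (rule V'_le[OF V'_minus[OF X(1,2)] X(3)])
      moreover have "\<bar>g t (s n t - w t)\<bar> \<le> normV' (g t) * normV (s n t - w t)"
        by (rule V'_le[OF X(2) V_diff[OF X(3,4)]])
      ultimately show ?thesis by simp
    qed
    then show "\<forall>\<^sub>F n in sequentially. norm (r n t (s n t) - g t (w t))
        \<le> normV' (r n t - g t) * normV (s n t) + normV' (g t) * normV (s n t - w t)" by simp
    have "(\<lambda>n. normV' (r n t - g t) * normV (s n t) + normV' (g t) * normV (s n t - w t))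
        \<longlonglongrightarrow> 0 * normV (w t) + normV' (g t) * 0"
      by (intro tendsto_intros Vdu.approx_tendsto[OF g t] Vsp.approx_tendsto[OF w t] Vsp.approx_nrm_tendsto[OF w t])
    then show "(\<lambda>n. normV' (r n t - g t) * normV (s n t) + normV' (g t) * normV (s n t - w t)) \<longlonglongrightarrow> 0"
      by simp
  qed
qed

lemma pairing_integrable:
  assumes g: "Vdu.approx I r g" and w: "Vsp.approx I s w"
  shows "integrable (lebesgue_on I) (\<lambda>t. g t (w t))"
proof (rule Bochner_Integration.integrable_bound)
  show "integrable (lebesgue_on I) (\<lambda>t. (normV' (g t))\<^sup>2 + (normV (w t))\<^sup>2)"
    by (intro Bochner_Integration.integrable_add Vdu.approx_integrable[OF g] Vsp.approx_integrable[OF w])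
  have "\<bar>g t (w t)\<bar> \<le> (normV' (g t))\<^sup>2 + (normV (w t))\<^sup>2" for t
    using V'_le[OF Vdu.approx_in(2)[OF g, of t] Vsp.approx_in(2)[OF w, of t]] mult_le_add_power2[of "normV' (g t)" "normV (w t)"]
    by linarith
  then show "AE t in lebesgue_on I. norm (g t (w t)) \<le> norm ((normV' (g t))\<^sup>2 + (normV (w t))\<^sup>2)" by simp
qed (rule pairing_measurable[OF assms])

lemma approx_const: "z \<in> V \<Longrightarrow> Vsp.approx {a<..<b} (\<lambda>n t. z) (\<lambda>t. z)"
proof -
  assume "z \<in> V"
  interpret finite_measure "lebesgue_on {a<..<b}" by (rule finite_measure_lebesgue_on_interval)
  show ?thesis using \<open>z \<in> V\<close> Vsp.nrm_zero by (auto simp: Vsp.approx_def)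
qed

lemmas pairing_const_integrable = pairing_integrable[OF _ approx_const]

text \<open>The exceptional null set in the integrated form of the weak time derivative is made independent
  of \<open>z\<close> for \<open>z\<close> in the countable set of values of the approximants; the case \<open>z = w r\<close> follows by
  passing to the limit.\<close>

lemma integrated_time_derivative:
  assumes T: "0 < T" and w: "Vsp.approx {0<..<T} s w" and g: "Vdu.approx {0<..<T} r g" and h: "Vdu.approx {0<..<T} q h"
    and weak: "\<And>\<phi> z. \<phi> \<in> test_functions {0<..<T} \<Longrightarrow> z \<in> V \<Longrightarrow>
      (LINT t|lebesgue_on {0<..<T}. h t z * deriv \<phi> t) = - (LINT t|lebesgue_on {0<..<T}. g t z * \<phi> t)"
  shows "\<exists>N\<subseteq>{0<..<T}. (AE t in lebesgue_on {0<..<T}. t \<in> N) \<and>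
    (\<forall>a\<in>N. \<forall>b\<in>N. \<forall>c\<in>N. a \<le> b \<longrightarrow> h b (w c) - h a (w c) = integral {a..b} (\<lambda>\<tau>. g \<tau> (w c)))"
proof -
  let ?I = "{0<..<T}"
  let ?m = "lebesgue_on ?I"
  interpret finite_measure ?m by (rule finite_measure_lebesgue_on_interval)
  note wX = Vsp.approx_in[OF w] and gX = Vdu.approx_in[OF g] and hX = Vdu.approx_in[OF h]
  have gi: "integrable ?m (\<lambda>t. g t z)" if "z \<in> V" for z by (rule pairing_const_integrable[OF g that])
  have hi: "integrable ?m (\<lambda>t. h t z)" if "z \<in> V" for z by (rule pairing_const_integrable[OF h that])
  have "\<exists>c. AE t in ?m. h t z = c + integral {0..t} (\<lambda>\<tau>. g \<tau> z)" if "z \<in> V" for z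
    by (rule du_Bois_Reymond[OF T hi[OF that] gi[OF that] weak[OF _ that]])
  then obtain c where c: "\<And>z. z \<in> V \<Longrightarrow> AE t in ?m. h t z = c z + integral {0..t} (\<lambda>\<tau>. g \<tau> z)" by metis
  define Z where "Z = (\<Union>n. s n ` ?I)"
  have "finite (s n ` ?I)" for n using simple_functionD(1)[OF Vsp.approx_simple[OF w, of n]] by simp
  then have Z: "countable Z" "Z \<subseteq> V" unfolding Z_def using wX(1) by (auto intro: countable_finite)
  define N where "N = {t \<in> ?I. \<forall>z\<in>Z. h t z = c z + integral {0..t} (\<lambda>\<tau>. g \<tau> z)}"
  have "AE t in ?m. \<forall>z\<in>Z. h t z = c z + integral {0..t} (\<lambda>\<tau>. g \<tau> z)"
    using c Z by (subst AE_ball_countable) auto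
  then have ae: "AE t in ?m. t \<in> N"
    using AE_space by eventually_elim (simp add: N_def)
  have g_on: "(\<lambda>\<tau>. g \<tau> z) integrable_on {a..b}" if "z \<in> V" "0 \<le> a" "b \<le> T" for z a b
    by (rule integrable_on_subinterval_open[OF gi[OF that(1)] that(2,3)])
  have "integrable ?m (\<lambda>t. normV' (g t))"
    using Vdu.approx_integrable[OF g] Vdu.approx_nrm_measurable[OF g]
    by (intro L2_space_integrable_finite) (auto simp: L2_space_def finite_measure_lebesgue_on_interval)
  then have gn_on: "(\<lambda>\<tau>. normV' (g \<tau>)) integrable_on {a..b}" if "0 \<le> a" "b \<le> T" for a b
    by (rule integrable_on_subinterval_open[OF _ that])
  have "h b (w k) - h a (w k) = integral {a..b} (\<lambda>\<tau>. g \<tau> (w k))"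
    if abk: "a \<in> N" "b \<in> N" "k \<in> N" "a \<le> b" for a b k
  proof -
    have ab: "0 < a" "b < T" "k \<in> ?I" using abk by (auto simp: N_def)
    \<comment> \<open>\<open>D\<close> is the defect of the identity. It vanishes at
      \<open>s n k\<close>, which belongs to \<open>Z\<close>, and its change from there to
      \<open>w k\<close> is at most \<open>C\<close> times their distance in
      \<open>normV\<close>.\<close>
    define D where "D z = h b z - h a z - integral {a..b} (\<lambda>\<tau>. g \<tau> z)" for z
    have D0: "D (s n k) = 0" for n
    proof -
      have z: "s n k \<in> Z" "s n k \<in> V" using ab(3) wX(1) unfolding Z_def by blast+
      have "integral {0..a} (\<lambda>\<tau>. g \<tau> (s n k)) + integral {a..b} (\<lambda>\<tau>. g \<tau> (s n k)) = integral {0..b} (\<lambda>\<tau>. g \<tau> (s n k))"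
        using ab abk(4) by (intro Henstock_Kurzweil_Integration.integral_combine g_on z) auto
      moreover have "h b (s n k) = c (s n k) + integral {0..b} (\<lambda>\<tau>. g \<tau> (s n k))"
        "h a (s n k) = c (s n k) + integral {0..a} (\<lambda>\<tau>. g \<tau> (s n k))"
        using abk(1,2) z(1) by (auto simp: N_def)
      ultimately show ?thesis by (simp add: D_def)
    qed
    define C where "C = normV' (h b) + normV' (h a) + integral {a..b} (\<lambda>\<tau>. normV' (g \<tau>))"
    have "norm (D (w k)) \<le> C * normV (s n k - w k)" for n
    proof -
      let ?z = "s n k" and ?y = "w k"
      have zy: "?z \<in> V" "?y \<in> V" "?z - ?y \<in> V" using wX V_diff by auto
      have "integral {a..b} (\<lambda>\<tau>. g \<tau> ?z) - integral {a..b} (\<lambda>\<tau>. g \<tau> ?y) = integral {a..b} (\<lambda>\<tau>. g \<tau> (?z - ?y))"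
        using ab zy V'_diff[OF gX(2)]
        by (subst integral_diff[symmetric]) (auto intro!: g_on less_imp_le)
      then have "D ?z - D ?y = h b (?z - ?y) - h a (?z - ?y) - integral {a..b} (\<lambda>\<tau>. g \<tau> (?z - ?y))"
        using V'_diff[OF hX(2)] zy by (simp add: D_def)
      moreover have "\<bar>h b (?z - ?y)\<bar> \<le> normV' (h b) * normV (?z - ?y)" "\<bar>h a (?z - ?y)\<bar> \<le> normV' (h a) * normV (?z - ?y)"
        using V'_le[OF hX(2) zy(3)] by auto
      moreover have "\<bar>integral {a..b} (\<lambda>\<tau>. g \<tau> (?z - ?y))\<bar> \<le> integral {a..b} (\<lambda>\<tau>. normV' (g \<tau>) * normV (?z - ?y))"
        using ab zy V'_le[OF gX(2) zy(3)] gn_on[of a b]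
        by (subst real_norm_def[symmetric]) (intro integral_norm_bound_integral g_on integrable_on_mult_left; simp)
      ultimately have "\<bar>D ?z - D ?y\<bar> \<le> C * normV (?z - ?y)"
        by (simp add: C_def algebra_simps)
      then show ?thesis using D0[of n] by simp
    qed
    moreover have "(\<lambda>n. C * normV (s n k - w k)) \<longlonglongrightarrow> 0"
      using tendsto_mult_right_zero[OF Vsp.approx_tendsto[OF w ab(3)]] by simp
    ultimately have "norm (D (w k)) \<le> 0"
      by (intro LIMSEQ_le_const) auto
    then show ?thesis by (simp add: D_def)
  qed
  moreover have "N \<subseteq> ?I" by (auto simp: N_def)
  ultimately show ?thesis using ae by blast
qed

text \<open>The increments of the defect \<open>F\<close> are integrals of
  \<open>g \<tau> (w t) + g \<tau> (w s) - 2 * g \<tau> (w \<tau>)\<close>, a trapezoidal error.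
  Young's inequality with weight \<open>l\<close> splits it into an integrable density
  \<open>G\<close> and end point values of \<open>E / l\<close>, the form \<open>chain_bound\<close>
  accepts; everything is then of order \<open>l\<close>.\<close>

lemma energy_on_good_times:
  assumes T: "0 < T" and w: "Vsp.approx {0<..<T} s w" and g: "Vdu.approx {0<..<T} r g"
    and N: "N \<subseteq> {0<..<T}" "AE t in lebesgue_on {0<..<T}. t \<in> N"
    and key: "\<And>a b c. a \<in> N \<Longrightarrow> b \<in> N \<Longrightarrow> c \<in> N \<Longrightarrow> a \<le> b \<Longrightarrow>
      L2_inner \<mu> (w b) (w c) - L2_inner \<mu> (w a) (w c) = integral {a..b} (\<lambda>\<tau>. g \<tau> (w c))"
    and ab: "a \<in> N" "b \<in> N" "a < b"
  shows "(L2_norm \<mu> (w b))\<^sup>2 - (L2_norm \<mu> (w a))\<^sup>2 = 2 * integral {a..b} (\<lambda>\<tau>. g \<tau> (w \<tau>))"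
proof -
  let ?I = "{0<..<T}"
  let ?m = "lebesgue_on ?I"
  interpret finite_measure ?m by (rule finite_measure_lebesgue_on_interval)
  note wX = Vsp.approx_in[OF w] and gX = Vdu.approx_in[OF g]
  have gw: "integrable ?m (\<lambda>t. g t (w t))" by (rule pairing_integrable[OF g w])
  have gz: "integrable ?m (\<lambda>t. g t z)" if "z \<in> V" for z by (rule pairing_const_integrable[OF g that])
  note on = integrable_on_subinterval_open
  have gn: "integrable ?m (\<lambda>t. (normV' (g t))\<^sup>2)" by (rule Vdu.approx_integrable[OF g])
  define F where "F t = (L2_norm \<mu> (w t))\<^sup>2 - 2 * integral {0..t} (\<lambda>\<tau>. g \<tau> (w \<tau>))" for t
  \<comment> \<open>Sum of the contributions divided by \<open>l\<close>: the first two terms come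
    from \<open>2 * l * (normV' (g t))^2\<close> and \<open>2 * l\<close> in \<open>G\<close>; 6 is
    2 from \<open>(2 / l) * E\<close> in \<open>G\<close> plus 4 from \<open>chain_bound\<close>, as
    \<open>E / l\<close> has integral at most \<open>l\<close>.\<close>
  define K where "K = 2 * integral {0..T} (\<lambda>t. (normV' (g t))\<^sup>2) + 2 * T + 6"
  have small: "\<bar>F b - F a\<bar> \<le> l * K" if l: "0 < l" for l
  proof -
    \<comment> \<open>The modulus is requested with tolerance \<open>l^2\<close> because Young's
      inequality divides both \<open>E\<close> and the remainder by \<open>l\<close>.\<close>
    have "0 < l\<^sup>2" using l by simp
    from Vsp.approx_L2_modulus[OF w this] obtain E \<delta> where E: "0 < \<delta>" "integrable ?m E" "\<And>t. 0 \<le> E t"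
      "(LINT t|?m. E t) < l\<^sup>2"
      "\<And>t \<tau>. t \<in> ?I \<Longrightarrow> \<tau> \<in> ?I \<Longrightarrow> \<bar>t - \<tau>\<bar> < \<delta> \<Longrightarrow> (normV (w t - w \<tau>))\<^sup>2 \<le> E t + E \<tau> + l\<^sup>2" by metis
    define G where "G t = 2 * l * (normV' (g t))\<^sup>2 + (2 / l) * E t + 2 * l" for t
    have Gi: "integrable ?m G" unfolding G_def using gn E(2) by auto
    have step: "\<bar>F t - F s\<bar> \<le> integral {s..t} G + (t - s) * (E s / l + E t / l)"
      if st: "s \<in> N" "t \<in> N" "s < t" "t - s < \<delta>" for s t
    proof -
      have sI: "s \<in> ?I" "t \<in> ?I" using st N(1) by auto
      have s0: "0 \<le> s" "t \<le> T" using sI by auto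
      \<comment> \<open>The integrated equation is used with \<open>w t\<close> and with
        \<open>w s\<close>; by symmetry of the inner product the mixed terms cancel.\<close>
      have "(L2_norm \<mu> (w t))\<^sup>2 - (L2_norm \<mu> (w s))\<^sup>2
          = (L2_inner \<mu> (w t) (w t) - L2_inner \<mu> (w s) (w t)) + (L2_inner \<mu> (w t) (w s) - L2_inner \<mu> (w s) (w s))"
        by (simp add: L2_norm_power2 L2_inner_commute)
      also have "\<dots> = integral {s..t} (\<lambda>\<tau>. g \<tau> (w t)) + integral {s..t} (\<lambda>\<tau>. g \<tau> (w s))"
        using key[of s t t] key[of s t s] st by simp
      finally have 1: "(L2_norm \<mu> (w t))\<^sup>2 - (L2_norm \<mu> (w s))\<^sup>2
          = integral {s..t} (\<lambda>\<tau>. g \<tau> (w t)) + integral {s..t} (\<lambda>\<tau>. g \<tau> (w s))" .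
      have "integral {0..s} (\<lambda>\<tau>. g \<tau> (w \<tau>)) + integral {s..t} (\<lambda>\<tau>. g \<tau> (w \<tau>)) = integral {0..t} (\<lambda>\<tau>. g \<tau> (w \<tau>))"
        using st s0 by (intro Henstock_Kurzweil_Integration.integral_combine on[OF gw]) auto
      then have "F t - F s = integral {s..t} (\<lambda>\<tau>. g \<tau> (w t)) + integral {s..t} (\<lambda>\<tau>. g \<tau> (w s)) - 2 * integral {s..t} (\<lambda>\<tau>. g \<tau> (w \<tau>))"
        using 1 by (simp add: F_def)
      also have "\<dots> = integral {s..t} (\<lambda>\<tau>. g \<tau> (w t) + g \<tau> (w s) - 2 * g \<tau> (w \<tau>))"
        using on[OF gz[OF wX(2)[of t]] s0] on[OF gz[OF wX(2)[of s]] s0] on[OF gw s0]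
        by (simp add: integral_diff integral_add integrable_add integrable_on_mult_right)
      finally have eq: "F t - F s = integral {s..t} (\<lambda>\<tau>. g \<tau> (w t) + g \<tau> (w s) - 2 * g \<tau> (w \<tau>))" .
      have Gs: "(\<lambda>\<tau>. G \<tau> + (E s / l + E t / l)) integrable_on {s..t}"
        using on[OF Gi s0] by (intro integrable_add) auto
      have bound: "\<bar>g \<tau> (w t) + g \<tau> (w s) - 2 * g \<tau> (w \<tau>)\<bar> \<le> G \<tau> + (E s / l + E t / l)" if \<tau>: "\<tau> \<in> {s..t}" for \<tau>
      proof -
        have \<tau>I: "\<tau> \<in> ?I" using \<tau> sI by auto
        have d: "normV' (g \<tau>) * normV (w x - w \<tau>) \<le> l * (normV' (g \<tau>))\<^sup>2 + (E x + E \<tau>) / l + l"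
          if x: "x \<in> ?I" "\<bar>x - \<tau>\<bar> < \<delta>" for x
        proof -
          let ?a = "normV' (g \<tau>)" and ?d = "normV (w x - w \<tau>)"
          have "(l * ?a) * ?d \<le> (l * ?a)\<^sup>2 + ?d\<^sup>2" by (rule mult_le_add_power2)
          also have "?d\<^sup>2 \<le> E x + E \<tau> + l\<^sup>2" by (rule E(5)[OF x(1) \<tau>I x(2)])
          also have "(l * ?a)\<^sup>2 + (E x + E \<tau> + l\<^sup>2) = l * (l * ?a\<^sup>2 + (E x + E \<tau>) / l + l)"
            using l by (simp add: power2_eq_square distrib_left add_divide_distrib)
          finally have "l * (?a * ?d) \<le> l * (l * ?a\<^sup>2 + (E x + E \<tau>) / l + l)" by (simp only: mult.assoc)
          then show ?thesis using l by (simp only: mult_le_cancel_left_pos)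
        qed
        have "g \<tau> (w t) + g \<tau> (w s) - 2 * g \<tau> (w \<tau>) = g \<tau> (w t - w \<tau>) + g \<tau> (w s - w \<tau>)"
          using V'_diff[OF gX(2)] wX by simp
        moreover have "\<bar>g \<tau> (w t - w \<tau>)\<bar> \<le> normV' (g \<tau>) * normV (w t - w \<tau>)"
          "\<bar>g \<tau> (w s - w \<tau>)\<bar> \<le> normV' (g \<tau>) * normV (w s - w \<tau>)"
          using V'_le[OF gX(2)] V_diff wX by auto
        moreover have "\<bar>t - \<tau>\<bar> < \<delta>" "\<bar>s - \<tau>\<bar> < \<delta>" using \<tau> st by auto
        ultimately have "\<bar>g \<tau> (w t) + g \<tau> (w s) - 2 * g \<tau> (w \<tau>)\<bar>
            \<le> (l * (normV' (g \<tau>))\<^sup>2 + (E t + E \<tau>) / l + l) + (l * (normV' (g \<tau>))\<^sup>2 + (E s + E \<tau>) / l + l)"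
          using d[OF sI(1)] d[OF sI(2)] by linarith
        also have "\<dots> = G \<tau> + (E s / l + E t / l)" by (simp add: G_def add_divide_distrib)
        finally show ?thesis .
      qed
      have "\<bar>F t - F s\<bar> \<le> integral {s..t} (\<lambda>\<tau>. G \<tau> + (E s / l + E t / l))"
        unfolding eq real_norm_def[symmetric]
        using on[OF gz[OF wX(2)[of t]] s0] on[OF gz[OF wX(2)[of s]] s0] on[OF gw s0] bound
        by (intro integral_norm_bound_integral[OF _ Gs] integrable_diff integrable_add integrable_on_mult_right) auto
      also have "\<dots> = integral {s..t} G + (t - s) * (E s / l + E t / l)"
        using on[OF Gi s0] st by (subst integral_add) auto
      finally show ?thesis .
    qed
    have "\<bar>F b - F a\<bar> \<le> integral {a..b} G + 4 * integral {0..T} (\<lambda>t. E t / l)"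
      by (rule chain_bound[OF N(2,1) _ _ Gi E(1) step ab]) (use E(2,3) l in auto)
    also have "integral {a..b} G \<le> integral {0..T} G"
    proof (rule integral_subset_le)
      show "{a..b} \<subseteq> {0..T}" "G integrable_on {a..b}" "G integrable_on {0..T}"
        using ab N(1) by (auto intro!: on[OF Gi] less_imp_le)
      show "\<forall>t\<in>{0..T}. 0 \<le> G t" using E(3) l by (auto simp: G_def intro!: add_nonneg_nonneg)
    qed
    also have "integral {0..T} G = 2 * l * integral {0..T} (\<lambda>t. (normV' (g t))\<^sup>2) + (2 / l) * integral {0..T} E + T * (2 * l)"
    proof -
      have "(LINT t|?m. G t) = 2 * l * (LINT t|?m. (normV' (g t))\<^sup>2) + (2 / l) * (LINT t|?m. E t) + T * (2 * l)"
        unfolding G_def using gn E(2) T by (simp add: measure_restrict_space)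
      then show ?thesis using LINT_open_interval[OF Gi] LINT_open_interval[OF gn] LINT_open_interval[OF E(2)] by simp
    qed
    also have "integral {0..T} (\<lambda>t. E t / l) = integral {0..T} E / l" by simp
    also have "2 * l * integral {0..T} (\<lambda>t. (normV' (g t))\<^sup>2) + (2 / l) * integral {0..T} E + T * (2 * l) + 4 * (integral {0..T} E / l)
       = 2 * l * integral {0..T} (\<lambda>t. (normV' (g t))\<^sup>2) + T * (2 * l) + 6 * (integral {0..T} E / l)" by simp
    also have "integral {0..T} E / l \<le> l"
      using E(4) LINT_open_interval[OF E(2)] l by (simp add: pos_divide_le_eq power2_eq_square)
    finally show ?thesis by (simp add: K_def algebra_simps)
  qed
  have "\<bar>F b - F a\<bar> \<le> 0"
  proof (rule field_le_epsilon)
    fix e :: real assume e: "0 < e"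
    have "0 \<le> integral {0..T} (\<lambda>t. (normV' (g t))\<^sup>2)"
      by (rule Henstock_Kurzweil_Integration.integral_nonneg[OF on[OF gn]]) auto
    then have K: "0 < K" using T by (simp add: K_def)
    have "\<bar>F b - F a\<bar> \<le> (e / K) * K" using e K by (intro small) simp
    then show "\<bar>F b - F a\<bar> \<le> 0 + e" using K by simp
  qed
  moreover have "integral {0..a} (\<lambda>\<tau>. g \<tau> (w \<tau>)) + integral {a..b} (\<lambda>\<tau>. g \<tau> (w \<tau>)) = integral {0..b} (\<lambda>\<tau>. g \<tau> (w \<tau>))"
    using ab N(1) by (intro Henstock_Kurzweil_Integration.integral_combine on[OF gw]) auto
  ultimately show ?thesis by (simp add: F_def)
qed

text \<open>The intermediate time \<open>c\<close> is chosen such that \<open>\<parallel>w c\<parallel>\<^sup>2\<close> is at most its average over the interval.\<close>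

lemma H_modulus_on_good_times:
  assumes T: "0 < T" and w: "Vsp.approx {0<..<T} s w" and g: "Vdu.approx {0<..<T} r g"
    and N: "N \<subseteq> {0<..<T}" "AE t in lebesgue_on {0<..<T}. t \<in> N"
    and key: "\<And>a b c. a \<in> N \<Longrightarrow> b \<in> N \<Longrightarrow> c \<in> N \<Longrightarrow> a \<le> b \<Longrightarrow>
      L2_inner \<mu> (w b) (w c) - L2_inner \<mu> (w a) (w c) = integral {a..b} (\<lambda>\<tau>. g \<tau> (w c))"
    and ab: "a \<in> N" "b \<in> N" "a < b"
  shows "(L2_norm \<mu> (w b - w a))\<^sup>2 \<le> 8 * integral {a..b} (\<lambda>\<tau>. (normV' (g \<tau>))\<^sup>2 + (normV (w \<tau>))\<^sup>2)"
proof -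
  let ?I = "{0<..<T}"
  let ?m = "lebesgue_on ?I"
  note wX = Vsp.approx_in[OF w] and gX = Vdu.approx_in[OF g]
  have gw: "integrable ?m (\<lambda>t. g t (w t))" by (rule pairing_integrable[OF g w])
  have gz: "integrable ?m (\<lambda>t. g t z)" if "z \<in> V" for z by (rule pairing_const_integrable[OF g that])
  have gn: "integrable ?m (\<lambda>t. (normV' (g t))\<^sup>2)" by (rule Vdu.approx_integrable[OF g])
  have wn: "integrable ?m (\<lambda>t. (normV (w t))\<^sup>2)" by (rule Vsp.approx_integrable[OF w])
  note on = integrable_on_subinterval_open
  have a0: "0 < a" "b < T" using ab N(1) by auto
  define P where "P \<tau> = (normV' (g \<tau>))\<^sup>2 + (normV (w \<tau>))\<^sup>2" for \<tau>
  have Pi: "integrable ?m P" unfolding P_def using gn wn by auto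
  have "AE t in lebesgue_on {a<..<b}. t \<in> N" by (rule AE_lebesgue_on_subset[OF N(2)]) (use a0 in auto)
  from exists_le_average[OF ab(3) integrable_lebesgue_on_open_subinterval[OF wn] this]
  obtain c where c: "a < c" "c < b" "c \<in> N" "(b - a) * (normV (w c))\<^sup>2 \<le> integral {a..b} (\<lambda>\<tau>. (normV (w \<tau>))\<^sup>2)"
    using a0 by auto
  have pair_le: "\<bar>g \<tau> (w x)\<bar> \<le> ((normV' (g \<tau>))\<^sup>2 + (normV (w x))\<^sup>2)" for \<tau> x
    using V'_le[OF gX(2)[of \<tau>] wX(2)[of x]] mult_le_add_power2[of "normV' (g \<tau>)" "normV (w x)"] by linarith
  \<comment> \<open>With \<open>c\<close> as an end point, the squared distance combines the energy
    increment with the increment of the inner product with \<open>w c\<close>. Only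
    \<open>normV (w c)\<close> enters, which is controlled by an average, whereas
    \<open>normV (w a)\<close> and \<open>normV (w b)\<close> may be large.\<close>
  have seg: "(L2_norm \<mu> (w y - w x))\<^sup>2 \<le> 2 * integral {x..y} P + 2 * integral {x..y} (\<lambda>\<tau>. (normV' (g \<tau>))\<^sup>2 + (normV (w c))\<^sup>2)"
    if xy: "x \<in> N" "y \<in> N" "x < y" "c = x \<or> c = y" for x y
  proof -
    have x0: "0 \<le> x" "y \<le> T" using xy N(1) by auto
    have e: "(L2_norm \<mu> (w y))\<^sup>2 - (L2_norm \<mu> (w x))\<^sup>2 = 2 * integral {x..y} (\<lambda>\<tau>. g \<tau> (w \<tau>))"
      using energy_on_good_times[OF T w g N key xy(1,2,3)] by simp
    have k: "L2_inner \<mu> (w y) (w c) - L2_inner \<mu> (w x) (w c) = integral {x..y} (\<lambda>\<tau>. g \<tau> (w c))"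
      using key[OF xy(1,2) c(3)] xy(3) by simp
    have "(L2_norm \<mu> (w y - w x))\<^sup>2 = (L2_norm \<mu> (w y))\<^sup>2 - 2 * L2_inner \<mu> (w y) (w x) + (L2_norm \<mu> (w x))\<^sup>2"
      by (intro L2_norm_diff_power2 V_L2 wX)
    also have "\<dots> \<le> 2 * \<bar>integral {x..y} (\<lambda>\<tau>. g \<tau> (w \<tau>))\<bar> + 2 * \<bar>integral {x..y} (\<lambda>\<tau>. g \<tau> (w c))\<bar>"
      using xy(4) e k L2_inner_commute[of \<mu> "w x" "w y"] by (auto simp: L2_norm_power2)
    also have "\<bar>integral {x..y} (\<lambda>\<tau>. g \<tau> (w \<tau>))\<bar> \<le> integral {x..y} P"
      unfolding real_norm_def[symmetric] using on[OF gw x0] on[OF Pi x0] pair_le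
      by (intro integral_norm_bound_integral) (auto simp: P_def)
    also have "\<bar>integral {x..y} (\<lambda>\<tau>. g \<tau> (w c))\<bar> \<le> integral {x..y} (\<lambda>\<tau>. (normV' (g \<tau>))\<^sup>2 + (normV (w c))\<^sup>2)"
      unfolding real_norm_def[symmetric] using on[OF gz[OF wX(2)[of c]] x0] on[OF gn x0] pair_le
      by (intro integral_norm_bound_integral integrable_add) auto
    finally show ?thesis by simp
  qed
  have "(L2_norm \<mu> (w b - w a))\<^sup>2 \<le> 2 * (L2_norm \<mu> (w b - w c))\<^sup>2 + 2 * (L2_norm \<mu> (w c - w a))\<^sup>2"
  proof -
    have "L2_norm \<mu> (w b - w a) \<le> L2_norm \<mu> (w b - w c) + L2_norm \<mu> (w c - w a)"
      by (intro L2_norm_triangle3 V_L2 wX)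
    then have "(L2_norm \<mu> (w b - w a))\<^sup>2 \<le> (L2_norm \<mu> (w b - w c) + L2_norm \<mu> (w c - w a))\<^sup>2"
      by (intro power_mono) auto
    also have "\<dots> \<le> 2 * (L2_norm \<mu> (w b - w c))\<^sup>2 + 2 * (L2_norm \<mu> (w c - w a))\<^sup>2"
      using sum_squares_bound[of "L2_norm \<mu> (w b - w c)" "L2_norm \<mu> (w c - w a)"] by (simp add: power2_sum)
    finally show ?thesis .
  qed
  also have "\<dots> \<le> 4 * (integral {a..c} P + integral {c..b} P)
      + 4 * (integral {a..c} (\<lambda>\<tau>. (normV' (g \<tau>))\<^sup>2 + (normV (w c))\<^sup>2) + integral {c..b} (\<lambda>\<tau>. (normV' (g \<tau>))\<^sup>2 + (normV (w c))\<^sup>2))"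
    using seg[OF ab(1) c(3) c(1)] seg[OF c(3) ab(2) c(2)] by simp
  also have "integral {a..c} P + integral {c..b} P = integral {a..b} P"
    using c a0 by (intro Henstock_Kurzweil_Integration.integral_combine on[OF Pi]) auto
  also have "integral {a..c} (\<lambda>\<tau>. (normV' (g \<tau>))\<^sup>2 + (normV (w c))\<^sup>2) + integral {c..b} (\<lambda>\<tau>. (normV' (g \<tau>))\<^sup>2 + (normV (w c))\<^sup>2)
      = integral {a..b} (\<lambda>\<tau>. (normV' (g \<tau>))\<^sup>2 + (normV (w c))\<^sup>2)"
    using c a0 by (intro Henstock_Kurzweil_Integration.integral_combine integrable_add on[OF gn]) auto
  also have "\<dots> = integral {a..b} (\<lambda>\<tau>. (normV' (g \<tau>))\<^sup>2) + (b - a) * (normV (w c))\<^sup>2"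
    using c a0 on[OF gn, of a b] by (subst integral_add) auto
  also have "\<dots> \<le> integral {a..b} (\<lambda>\<tau>. (normV' (g \<tau>))\<^sup>2) + integral {a..b} (\<lambda>\<tau>. (normV (w \<tau>))\<^sup>2)"
    using c(4) by simp
  also have "\<dots> = integral {a..b} P"
    unfolding P_def using a0 on[OF gn, of a b] on[OF wn, of a b] by (subst integral_add) auto
  finally have "(L2_norm \<mu> (w b - w a))\<^sup>2 \<le> 8 * integral {a..b} P" by linarith
  then show ?thesis unfolding P_def[abs_def] .
qed

text \<open>On good times the squared distance in \<open>H\<close> is at most 8 times an increment
  of the continuous function \<open>\<Phi>\<close>. Every time is a limit of good ones, so
  \<open>W t\<close> exists by completeness of \<open>L^2\<close> and inherits the modulus. At a
  good time the modulus between \<open>W t\<close> and \<open>w t\<close> is zero.\<close>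

lemma continuous_rep_exists:
  assumes T: "0 < T" and w: "Vsp.approx {0<..<T} s w" and g: "Vdu.approx {0<..<T} r g"
    and N: "N \<subseteq> {0<..<T}" "AE t in lebesgue_on {0<..<T}. t \<in> N"
    and key: "\<And>a b c. a \<in> N \<Longrightarrow> b \<in> N \<Longrightarrow> c \<in> N \<Longrightarrow> a \<le> b \<Longrightarrow>
      L2_inner \<mu> (w b) (w c) - L2_inner \<mu> (w a) (w c) = integral {a..b} (\<lambda>\<tau>. g \<tau> (w c))"
  shows "\<exists>W. continuous_rep \<Omega> T w W"
proof -
  let ?I = "{0<..<T}"
  let ?m = "lebesgue_on ?I"
  note wX = Vsp.approx_in[OF w]
  define P where "P = (\<lambda>\<tau>. (normV' (g \<tau>))\<^sup>2 + (normV (w \<tau>))\<^sup>2)"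
  have Pi: "integrable ?m P"
    unfolding P_def by (intro Bochner_Integration.integrable_add Vdu.approx_integrable[OF g] Vsp.approx_integrable[OF w])
  define \<Phi> where "\<Phi> t = integral {0..t} P" for t
  have cont: "continuous_on {0..T} \<Phi>"
    unfolding \<Phi>_def by (intro indefinite_integral_continuous_1 integrable_on_subinterval_open[OF Pi]) auto
  have \<Phi>: "integral {a..b} P = \<Phi> b - \<Phi> a" if "0 \<le> a" "a \<le> b" "b \<le> T" for a b
    using Henstock_Kurzweil_Integration.integral_combine[of 0 a b P] integrable_on_subinterval_open[OF Pi, of 0 b] that
    by (simp add: \<Phi>_def)
  have modN: "(L2_norm \<mu> (w b - w a))\<^sup>2 \<le> 8 * \<bar>\<Phi> b - \<Phi> a\<bar>" if "a \<in> N" "b \<in> N" for a b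
  proof -
    have *: "(L2_norm \<mu> (w b - w a))\<^sup>2 \<le> 8 * \<bar>\<Phi> b - \<Phi> a\<bar>" if "a \<in> N" "b \<in> N" "a < b" for a b
    proof -
      have "(L2_norm \<mu> (w b - w a))\<^sup>2 \<le> 8 * integral {a..b} P"
        unfolding P_def by (rule H_modulus_on_good_times[OF T w g N key that])
      moreover have "a \<in> {0<..<T}" "b \<in> {0<..<T}" using that N(1) by auto
      ultimately show ?thesis using \<Phi>[of a b] that(3) abs_ge_self[of "\<Phi> b - \<Phi> a"] by auto
    qed
    consider "a < b" | "b < a" | "a = b" by linarith
    then show ?thesis
    proof cases
      case 2
      then show ?thesis using *[of b a] that L2_norm_minus_commute[of \<mu> "w a" "w b"] by (simp add: abs_minus_commute)
    qed (use * that in \<open>auto simp: L2_norm_0\<close>)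
  qed
  have "\<exists>x. (\<forall>n. x n \<in> N) \<and> x \<longlonglongrightarrow> t" if t: "t \<in> {0..T}" for t
  proof -
    have "\<exists>y\<in>N. \<bar>y - t\<bar> < inverse (real (Suc n))" for n
    proof -
      define d where "d = inverse (real (Suc n))"
      have d: "0 < d" by (simp add: d_def)
      define lo hi where "lo = max 0 (t - d)" and "hi = min T (t + d)"
      have lh: "lo < hi" using t T d by (auto simp: lo_def hi_def)
      have "AE y in lebesgue_on {lo<..<hi}. y \<in> N"
        by (rule AE_lebesgue_on_subset[OF N(2)]) (auto simp: lo_def hi_def)
      from AE_interval_imp_ex[OF lh this] obtain y where "y \<in> {lo<..<hi}" "y \<in> N" by blast
      then show ?thesis by (intro bexI[of _ y]) (auto simp: lo_def hi_def d_def)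
    qed
    then obtain x where x: "\<And>n. x n \<in> N" "\<And>n. \<bar>x n - t\<bar> < inverse (real (Suc n))" by metis
    have "(\<lambda>n. x n - t) \<longlonglongrightarrow> 0"
      by (rule Lim_null_comparison[OF _ LIMSEQ_inverse_real_of_nat]) (use x(2) in \<open>auto intro!: always_eventually less_imp_le\<close>)
    then show ?thesis using x(1) LIM_zero_cancel by blast
  qed
  then obtain x where x: "\<And>t n. t \<in> {0..T} \<Longrightarrow> x t n \<in> N" "\<And>t. t \<in> {0..T} \<Longrightarrow> x t \<longlonglongrightarrow> t" by metis
  have \<Phi>x: "(\<lambda>n. \<Phi> (x t n)) \<longlonglongrightarrow> \<Phi> t" if t: "t \<in> {0..T}" for t
  proof (rule continuous_on_tendsto_compose[OF cont x(2)[OF t] t])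
    have "x t n \<in> {0..T}" for n using x(1)[OF t, of n] N(1) by force
    then show "\<forall>\<^sub>F n in sequentially. x t n \<in> {0..T}" by simp
  qed
  have "\<exists>y\<in>L2_space \<mu>. (\<lambda>n. L2_norm \<mu> (w (x t n) - y)) \<longlonglongrightarrow> 0" if t: "t \<in> {0..T}" for t
  proof (rule L2_complete)
    show "w (x t n) \<in> L2_space \<mu>" for n by (intro V_L2 wX)
    fix e :: real assume e: "0 < e"
    have "Cauchy (\<lambda>n. \<Phi> (x t n))" using \<Phi>x[OF t] by (rule LIMSEQ_imp_Cauchy)
    moreover have "0 < e\<^sup>2 / 8" using e by simp
    ultimately obtain K where K: "\<And>m n. m \<ge> K \<Longrightarrow> n \<ge> K \<Longrightarrow> \<bar>\<Phi> (x t m) - \<Phi> (x t n)\<bar> < e\<^sup>2 / 8"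
      unfolding Cauchy_def dist_real_def by blast
    show "\<exists>K. \<forall>m\<ge>K. \<forall>n\<ge>K. L2_norm \<mu> (w (x t m) - w (x t n)) < e"
    proof (intro exI allI impI)
      fix m n assume mn: "K \<le> m" "K \<le> n"
      have "8 * \<bar>\<Phi> (x t m) - \<Phi> (x t n)\<bar> < e\<^sup>2" using K[OF mn] by simp
      with modN[OF x(1)[OF t] x(1)[OF t]] have "(L2_norm \<mu> (w (x t m) - w (x t n)))\<^sup>2 < e\<^sup>2"
        by (rule le_less_trans)
      then show "L2_norm \<mu> (w (x t m) - w (x t n)) < e"
        using e by (intro power2_less_imp_less[of _ e]) auto
    qed
  qed
  then obtain W where W: "\<And>t. t \<in> {0..T} \<Longrightarrow> W t \<in> L2_space \<mu>"
    "\<And>t. t \<in> {0..T} \<Longrightarrow> (\<lambda>n. L2_norm \<mu> (w (x t n) - W t)) \<longlonglongrightarrow> 0" by metis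
  have lim: "(\<lambda>n. L2_norm \<mu> (w (x t n) - y)) \<longlonglongrightarrow> L2_norm \<mu> (W t - y)"
    if t: "t \<in> {0..T}" and y: "y \<in> L2_space \<mu>" for t y
  proof (rule L2_norm_diff_tendsto)
    show "w (x t n) - y \<in> L2_space \<mu>" for n by (intro L2_space_diff V_L2 wX y)
    show "W t - y \<in> L2_space \<mu>" by (intro L2_space_diff W t y)
    have "w (x t n) - y - (W t - y) = w (x t n) - W t" for n by (simp add: fun_eq_iff)
    then show "(\<lambda>n. L2_norm \<mu> (w (x t n) - y - (W t - y))) \<longlonglongrightarrow> 0" using W(2)[OF t] by (simp only:)
  qed
  have modW: "(L2_norm \<mu> (W t - w a))\<^sup>2 \<le> 8 * \<bar>\<Phi> t - \<Phi> a\<bar>" if t: "t \<in> {0..T}" and a: "a \<in> N" for t a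
  proof (rule LIMSEQ_le)
    show "(\<lambda>n. (L2_norm \<mu> (w (x t n) - w a))\<^sup>2) \<longlonglongrightarrow> (L2_norm \<mu> (W t - w a))\<^sup>2"
      by (intro tendsto_power lim t V_L2 wX)
    show "(\<lambda>n. 8 * \<bar>\<Phi> (x t n) - \<Phi> a\<bar>) \<longlonglongrightarrow> 8 * \<bar>\<Phi> t - \<Phi> a\<bar>"
      by (intro tendsto_intros \<Phi>x t)
    show "\<exists>K. \<forall>n\<ge>K. (L2_norm \<mu> (w (x t n) - w a))\<^sup>2 \<le> 8 * \<bar>\<Phi> (x t n) - \<Phi> a\<bar>"
      using modN[OF a x(1)[OF t]] by blast
  qed
  have modWW: "(L2_norm \<mu> (W u - W t))\<^sup>2 \<le> 8 * \<bar>\<Phi> u - \<Phi> t\<bar>" if t: "t \<in> {0..T}" and u: "u \<in> {0..T}" for t u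
  proof (rule LIMSEQ_le)
    show "(\<lambda>n. (L2_norm \<mu> (w (x u n) - W t))\<^sup>2) \<longlonglongrightarrow> (L2_norm \<mu> (W u - W t))\<^sup>2"
      by (intro tendsto_power lim u W t)
    show "(\<lambda>n. 8 * \<bar>\<Phi> (x u n) - \<Phi> t\<bar>) \<longlonglongrightarrow> 8 * \<bar>\<Phi> u - \<Phi> t\<bar>"
      by (intro tendsto_intros \<Phi>x u)
    have "(L2_norm \<mu> (w (x u n) - W t))\<^sup>2 \<le> 8 * \<bar>\<Phi> (x u n) - \<Phi> t\<bar>" for n
      using modW[OF t x(1)[OF u, of n]] L2_norm_minus_commute[of \<mu> "W t"] by (simp add: abs_minus_commute)
    then show "\<exists>K. \<forall>n\<ge>K. (L2_norm \<mu> (w (x u n) - W t))\<^sup>2 \<le> 8 * \<bar>\<Phi> (x u n) - \<Phi> t\<bar>" by blast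
  qed
  have "((\<lambda>u. L2_norm \<mu> (W u - W t)) \<longlongrightarrow> 0) (at t within {0..T})" if t: "t \<in> {0..T}" for t
  proof (rule Lim_null_comparison)
    show "\<forall>\<^sub>F u in at t within {0..T}. norm (L2_norm \<mu> (W u - W t)) \<le> sqrt (8 * \<bar>\<Phi> u - \<Phi> t\<bar>)"
      unfolding eventually_at_filter
      by (intro always_eventually) (use modWW[OF t] in \<open>auto intro!: real_le_rsqrt\<close>)
    have "(\<Phi> \<longlongrightarrow> \<Phi> t) (at t within {0..T})" using cont t by (simp add: continuous_on_def)
    then have "((\<lambda>u. sqrt (8 * \<bar>\<Phi> u - \<Phi> t\<bar>)) \<longlongrightarrow> sqrt (8 * \<bar>\<Phi> t - \<Phi> t\<bar>)) (at t within {0..T})"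
      by (intro tendsto_intros)
    then show "((\<lambda>u. sqrt (8 * \<bar>\<Phi> u - \<Phi> t\<bar>)) \<longlongrightarrow> 0) (at t within {0..T})" by simp
  qed
  moreover have "AE t in ?m. AE y in \<mu>. W t y = w t y"
    using N(2)
  proof eventually_elim
    case (elim t)
    then have t: "t \<in> {0..T}" using N(1) by auto
    have "L2_norm \<mu> (W t - w t) = 0" using modW[OF t elim] by simp
    then have "AE y in \<mu>. (W t - w t) y = 0"
      by (intro L2_norm_eq_0_AE L2_space_diff W t V_L2 wX)
    then show ?case by eventually_elim simp
  qed
  ultimately show ?thesis using W(1) unfolding continuous_rep_def by blast
qed

text \<open>On the set \<open>M\<close> of good times where \<open>W t = w t\<close> almost
  everywhere, \<open>W\<close> inherits the energy identity. The end points are reached as limits of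
  points of \<open>M\<close>, using the continuity of \<open>W\<close> in \<open>H\<close> and of
  the primitive \<open>Q\<close>.\<close>

lemma energy_identity_end_points:
  assumes T: "0 < T" and w: "Vsp.approx {0<..<T} s w" and g: "Vdu.approx {0<..<T} r g"
    and N: "N \<subseteq> {0<..<T}" "AE t in lebesgue_on {0<..<T}. t \<in> N"
    and key: "\<And>a b c. a \<in> N \<Longrightarrow> b \<in> N \<Longrightarrow> c \<in> N \<Longrightarrow> a \<le> b \<Longrightarrow>
      L2_inner \<mu> (w b) (w c) - L2_inner \<mu> (w a) (w c) = integral {a..b} (\<lambda>\<tau>. g \<tau> (w c))"
    and W: "continuous_rep \<Omega> T w W"
  shows "(L2_norm \<mu> (W T))\<^sup>2 - (L2_norm \<mu> (W 0))\<^sup>2 = 2 * (LINT t|lebesgue_on {0<..<T}. g t (w t))"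
proof -
  let ?I = "{0<..<T}"
  let ?m = "lebesgue_on ?I"
  note wX = Vsp.approx_in[OF w]
  have gw: "integrable ?m (\<lambda>t. g t (w t))" by (rule pairing_integrable[OF g w])
  define Q where "Q t = integral {0..t} (\<lambda>\<tau>. g \<tau> (w \<tau>))" for t
  have contQ: "continuous_on {0..T} Q"
    unfolding Q_def by (intro indefinite_integral_continuous_1 integrable_on_subinterval_open[OF gw]) auto
  have WL2: "W t \<in> L2_space \<mu>" and Wc: "((\<lambda>s. L2_norm \<mu> (W s - W t)) \<longlongrightarrow> 0) (at t within {0..T})"
    if "t \<in> {0..T}" for t using W that by (auto simp: continuous_rep_def)
  have Wae: "AE t in ?m. AE x in \<mu>. W t x = w t x" using W by (simp add: continuous_rep_def)
  define M where "M = {t \<in> N. AE x in \<mu>. W t x = w t x}"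
  have Mae: "AE t in ?m. t \<in> M" using N(2) Wae by eventually_elim (simp add: M_def)
  have normM: "L2_norm \<mu> (W t) = L2_norm \<mu> (w t)" if "t \<in> M" for t
  proof -
    have "t \<in> {0..T}" using that N(1) by (auto simp: M_def)
    then show ?thesis
      using that by (intro L2_norm_cong_AE L2_space_measurable WL2 V_L2 wX) (auto simp: M_def)
  qed
  have eq: "(L2_norm \<mu> (W b))\<^sup>2 - (L2_norm \<mu> (W a))\<^sup>2 = 2 * (Q b - Q a)" if "a \<in> M" "b \<in> M" "a < b" for a b
  proof -
    have ab: "a \<in> N" "b \<in> N" "0 < a" "b < T" using that N(1) by (auto simp: M_def)
    have "integral {0..a} (\<lambda>\<tau>. g \<tau> (w \<tau>)) + integral {a..b} (\<lambda>\<tau>. g \<tau> (w \<tau>)) = integral {0..b} (\<lambda>\<tau>. g \<tau> (w \<tau>))"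
      using ab that by (intro Henstock_Kurzweil_Integration.integral_combine integrable_on_subinterval_open[OF gw]) auto
    then show ?thesis
      using energy_on_good_times[OF T w g N key ab(1,2) that(3)] normM that by (simp add: Q_def)
  qed
  have "\<exists>y\<in>M. lo < y \<and> y < hi" if "0 \<le> lo" "lo < hi" "hi \<le> T" for lo hi
  proof -
    have "AE y in lebesgue_on {lo<..<hi}. y \<in> M"
      by (rule AE_lebesgue_on_subset[OF Mae]) (use that in auto)
    from AE_interval_imp_ex[OF that(2) this] show ?thesis by auto
  qed
  note dense = this
  \<comment> \<open>The factor \<open>T / 2\<close> keeps \<open>a n\<close> below
    \<open>T / 2\<close> and, further on, \<open>b n\<close> above it, so that
    \<open>a n < b n\<close> holds for every \<open>n\<close>.\<close>
  have "\<exists>y\<in>M. 0 < y \<and> y < (T / 2) * inverse (real (Suc n))" for n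
    using T by (intro dense) (auto simp: field_simps)
  then obtain a where a: "\<And>n. a n \<in> M" "\<And>n. 0 < a n" "\<And>n. a n < (T / 2) * inverse (real (Suc n))" by metis
  have "\<exists>y\<in>M. T - (T / 2) * inverse (real (Suc n)) < y \<and> y < T" for n
    using T by (intro dense) (auto simp: field_simps)
  then obtain b where b: "\<And>n. b n \<in> M" "\<And>n. T - (T / 2) * inverse (real (Suc n)) < b n" "\<And>n. b n < T" by metis
  have le: "(T / 2) * inverse (real (Suc n)) \<le> T / 2" for n using T by (simp add: field_simps)
  have z: "(\<lambda>n. (T / 2) * inverse (real (Suc n))) \<longlonglongrightarrow> 0"
    using tendsto_mult_left[OF LIMSEQ_inverse_real_of_nat, of "T / 2"] by simp
  have alim: "a \<longlonglongrightarrow> 0"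
  proof (rule Lim_null_comparison[OF _ z])
    have "norm (a n) \<le> (T / 2) * inverse (real (Suc n))" for n using a(2)[of n] a(3)[of n] by simp
    then show "\<forall>\<^sub>F n in sequentially. norm (a n) \<le> (T / 2) * inverse (real (Suc n))" by simp
  qed
  have "(\<lambda>n. b n - T) \<longlonglongrightarrow> 0"
  proof (rule Lim_null_comparison[OF _ z])
    have "norm (b n - T) \<le> (T / 2) * inverse (real (Suc n))" for n using b(2)[of n] b(3)[of n] by simp
    then show "\<forall>\<^sub>F n in sequentially. norm (b n - T) \<le> (T / 2) * inverse (real (Suc n))" by simp
  qed
  then have blim: "b \<longlonglongrightarrow> T" by (rule LIM_zero_cancel)
  \<comment> \<open>The filter \<open>at t within {0..T}\<close> omits \<open>t\<close>, so the
    sequences must avoid 0 and \<open>T\<close> themselves.\<close>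
  have aI: "a n \<in> {0..T}" "b n \<in> {0..T}" and anz: "a n \<noteq> 0" "b n \<noteq> T" for n
    using a(1,2)[of n] b(1,3)[of n] N(1) by (auto simp: M_def)
  have Wlim: "(\<lambda>n. L2_norm \<mu> (W (c n))) \<longlonglongrightarrow> L2_norm \<mu> (W t)"
    if t: "t \<in> {0..T}" and c: "c \<longlonglongrightarrow> t" "\<And>n. c n \<in> {0..T}" "\<And>n. c n \<noteq> t" for c t
  proof (rule L2_norm_diff_tendsto[OF WL2[OF c(2)] WL2[OF t]])
    have "filterlim c (at t within {0..T}) sequentially"
      using c by (auto simp: filterlim_at)
    then show "(\<lambda>n. L2_norm \<mu> (W (c n) - W t)) \<longlonglongrightarrow> 0"
      by (rule filterlim_compose[OF Wc[OF t]])
  qed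
  have Qlim: "(\<lambda>n. Q (c n)) \<longlonglongrightarrow> Q t" if "t \<in> {0..T}" "c \<longlonglongrightarrow> t" "\<And>n. c n \<in> {0..T}" for c t
    by (rule continuous_on_tendsto_compose[OF contQ that(2,1)]) (use that(3) in \<open>auto intro!: always_eventually\<close>)
  have T0: "0 \<in> {0..T}" "T \<in> {0..T}" using T by auto
  have lim1: "(\<lambda>n. (L2_norm \<mu> (W (b n)))\<^sup>2 - (L2_norm \<mu> (W (a n)))\<^sup>2) \<longlonglongrightarrow> (L2_norm \<mu> (W T))\<^sup>2 - (L2_norm \<mu> (W 0))\<^sup>2"
    by (intro tendsto_diff tendsto_power Wlim T0 alim blim aI anz)
  have lim2: "(\<lambda>n. 2 * (Q (b n) - Q (a n))) \<longlonglongrightarrow> 2 * (Q T - Q 0)"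
    by (intro tendsto_intros Qlim T0 alim blim aI)
  have "a n < b n" for n using a(3)[of n] b(2)[of n] le[of n] by linarith
  from lim1 have "(\<lambda>n. 2 * (Q (b n) - Q (a n))) \<longlonglongrightarrow> (L2_norm \<mu> (W T))\<^sup>2 - (L2_norm \<mu> (W 0))\<^sup>2"
    unfolding eq[OF a(1) b(1) \<open>\<And>n. a n < b n\<close>] .
  from LIMSEQ_unique[OF this lim2] have "(L2_norm \<mu> (W T))\<^sup>2 - (L2_norm \<mu> (W 0))\<^sup>2 = 2 * (Q T - Q 0)" .
  then show ?thesis using LINT_open_interval[OF gw] by (simp add: Q_def)
qed

end

section \<open>Least flux error and the error identity\<close>

lemma deriv_test_function:
  fixes \<phi> :: "real \<Rightarrow> real"
  assumes "\<phi> \<in> test_functions U"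
  shows "deriv \<phi> \<in> test_functions U"
proof -
  have "deriv \<phi> x = frechet_derivative \<phi> (at x) 1" for x
  proof -
    have "Ck (Suc 0) \<phi>" using assms unfolding test_functions_def by blast
    then have "\<phi> differentiable (at x)" by simp
    then obtain D where D: "(\<phi> has_real_derivative D) (at x)" using real_differentiable_def by blast
    then show ?thesis
      using frechet_derivative_at[OF D[unfolded has_field_derivative_def]] DERIV_imp_deriv[OF D] by (metis mult.right_neutral)
  qed
  then have "deriv \<phi> = (\<lambda>x. frechet_derivative \<phi> (at x) 1)" by blast
  then show ?thesis using frechet_derivative_test_function[OF assms, of 1] by simp
qed

lemma bochner_norm_power2: "(bochner_norm I nrm w)\<^sup>2 = (LINT t|lebesgue_on I. (nrm (w t))\<^sup>2)"
  by (simp add: bochner_norm_def)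

lemma bochner_L2_AE_in: "w \<in> bochner_L2 I X nrm \<Longrightarrow> AE t in lebesgue_on I. w t \<in> X"
  and bochner_L2_integrable: "w \<in> bochner_L2 I X nrm \<Longrightarrow> integrable (lebesgue_on I) (\<lambda>t. (nrm (w t))\<^sup>2)"
  by (auto simp: bochner_L2_def)

context evolution_triple
begin

lemma H_embed_eq: "H_embed \<Omega> y z = L2_inner \<mu> y z"
  by (simp add: H_embed_def L2_inner_def)

lemma V'_pairing_integrable:
  assumes g: "g \<in> L2_Vdual \<Omega> \<Gamma>D T" and w: "w \<in> L2_V \<Omega> \<Gamma>D T"
  shows "integrable (lebesgue_on {0<..<T}) (\<lambda>t. g t (w t))"
proof -
  obtain r g' where g': "Vdu.approx {0<..<T} r g'" "AE t in lebesgue_on {0<..<T}. g' t = g t"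
    using Vdu.bochner_L2_approx[OF g] by blast
  obtain s w' where w': "Vsp.approx {0<..<T} s w'" "AE t in lebesgue_on {0<..<T}. w' t = w t"
    using Vsp.bochner_L2_approx[OF w] by blast
  have ae: "AE t in lebesgue_on {0<..<T}. g' t (w' t) = g t (w t)"
    using g'(2) w'(2) by eventually_elim simp
  show ?thesis by (rule integrable_lebesgue_on_cong_AE[OF _ pairing_integrable[OF g'(1) w'(1)] ae]) auto
qed

lemma V'_pairing_const_integrable:
  "g \<in> L2_Vdual \<Omega> \<Gamma>D T \<Longrightarrow> z \<in> V \<Longrightarrow> integrable (lebesgue_on {0<..<T}) (\<lambda>t. g t z)"
  by (rule V'_pairing_integrable[OF _ Vsp.bochner_L2_const]) auto

text \<open>Functionals matter on \<open>V\<close> only. \<open>H_embed\<close> of a difference is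
  known to be the difference of the embeddings on \<open>V\<close>, not as a function on all
  arguments; this lemma bridges the gap.\<close>

lemma L2_Vdual_cong:
  assumes \<xi>: "\<xi> \<in> L2_Vdual \<Omega> \<Gamma>D T" and ae: "AE t in lebesgue_on {0<..<T}. \<forall>z\<in>V. \<xi> t z = \<eta> t z"
  shows "\<eta> \<in> L2_Vdual \<Omega> \<Gamma>D T"
proof -
  let ?m = "lebesgue_on {0<..<T}"
  obtain s where s: "\<And>n. simple_function ?m (s n)" "\<And>n. s n ` {0<..<T} \<subseteq> V'"
    "AE t in ?m. (\<lambda>n. normV' (s n t - \<xi> t)) \<longlonglongrightarrow> 0"
    using \<xi> unfolding bochner_L2_def by blast
  have "AE t in ?m. \<eta> t \<in> V'"
    using bochner_L2_AE_in[OF \<xi>] ae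
  proof eventually_elim
    case (elim t)
    show ?case by (rule V'_cong[OF elim(1)]) (use elim(2) in blast)
  qed
  moreover have "AE t in ?m. (\<lambda>n. normV' (s n t - \<eta> t)) \<longlonglongrightarrow> 0"
    using s(3) ae
  proof eventually_elim
    case (elim t)
    have "normV' (s n t - \<eta> t) = normV' (s n t - \<xi> t)" for n
      using elim by (intro normV'_cong) simp
    then show ?case using elim by simp
  qed
  moreover have "integrable ?m (\<lambda>t. (normV' (\<eta> t))\<^sup>2)"
  proof (rule integrable_lebesgue_on_cong_AE[OF _ bochner_L2_integrable[OF \<xi>]])
    show "AE t in ?m. (normV' (\<xi> t))\<^sup>2 = (normV' (\<eta> t))\<^sup>2"
      using ae
    proof eventually_elim
      case (elim t)
      then have "normV' (\<xi> t) = normV' (\<eta> t)" by (intro normV'_cong) simp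
      then show ?case by simp
    qed
  qed auto
  ultimately show ?thesis
    unfolding bochner_L2_def using s(1,2) by blast
qed

text \<open>Replaces \<open>w\<close>, \<open>g\<close> and the embedded \<open>w\<close> by
  representatives without exceptional times. The times are then restricted to those where the third
  one is \<open>H_embed\<close> of the first, which turns functionals into inner products.\<close>

lemma good_times_exist:
  assumes T: "0 < T" and w: "w \<in> L2_V \<Omega> \<Gamma>D T" and d: "has_time_deriv \<Omega> \<Gamma>D T w g"
  shows "\<exists>s w' r g' N. Vsp.approx {0<..<T} s w' \<and> Vdu.approx {0<..<T} r g' \<and>
    (AE t in lebesgue_on {0<..<T}. w' t = w t) \<and> (AE t in lebesgue_on {0<..<T}. g' t = g t) \<and>
    N \<subseteq> {0<..<T} \<and> (AE t in lebesgue_on {0<..<T}. t \<in> N) \<and>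
    (\<forall>a\<in>N. \<forall>b\<in>N. \<forall>c\<in>N. a \<le> b \<longrightarrow>
      L2_inner \<mu> (w' b) (w' c) - L2_inner \<mu> (w' a) (w' c) = integral {a..b} (\<lambda>\<tau>. g' \<tau> (w' c)))"
proof -
  let ?I = "{0<..<T}"
  let ?m = "lebesgue_on ?I"
  have H: "(\<lambda>t. H_embed \<Omega> (w t)) \<in> L2_Vdual \<Omega> \<Gamma>D T" and gL: "g \<in> L2_Vdual \<Omega> \<Gamma>D T"
    and weak: "\<And>\<phi> z. \<phi> \<in> test_functions ?I \<Longrightarrow> z \<in> V \<Longrightarrow>
      (LINT t|?m. H_embed \<Omega> (w t) z * deriv \<phi> t) = - (LINT t|?m. g t z * \<phi> t)"
    using d unfolding has_time_deriv_def by auto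
  obtain s w' where w': "Vsp.approx ?I s w'" "AE t in ?m. w' t = w t"
    using Vsp.bochner_L2_approx[OF w] by blast
  obtain r g' where g': "Vdu.approx ?I r g'" "AE t in ?m. g' t = g t"
    using Vdu.bochner_L2_approx[OF gL] by blast
  obtain q h where h: "Vdu.approx ?I q h" "AE t in ?m. h t = H_embed \<Omega> (w t)"
    using Vdu.bochner_L2_approx[OF H] by blast
  have "(LINT t|?m. h t z * deriv \<phi> t) = - (LINT t|?m. g' t z * \<phi> t)"
    if \<phi>: "\<phi> \<in> test_functions ?I" and z: "z \<in> V" for \<phi> z
  proof -
    have "(LINT t|?m. h t z * deriv \<phi> t) = (LINT t|?m. H_embed \<Omega> (w t) z * deriv \<phi> t)"
    proof (rule LINT_lebesgue_on_cong_AE)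
      show "(\<lambda>t. h t z * deriv \<phi> t) \<in> borel_measurable ?m"
        by (intro borel_measurable_integrable integrable_mult_test_function[OF pairing_const_integrable[OF h(1) z] deriv_test_function[OF \<phi>]])
      show "AE t in ?m. h t z * deriv \<phi> t = H_embed \<Omega> (w t) z * deriv \<phi> t"
        using h(2) by eventually_elim simp
    qed auto
    moreover have "(LINT t|?m. g' t z * \<phi> t) = (LINT t|?m. g t z * \<phi> t)"
    proof (rule LINT_lebesgue_on_cong_AE)
      show "(\<lambda>t. g' t z * \<phi> t) \<in> borel_measurable ?m"
        by (intro borel_measurable_integrable integrable_mult_test_function[OF pairing_const_integrable[OF g'(1) z] \<phi>])
      show "AE t in ?m. g' t z * \<phi> t = g t z * \<phi> t"
        using g'(2) by eventually_elim simp
    qed auto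
    ultimately show ?thesis using weak[OF \<phi> z] by simp
  qed
  from integrated_time_derivative[OF T w'(1) g'(1) h(1) this] obtain N' where N': "N' \<subseteq> ?I" "AE t in ?m. t \<in> N'"
    "\<And>a b c. a \<in> N' \<Longrightarrow> b \<in> N' \<Longrightarrow> c \<in> N' \<Longrightarrow> a \<le> b \<Longrightarrow> h b (w' c) - h a (w' c) = integral {a..b} (\<lambda>\<tau>. g' \<tau> (w' c))"
    by blast
  define N where "N = {t \<in> N'. w' t = w t \<and> h t = H_embed \<Omega> (w t)}"
  have "AE t in ?m. t \<in> N" using N'(2) w'(2) h(2) by eventually_elim (simp add: N_def)
  moreover have "L2_inner \<mu> (w' b) (w' c) - L2_inner \<mu> (w' a) (w' c) = integral {a..b} (\<lambda>\<tau>. g' \<tau> (w' c))"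
    if "a \<in> N" "b \<in> N" "c \<in> N" "a \<le> b" for a b c
    using N'(3)[of a b c] that by (simp add: N_def H_embed_eq)
  moreover have "N \<subseteq> ?I" using N'(1) by (auto simp: N_def)
  ultimately show ?thesis using w' g' by blast
qed

section \<open>Continuous representatives and time derivatives: existence, differences,
  uniqueness\<close>

lemma continuous_rep_cong:
  assumes "continuous_rep \<Omega> T w W" "AE t in lebesgue_on {0<..<T}. w t = w' t"
  shows "continuous_rep \<Omega> T w' W"
proof -
  have "AE t in lebesgue_on {0<..<T}. AE x in \<mu>. W t x = w t x"
    using assms(1) by (simp add: continuous_rep_def)
  then have "AE t in lebesgue_on {0<..<T}. AE x in \<mu>. W t x = w' t x"
    using assms(2) by eventually_elim simp
  then show ?thesis using assms(1) by (simp add: continuous_rep_def)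
qed

text \<open>The \<open>SOME\<close> in \<open>value_at\<close> denotes a continuous representative
  only because one exists.\<close>

lemma continuous_rep_value_at:
  assumes T: "0 < T" and w: "w \<in> L2_V \<Omega> \<Gamma>D T" and d: "has_time_deriv \<Omega> \<Gamma>D T w g"
  shows "continuous_rep \<Omega> T w (value_at \<Omega> T w)"
proof -
  obtain s w' r g' N where *: "Vsp.approx {0<..<T} s w'" "Vdu.approx {0<..<T} r g'"
    "AE t in lebesgue_on {0<..<T}. w' t = w t" "N \<subseteq> {0<..<T}" "AE t in lebesgue_on {0<..<T}. t \<in> N"
    "\<And>a b c. a \<in> N \<Longrightarrow> b \<in> N \<Longrightarrow> c \<in> N \<Longrightarrow> a \<le> b \<Longrightarrow>
      L2_inner \<mu> (w' b) (w' c) - L2_inner \<mu> (w' a) (w' c) = integral {a..b} (\<lambda>\<tau>. g' \<tau> (w' c))"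
    using good_times_exist[OF assms] by blast
  have "\<exists>W. continuous_rep \<Omega> T w W"
    using continuous_rep_exists[OF T *(1,2,4,5,6)] continuous_rep_cong *(3) by blast
  then show ?thesis unfolding value_at_def by (rule someI_ex)
qed

lemma energy_identity:
  assumes T: "0 < T" and w: "w \<in> L2_V \<Omega> \<Gamma>D T" and d: "has_time_deriv \<Omega> \<Gamma>D T w g"
    and W: "continuous_rep \<Omega> T w W"
  shows "(L2_norm \<mu> (W T))\<^sup>2 - (L2_norm \<mu> (W 0))\<^sup>2 = 2 * (LINT t|lebesgue_on {0<..<T}. g t (w t))"
proof -
  let ?m = "lebesgue_on {0<..<T}"
  obtain s w' r g' N where *: "Vsp.approx {0<..<T} s w'" "Vdu.approx {0<..<T} r g'"
    "N \<subseteq> {0<..<T}" "AE t in ?m. t \<in> N"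
    "\<And>a b c. a \<in> N \<Longrightarrow> b \<in> N \<Longrightarrow> c \<in> N \<Longrightarrow> a \<le> b \<Longrightarrow>
      L2_inner \<mu> (w' b) (w' c) - L2_inner \<mu> (w' a) (w' c) = integral {a..b} (\<lambda>\<tau>. g' \<tau> (w' c))"
    and ae: "AE t in ?m. w' t = w t" "AE t in ?m. g' t = g t"
    using good_times_exist[OF T w d] by blast
  have ae': "AE t in ?m. w t = w' t" using ae(1) by eventually_elim simp
  have "AE t in ?m. g' t (w' t) = g t (w t)" using ae by eventually_elim simp
  then have "(LINT t|?m. g' t (w' t)) = (LINT t|?m. g t (w t))"
    by (intro LINT_lebesgue_on_cong_AE pairing_measurable[OF *(2,1)]) auto
  then show ?thesis
    using energy_identity_end_points[OF T *(1,2,3,4,5) continuous_rep_cong[OF W ae']] by simp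
qed

lemma continuous_rep_diff:
  assumes v: "continuous_rep \<Omega> T v X" and u: "continuous_rep \<Omega> T u Y"
  shows "continuous_rep \<Omega> T (v - u) (\<lambda>t. X t - Y t)"
  unfolding continuous_rep_def
proof (intro conjI ballI)
  have X: "X t \<in> L2_space \<mu>" "((\<lambda>s. L2_norm \<mu> (X s - X t)) \<longlongrightarrow> 0) (at t within {0..T})"
    and Y: "Y t \<in> L2_space \<mu>" "((\<lambda>s. L2_norm \<mu> (Y s - Y t)) \<longlongrightarrow> 0) (at t within {0..T})"
    if "t \<in> {0..T}" for t using v u that by (auto simp: continuous_rep_def)
  fix t assume t: "t \<in> {0..T}"
  show "X t - Y t \<in> L2_space \<mu>" using X Y t by (intro L2_space_diff)
  show "((\<lambda>s. L2_norm \<mu> (X s - Y s - (X t - Y t))) \<longlongrightarrow> 0) (at t within {0..T})"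
  proof (rule Lim_null_comparison)
    have le: "norm (L2_norm \<mu> (X s - Y s - (X t - Y t))) \<le> L2_norm \<mu> (X s - X t) + L2_norm \<mu> (Y s - Y t)"
      if s: "s \<in> {0..T}" for s
    proof -
      have "X s - Y s - (X t - Y t) = (X s - X t) - (Y s - Y t)" by (simp add: fun_eq_iff)
      then show ?thesis
        using L2_norm_triangle_diff[OF L2_space_diff[OF X(1)[OF s] X(1)[OF t]] L2_space_diff[OF Y(1)[OF s] Y(1)[OF t]]]
        by (simp only: real_norm_def abs_of_nonneg[OF L2_norm_nonneg])
    qed
    show "\<forall>\<^sub>F s in at t within {0..T}. norm (L2_norm \<mu> (X s - Y s - (X t - Y t)))
        \<le> L2_norm \<mu> (X s - X t) + L2_norm \<mu> (Y s - Y t)"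
      unfolding eventually_at_filter by (intro always_eventually) (use le in blast)
    show "((\<lambda>s. L2_norm \<mu> (X s - X t) + L2_norm \<mu> (Y s - Y t)) \<longlongrightarrow> 0) (at t within {0..T})"
      using tendsto_add[OF X(2)[OF t] Y(2)[OF t]] by simp
  qed
next
  have "AE t in lebesgue_on {0<..<T}. AE x in \<mu>. X t x = v t x"
    "AE t in lebesgue_on {0<..<T}. AE x in \<mu>. Y t x = u t x"
    using v u by (auto simp: continuous_rep_def)
  then show "AE t in lebesgue_on {0<..<T}. AE x in \<mu>. (X t - Y t) x = (v - u) t x"
  proof eventually_elim
    case (elim t)
    then show ?case by eventually_elim simp
  qed
qed

text \<open>The representatives agree at almost every time, hence at times arbitrarily close to
  \<open>t\<close>, and continuity carries this to \<open>t\<close> itself. It is needed at the end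
  point 0, about which agreement inside the interval says nothing directly.\<close>

lemma continuous_rep_unique:
  assumes T: "0 < T" and X: "continuous_rep \<Omega> T w X" and Y: "continuous_rep \<Omega> T w Y" and t: "t \<in> {0..T}"
  shows "L2_norm \<mu> (X t - Y t) = 0"
proof (rule ccontr)
  assume n: "L2_norm \<mu> (X t - Y t) \<noteq> 0"
  define e where "e = L2_norm \<mu> (X t - Y t)"
  have e: "0 < e" using n L2_norm_nonneg[of \<mu> "X t - Y t"] unfolding e_def by linarith
  have XY: "X s \<in> L2_space \<mu>" "Y s \<in> L2_space \<mu>" if "s \<in> {0..T}" for s
    using X Y that by (auto simp: continuous_rep_def)
  have "((\<lambda>s. L2_norm \<mu> (X s - X t)) \<longlongrightarrow> 0) (at t within {0..T})" "((\<lambda>s. L2_norm \<mu> (Y s - Y t)) \<longlongrightarrow> 0) (at t within {0..T})"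
    using X Y t by (auto simp: continuous_rep_def)
  then have "\<forall>\<^sub>F s in at t within {0..T}. L2_norm \<mu> (X s - X t) < e / 2 \<and> L2_norm \<mu> (Y s - Y t) < e / 2"
    using e by (intro eventually_conj order_tendstoD(2)) auto
  then obtain d where d: "0 < d" "\<And>s. s \<in> {0..T} \<Longrightarrow> s \<noteq> t \<Longrightarrow> dist s t < d \<Longrightarrow>
      L2_norm \<mu> (X s - X t) < e / 2 \<and> L2_norm \<mu> (Y s - Y t) < e / 2"
    unfolding eventually_at by blast
  define lo hi where "lo = max 0 (t - d)" and "hi = min T (t + d)"
  have lh: "lo < hi" using t T d by (auto simp: lo_def hi_def)
  have "AE s in lebesgue_on {0<..<T}. AE x in \<mu>. X s x = w s x" "AE s in lebesgue_on {0<..<T}. AE x in \<mu>. Y s x = w s x"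
    using X Y by (auto simp: continuous_rep_def)
  then have "AE s in lebesgue_on {0<..<T}. AE x in \<mu>. X s x = Y s x"
  proof eventually_elim
    case (elim s)
    then show ?case by eventually_elim simp
  qed
  then have ae: "AE s in lebesgue_on {lo<..<hi}. AE x in \<mu>. X s x = Y s x"
    by (rule AE_lebesgue_on_subset) (auto simp: lo_def hi_def)
  have "AE s in lebesgue. s \<noteq> t" using AE_not_in[of "{t}" lebesgue] by simp
  then have "AE s in lebesgue_on {lo<..<hi}. s \<noteq> t"
    by (auto simp: AE_restrict_space_iff elim!: eventually_mono)
  with ae have "AE s in lebesgue_on {lo<..<hi}. s \<noteq> t \<and> (AE x in \<mu>. X s x = Y s x)" by eventually_elim simp
  from AE_interval_imp_ex[OF lh this] obtain s where s: "s \<in> {lo<..<hi}" "s \<noteq> t" "AE x in \<mu>. X s x = Y s x" by blast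
  have sT: "s \<in> {0..T}" and sd: "dist s t < d" using s(1) by (auto simp: lo_def hi_def dist_real_def)
  have "L2_norm \<mu> (X t - Y t) \<le> L2_norm \<mu> (X t - X s) + L2_norm \<mu> (X s - Y t)"
    by (intro L2_norm_triangle3 XY t sT)
  also have "L2_norm \<mu> (X s - Y t) = L2_norm \<mu> (Y s - Y t)"
    using s(3) by (intro L2_norm_cong_AE L2_space_measurable L2_space_diff XY t sT) (auto elim!: eventually_mono)
  also have "L2_norm \<mu> (X t - X s) = L2_norm \<mu> (X s - X t)" by (rule L2_norm_minus_commute)
  finally show False using d(2)[OF sT s(2) sd] unfolding e_def by linarith
qed

lemma has_time_deriv_diff:
  assumes v: "v \<in> L2_V \<Omega> \<Gamma>D T" "has_time_deriv \<Omega> \<Gamma>D T v g" and u: "u \<in> L2_V \<Omega> \<Gamma>D T" "has_time_deriv \<Omega> \<Gamma>D T u k"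
  shows "has_time_deriv \<Omega> \<Gamma>D T (v - u) (\<lambda>t. g t - k t)"
  unfolding has_time_deriv_def
proof (intro conjI ballI)
  let ?I = "{0<..<T}"
  let ?m = "lebesgue_on ?I"
  have I: "?I \<in> sets lebesgue" by auto
  have H: "(\<lambda>t. H_embed \<Omega> (v t)) \<in> L2_Vdual \<Omega> \<Gamma>D T" "(\<lambda>t. H_embed \<Omega> (u t)) \<in> L2_Vdual \<Omega> \<Gamma>D T"
    and gk: "g \<in> L2_Vdual \<Omega> \<Gamma>D T" "k \<in> L2_Vdual \<Omega> \<Gamma>D T"
    using v u by (auto simp: has_time_deriv_def)
  have Hd: "(\<lambda>t. H_embed \<Omega> (v t) - H_embed \<Omega> (u t)) \<in> L2_Vdual \<Omega> \<Gamma>D T"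
    by (rule Vdu.bochner_L2_diff[OF I H])
  have ae: "AE t in ?m. \<forall>z\<in>V. (H_embed \<Omega> (v t) - H_embed \<Omega> (u t)) z = H_embed \<Omega> ((v - u) t) z"
    using bochner_L2_AE_in[OF v(1)] bochner_L2_AE_in[OF u(1)]
  proof eventually_elim
    case (elim t)
    then show ?case by (simp add: H_embed_eq L2_inner_diff V_L2)
  qed
  show "(\<lambda>t. H_embed \<Omega> ((v - u) t)) \<in> L2_Vdual \<Omega> \<Gamma>D T" by (rule L2_Vdual_cong[OF Hd ae])
  show "(\<lambda>t. g t - k t) \<in> L2_Vdual \<Omega> \<Gamma>D T" by (rule Vdu.bochner_L2_diff[OF I gk])
  fix \<phi> z assume \<phi>: "\<phi> \<in> test_functions ?I" and z: "z \<in> V"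
  note i1 = V'_pairing_const_integrable[OF _ z, THEN integrable_mult_test_function, OF _ deriv_test_function[OF \<phi>]]
  note i2 = V'_pairing_const_integrable[OF _ z, THEN integrable_mult_test_function, OF _ \<phi>]
  have "(LINT t|?m. H_embed \<Omega> ((v - u) t) z * deriv \<phi> t)
      = (LINT t|?m. (H_embed \<Omega> (v t) - H_embed \<Omega> (u t)) z * deriv \<phi> t)"
  proof (rule LINT_lebesgue_on_cong_AE[symmetric])
    show "(\<lambda>t. (H_embed \<Omega> (v t) - H_embed \<Omega> (u t)) z * deriv \<phi> t) \<in> borel_measurable ?m"
      by (rule borel_measurable_integrable[OF i1[OF Hd]])
    show "AE t in ?m. (H_embed \<Omega> (v t) - H_embed \<Omega> (u t)) z * deriv \<phi> t = H_embed \<Omega> ((v - u) t) z * deriv \<phi> t"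
      using ae
    proof eventually_elim
      case (elim t)
      then show ?case using z by simp
    qed
  qed auto
  also have "\<dots> = (LINT t|?m. H_embed \<Omega> (v t) z * deriv \<phi> t) - (LINT t|?m. H_embed \<Omega> (u t) z * deriv \<phi> t)"
    using i1[OF H(1)] i1[OF H(2)] by (simp add: left_diff_distrib)
  also have "\<dots> = - (LINT t|?m. g t z * \<phi> t) - - (LINT t|?m. k t z * \<phi> t)"
    using v(2) u(2) \<phi> z unfolding has_time_deriv_def by simp
  also have "\<dots> = - (LINT t|?m. (g t - k t) z * \<phi> t)"
    using i2[OF gk(1)] i2[OF gk(2)] by (simp add: left_diff_distrib)
  finally show "(LINT t|?m. H_embed \<Omega> ((v - u) t) z * deriv \<phi> t) = - (LINT t|?m. (g t - k t) z * \<phi> t)" .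
qed

text \<open>The values of the approximants of a strongly measurable functional form a countable set, so that
  countably many \<open>z\<close> compute the dual norms of these values up to \<open>1 / (k + 1)\<close>.\<close>

lemma has_time_deriv_unique:
  assumes g: "has_time_deriv \<Omega> \<Gamma>D T w g" and k: "has_time_deriv \<Omega> \<Gamma>D T w k"
  shows "AE t in lebesgue_on {0<..<T}. \<forall>z\<in>V. g t z = k t z"
proof -
  let ?I = "{0<..<T}"
  let ?m = "lebesgue_on ?I"
  have gk: "g \<in> L2_Vdual \<Omega> \<Gamma>D T" "k \<in> L2_Vdual \<Omega> \<Gamma>D T"
    using g k by (auto simp: has_time_deriv_def)
  have DL: "(\<lambda>t. g t - k t) \<in> L2_Vdual \<Omega> \<Gamma>D T" by (rule Vdu.bochner_L2_diff[OF _ gk]) auto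
  have D0: "AE t in ?m. (g t - k t) z = 0" if z: "z \<in> V" for z
  proof (rule AE_eq_0_if_test_integrals_0)
    show "integrable (lebesgue_on (cbox a b)) (\<lambda>t. (g t - k t) z)" if "cbox a b \<subseteq> ?I" for a b
      by (rule integrable_lebesgue_on_subset[OF V'_pairing_const_integrable[OF DL z] that]) auto
    fix \<phi> assume \<phi>: "\<phi> \<in> test_functions ?I"
    note i = V'_pairing_const_integrable[OF _ z, THEN integrable_mult_test_function, OF _ \<phi>]
    have "(LINT t|?m. (g t - k t) z * \<phi> t) = (LINT t|?m. g t z * \<phi> t) - (LINT t|?m. k t z * \<phi> t)"
      using i[OF gk(1)] i[OF gk(2)] by (simp add: left_diff_distrib)
    also have "\<dots> = 0"
    proof -
      have "(LINT t|?m. H_embed \<Omega> (w t) z * deriv \<phi> t) = - (LINT t|?m. g t z * \<phi> t)"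
        "(LINT t|?m. H_embed \<Omega> (w t) z * deriv \<phi> t) = - (LINT t|?m. k t z * \<phi> t)"
        using g k \<phi> z unfolding has_time_deriv_def by blast+
      then show ?thesis by linarith
    qed
    finally show "(LINT t|?m. (g t - k t) z * \<phi> t) = 0" .
  qed simp
  obtain s D where D: "Vdu.approx ?I s D" "AE t in ?m. D t = g t - k t"
    using Vdu.bochner_L2_approx[OF DL] by blast
  note DX = Vdu.approx_in[OF D(1)]
  have "\<exists>z\<in>V. normV z \<le> 1 \<and> normV' \<xi> - inverse (real (Suc n)) < \<bar>\<xi> z\<bar>" if \<xi>: "\<xi> \<in> V'" for \<xi> n
  proof (rule ccontr)
    assume "\<not> ?thesis"
    then have "normV' \<xi> \<le> normV' \<xi> - inverse (real (Suc n))"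
      unfolding V_dual_norm_def[of _ _ \<xi>] using V_zero normV_zero by (intro cSUP_least) (auto simp: not_less)
    then show False by simp
  qed
  then obtain z where z: "\<And>\<xi> n. \<xi> \<in> V' \<Longrightarrow> z \<xi> n \<in> V" "\<And>\<xi> n. \<xi> \<in> V' \<Longrightarrow> normV (z \<xi> n) \<le> 1"
    "\<And>\<xi> n. \<xi> \<in> V' \<Longrightarrow> normV' \<xi> - inverse (real (Suc n)) < \<bar>\<xi> (z \<xi> n)\<bar>" by metis
  define Z where "Z = (\<Union>m n. (\<lambda>t. z (s m t) n) ` ?I)"
  have fin: "finite ((\<lambda>t. z (s m t) n) ` ?I)" for m n
  proof -
    have "finite (s m ` ?I)" using simple_functionD(1)[OF Vdu.approx_simple[OF D(1), of m]] by simp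
    then have "finite ((\<lambda>\<xi>. z \<xi> n) ` s m ` ?I)" by (rule finite_imageI)
    then show ?thesis by (simp add: image_image)
  qed
  have "countable (\<Union>n. (\<lambda>t. z (s m t) n) ` ?I)" for m
    by (rule countable_UN[OF _ countable_finite[OF fin]]) simp
  then have "countable Z" unfolding Z_def by (rule countable_UN[rotated]) simp
  moreover have "Z \<subseteq> V" unfolding Z_def using z(1) DX(1) by auto
  ultimately have Z: "countable Z" "Z \<subseteq> V" .
  have "AE t in ?m. \<forall>y\<in>Z. (g t - k t) y = 0"
    using D0 Z by (subst AE_ball_countable) auto
  then show ?thesis
    using D(2) AE_space
  proof eventually_elim
    case (elim t)
    then have t: "t \<in> ?I" and D0t: "\<And>y. y \<in> Z \<Longrightarrow> D t y = 0" by auto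
    have le: "normV' (s n t) \<le> normV' (s n t - D t) + inverse (real (Suc n))" for n
    proof -
      let ?z = "z (s n t) n"
      have zZ: "?z \<in> Z" "?z \<in> V" using t z(1)[OF DX(1)] unfolding Z_def by blast+
      have "normV' (s n t) - inverse (real (Suc n)) < \<bar>s n t ?z\<bar>" by (rule z(3)[OF DX(1)])
      also have "s n t ?z = (s n t - D t) ?z" using D0t[OF zZ(1)] by simp
      also have "\<bar>(s n t - D t) ?z\<bar> \<le> normV' (s n t - D t)"
        by (rule V'_unit_le[OF V'_minus[OF DX] zZ(2) z(2)[OF DX(1)]])
      finally show ?thesis by simp
    qed
    have "normV' (D t) \<le> 0"
    proof (rule LIMSEQ_le)
      show "(\<lambda>n. normV' (s n t)) \<longlonglongrightarrow> normV' (D t)" by (rule Vdu.approx_nrm_tendsto[OF D(1) t])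
      show "(\<lambda>n. normV' (s n t - D t) + inverse (real (Suc n))) \<longlonglongrightarrow> 0"
        using tendsto_add[OF Vdu.approx_tendsto[OF D(1) t] LIMSEQ_inverse_real_of_nat] by simp
    qed (use le in blast)
    then have "\<bar>D t y\<bar> \<le> 0" if "y \<in> V" for y
      using V'_le[OF DX(2)[of t] that] mult_right_mono[of "normV' (D t)" 0 "normV y"] normV_nonneg[of y] by simp
    then show ?case using elim by auto
  qed
qed

section \<open>The Laplacian and the Riesz map on Bochner spaces; the least flux error\<close>

lemma neg_laplace_diff: "x \<in> V \<Longrightarrow> y \<in> V \<Longrightarrow> z \<in> V \<Longrightarrow>
    neg_laplace \<Omega> (x - y) z = neg_laplace \<Omega> x z - neg_laplace \<Omega> y z"
proof -
  assume xyz: "x \<in> V" "y \<in> V" "z \<in> V"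
  have "L2_inner \<mu> (grad (x - y)) (grad z) = L2_inner \<mu> (grad x - grad y) (grad z)"
    using grad_diff_AE[OF xyz(1,2)] xyz by (intro L2_inner_cong_AE L2_space_measurable L2_space_diff grad_L2 V_diff) auto
  then show ?thesis using xyz by (simp add: neg_laplace_def grad_adj_eq L2_inner_diff grad_L2)
qed

lemma normV'_neg_laplace: "z \<in> V \<Longrightarrow> normV' (neg_laplace \<Omega> z) = normV z"
  unfolding neg_laplace_def V_norm_def by (intro normV'_grad_adj grad_closed_grads)

lemma neg_laplace_L2_Vdual:
  assumes "v \<in> L2_V \<Omega> \<Gamma>D T"
  shows "(\<lambda>t. neg_laplace \<Omega> (v t)) \<in> L2_Vdual \<Omega> \<Gamma>D T"
proof (rule bochner_L2_isometry[OF _ assms])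
  fix x y assume xy: "x \<in> V" "y \<in> V"
  have "normV' (neg_laplace \<Omega> x - neg_laplace \<Omega> y) = normV' (neg_laplace \<Omega> (x - y))"
    using xy by (intro normV'_cong) (simp add: neg_laplace_diff)
  then show "normV' (neg_laplace \<Omega> x - neg_laplace \<Omega> y) = normV (x - y)"
    using normV'_neg_laplace V_diff xy by simp
qed (auto intro: neg_laplace_V' normV'_neg_laplace)

lemma grad_L2_Y:
  assumes "v \<in> L2_V \<Omega> \<Gamma>D T"
  shows "(\<lambda>t. grad (v t)) \<in> L2_Y \<Omega> T"
  by (rule bochner_L2_isometry[OF _ assms]) (auto intro: grad_L2 simp: normV_diff V_norm_def[symmetric])

lemma riesz_L2_Y:
  assumes "\<xi> \<in> L2_Vdual \<Omega> \<Gamma>D T"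
  shows "(\<lambda>t. riesz (\<xi> t)) \<in> L2_Y \<Omega> T"
  by (rule bochner_L2_isometry[OF _ assms]) (auto intro: riesz L2_norm_riesz L2_norm_riesz_diff)

text \<open>For admissible \<open>y\<close> the residual is \<open>grad_adj\<close> of
  \<open>grad (v t) - y t\<close>, whose dual norm is at most the \<open>L^2\<close> norm. In
  \<open>ereal\<close> an infimum over the empty set is infinite, so the equality also says that an
  admissible \<open>y\<close> exists.\<close>

lemma least_flux_error:
  assumes v: "v \<in> L2_V \<Omega> \<Gamma>D T" and F: "F \<in> L2_Vdual \<Omega> \<Gamma>D T"
  shows "(INF y \<in> {y \<in> L2_Y \<Omega> T. AE t in lebesgue_on {0<..<T}. \<forall>z\<in>V. grad_adj \<Omega> (y t) z = F t z}.
      ereal (1/2 * (Q_norm \<Omega> T (\<lambda>t. y t - grad (v t)))\<^sup>2))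
    = ereal (1/2 * (L2_Vdual_norm \<Omega> \<Gamma>D T (\<lambda>t. neg_laplace \<Omega> (v t) - F t))\<^sup>2)"
    (is "(INF y \<in> ?S. ?val y) = ereal ?R")
proof (rule antisym)
  let ?I = "{0<..<T}"
  let ?m = "lebesgue_on ?I"
  interpret Y: seminormed_set "L2_space \<mu>" "L2_norm \<mu>" by (rule seminormed_set_L2)
  have I: "?I \<in> sets lebesgue" by auto
  define R where "R t = neg_laplace \<Omega> (v t) - F t" for t
  have RL: "R \<in> L2_Vdual \<Omega> \<Gamma>D T"
    unfolding R_def by (rule Vdu.bochner_L2_diff[OF I neg_laplace_L2_Vdual[OF v] F])
  have vV: "AE t in ?m. v t \<in> V" and RV: "AE t in ?m. R t \<in> V'"
    using bochner_L2_AE_in v RL by auto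
  show "ereal ?R \<le> (INF y \<in> ?S. ?val y)"
  proof (rule INF_greatest)
    fix y assume y: "y \<in> ?S"
    then have yL: "y \<in> L2_Y \<Omega> T" by simp
    have dL: "(\<lambda>t. y t - grad (v t)) \<in> L2_Y \<Omega> T" by (rule Y.bochner_L2_diff[OF I yL grad_L2_Y[OF v]])
    have yae: "AE t in ?m. \<forall>z\<in>V. grad_adj \<Omega> (y t) z = F t z" using y by simp
    have "(LINT t|?m. (normV' (R t))\<^sup>2) \<le> (LINT t|?m. (L2_norm \<mu> (y t - grad (v t)))\<^sup>2)"
    proof (rule integral_mono_AE[OF bochner_L2_integrable[OF RL] bochner_L2_integrable[OF dL]])
      show "AE t in ?m. (normV' (R t))\<^sup>2 \<le> (L2_norm \<mu> (y t - grad (v t)))\<^sup>2"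
        using yae vV RV bochner_L2_AE_in[OF yL]
      proof eventually_elim
        case (elim t)
        have d: "grad (v t) - y t \<in> L2_space \<mu>" using elim by (intro L2_space_diff grad_L2)
        have "R t z = grad_adj \<Omega> (grad (v t) - y t) z" if "z \<in> V" for z
          using that elim by (simp add: R_def neg_laplace_def grad_adj_eq L2_inner_diff grad_L2)
        then have "normV' (R t) = normV' (grad_adj \<Omega> (grad (v t) - y t))" by (rule normV'_cong)
        also have "\<dots> \<le> L2_norm \<mu> (y t - grad (v t))"
          using grad_adj_V'(2)[OF d] L2_norm_minus_commute[of \<mu> "y t"] by simp
        finally show ?case using normV'_nonneg[of "R t"] elim by (intro power_mono)
      qed
    qed
    then show "ereal ?R \<le> ?val y" by (simp add: bochner_norm_power2 R_def)
  qed
  \<comment> \<open>The minimiser: subtracting the Riesz representative of the residual makes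
    \<open>y\<close> admissible, and on such representatives the dual norm equals the
    \<open>L^2\<close> norm.\<close>
  define y where "y t = grad (v t) - riesz (R t)" for t
  have yL: "y \<in> L2_Y \<Omega> T"
    unfolding y_def by (rule Y.bochner_L2_diff[OF I grad_L2_Y[OF v] riesz_L2_Y[OF RL]])
  have "AE t in ?m. \<forall>z\<in>V. grad_adj \<Omega> (y t) z = F t z"
    using vV RV
  proof eventually_elim
    case (elim t)
    show ?case
    proof
      fix z assume z: "z \<in> V"
      have "grad_adj \<Omega> (y t) z = neg_laplace \<Omega> (v t) z - grad_adj \<Omega> (riesz (R t)) z"
        unfolding y_def using L2_inner_diff[OF grad_L2[OF elim(1)] riesz(2)[OF elim(2)] grad_L2[OF z]]
        by (simp add: neg_laplace_def grad_adj_eq)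
      also have "grad_adj \<Omega> (riesz (R t)) z = R t z" by (rule riesz(3)[OF elim(2) z])
      finally show "grad_adj \<Omega> (y t) z = F t z" by (simp add: R_def)
    qed
  qed
  with yL have yS: "y \<in> ?S" by simp
  have val: "?val y = ereal ?R"
  proof -
    have dL: "(\<lambda>t. y t - grad (v t)) \<in> L2_Y \<Omega> T" by (rule Y.bochner_L2_diff[OF I yL grad_L2_Y[OF v]])
    have "(LINT t|?m. (L2_norm \<mu> (y t - grad (v t)))\<^sup>2) = (LINT t|?m. (normV' (R t))\<^sup>2)"
    proof (rule LINT_lebesgue_on_cong_AE[OF I borel_measurable_integrable[OF bochner_L2_integrable[OF dL]]])
      show "AE t in ?m. (L2_norm \<mu> (y t - grad (v t)))\<^sup>2 = (normV' (R t))\<^sup>2"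
        using RV
      proof eventually_elim
        case (elim t)
        have "y t - grad (v t) = 0 - riesz (R t)" by (simp add: y_def fun_eq_iff)
        then have "L2_norm \<mu> (y t - grad (v t)) = L2_norm \<mu> (riesz (R t) - 0)"
          using L2_norm_minus_commute[of \<mu> 0 "riesz (R t)"] by simp
        then show ?case using L2_norm_riesz[OF elim] by simp
      qed
    qed
    then show ?thesis by (simp add: bochner_norm_power2 R_def)
  qed
  show "(INF y \<in> ?S. ?val y) \<le> ereal ?R"
    unfolding val[symmetric] by (rule INF_lower[OF yS])
qed

end

theorem lemma5p1:
  fixes \<Omega> \<Gamma>D \<Gamma>N :: "'a::euclidean_space set"
    and T :: real
    and f :: "real \<Rightarrow> ('a \<Rightarrow> real) \<Rightarrow> real"
    and u0 :: "'a \<Rightarrow> real"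
    and u v :: "real \<Rightarrow> 'a \<Rightarrow> real"
  assumes "bounded_lipschitz_domain \<Omega>"
    and "openin (top_of_set (frontier \<Omega>)) \<Gamma>D"
    and "openin (top_of_set (frontier \<Omega>)) \<Gamma>N"
    and "\<Gamma>D \<inter> \<Gamma>N = {}"
    and "\<Gamma>D \<noteq> {}"
    and "closure \<Gamma>D \<union> closure \<Gamma>N = frontier \<Omega>"
    and "0 < T"
    and "f \<in> L2_Vdual \<Omega> \<Gamma>D T"
    and "u0 \<in> L2_space (lebesgue_on \<Omega>)"
    and "u \<in> W_space \<Omega> \<Gamma>D T"
    and "AE t in lebesgue_on {0<..<T}. \<forall>z\<in>W12_D \<Omega> \<Gamma>D.
           time_deriv \<Omega> \<Gamma>D T u t z + neg_laplace \<Omega> (u t) z = f t z"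
    and "AE x in lebesgue_on \<Omega>. value_at \<Omega> T u 0 x = u0 x"
    and "v \<in> W_space \<Omega> \<Gamma>D T"
    and "AE x in lebesgue_on \<Omega>. value_at \<Omega> T v 0 x = u0 x"
  shows "ereal (1/2 * (Q_norm \<Omega> T (\<lambda>t. wgrad \<Omega> (v t - u t)))\<^sup>2
             + 1/2 * (L2_Vdual_norm \<Omega> \<Gamma>D T (time_deriv \<Omega> \<Gamma>D T (v - u)))\<^sup>2
             + 1/2 * (L2_norm (lebesgue_on \<Omega>) (value_at \<Omega> T (v - u) T))\<^sup>2)
         = (INF y \<in> {y \<in> L2_Y \<Omega> T. AE t in lebesgue_on {0<..<T}. \<forall>z\<in>W12_D \<Omega> \<Gamma>D.
                       grad_adj \<Omega> (y t) z = f t z - time_deriv \<Omega> \<Gamma>D T v t z}.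
              ereal (1/2 * (Q_norm \<Omega> T (\<lambda>t. y t - wgrad \<Omega> (v t)))\<^sup>2))
       \<and> (INF y \<in> {y \<in> L2_Y \<Omega> T. AE t in lebesgue_on {0<..<T}. \<forall>z\<in>W12_D \<Omega> \<Gamma>D.
                       grad_adj \<Omega> (y t) z = f t z - time_deriv \<Omega> \<Gamma>D T v t z}.
              ereal (1/2 * (Q_norm \<Omega> T (\<lambda>t. y t - wgrad \<Omega> (v t)))\<^sup>2))
         = ereal (1/2 * (L2_Vdual_norm \<Omega> \<Gamma>D T
             (\<lambda>t z. time_deriv \<Omega> \<Gamma>D T v t z + neg_laplace \<Omega> (v t) z - f t z))\<^sup>2)"
proof -
  interpret evolution_triple \<Omega> \<Gamma>D
    by unfold_locales (use assms(1) in \<open>simp add: bounded_lipschitz_domain_def\<close>)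
  let ?I = "{0<..<T}"
  let ?m = "lebesgue_on ?I"
  note T = \<open>0 < T\<close>
  have I: "?I \<in> sets lebesgue" by auto
  have td: "has_time_deriv \<Omega> \<Gamma>D T w (time_deriv \<Omega> \<Gamma>D T w)" if "\<exists>g. has_time_deriv \<Omega> \<Gamma>D T w g" for w
    unfolding time_deriv_def using that by (rule someI_ex)
  define gv gu w gw where "gv = time_deriv \<Omega> \<Gamma>D T v" and "gu = time_deriv \<Omega> \<Gamma>D T u"
    and "w = v - u" and "gw = time_deriv \<Omega> \<Gamma>D T w"
  have v: "v \<in> L2_V \<Omega> \<Gamma>D T" "has_time_deriv \<Omega> \<Gamma>D T v gv" and u: "u \<in> L2_V \<Omega> \<Gamma>D T" "has_time_deriv \<Omega> \<Gamma>D T u gu"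
    using assms(10,13) td by (auto simp: W_space_def gv_def gu_def)
  have wt: "w t = v t - u t" for t by (simp add: w_def)
  have wL: "w \<in> L2_V \<Omega> \<Gamma>D T"
    using Vsp.bochner_L2_diff[OF I v(1) u(1)] by (simp add: w_def fun_diff_def)
  note wd' = has_time_deriv_diff[OF v u, folded w_def]
  have wd: "has_time_deriv \<Omega> \<Gamma>D T w gw" unfolding gw_def using wd' by (intro td) blast
  \<comment> \<open>The derivative chosen for \<open>w\<close> is unrelated to those chosen for
    \<open>v\<close> and \<open>u\<close>; uniqueness identifies it with their difference on
    \<open>V\<close>.\<close>
  have gw_eq: "AE t in ?m. \<forall>z\<in>V. gw t z = (gv t - gu t) z" by (rule has_time_deriv_unique[OF wd wd'])
  have vV: "AE t in ?m. v t \<in> V" and uV: "AE t in ?m. u t \<in> V" using bochner_L2_AE_in v u by auto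
  have gwL: "gw \<in> L2_Vdual \<Omega> \<Gamma>D T" and gvL: "gv \<in> L2_Vdual \<Omega> \<Gamma>D T"
    using wd v by (auto simp: has_time_deriv_def)
  have gwV: "AE t in ?m. gw t \<in> V'" by (rule bochner_L2_AE_in[OF gwL])
  define R where "R = (\<lambda>t z. gv t z + neg_laplace \<Omega> (v t) z - f t z)"
  \<comment> \<open>The datum of the flux constraint is \<open>f - gv\<close>, which casts the
    residual in the form used by \<open>least_flux_error\<close>.\<close>
  have R_eq: "R = (\<lambda>t. neg_laplace \<Omega> (v t) - (f t - gv t))" by (auto simp: R_def fun_eq_iff)
  have RL: "R \<in> L2_Vdual \<Omega> \<Gamma>D T"
    unfolding R_eq by (intro Vdu.bochner_L2_diff[OF I] neg_laplace_L2_Vdual v assms(8) gvL)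
  have inf: "(INF y \<in> {y \<in> L2_Y \<Omega> T. AE t in ?m. \<forall>z\<in>V. grad_adj \<Omega> (y t) z = f t z - gv t z}.
      ereal (1/2 * (Q_norm \<Omega> T (\<lambda>t. y t - grad (v t)))\<^sup>2)) = ereal (1/2 * (L2_Vdual_norm \<Omega> \<Gamma>D T R)\<^sup>2)"
    using least_flux_error[OF v(1) Vdu.bochner_L2_diff[OF I assms(8) gvL]] by (simp add: R_eq)
  have "AE t in ?m. (normV' (R t))\<^sup>2 = (normV' (gw t))\<^sup>2 + 2 * gw t (w t) + (normV (w t))\<^sup>2"
    using gw_eq vV uV gwV assms(11)
  proof eventually_elim
    case (elim t)
    have wV: "w t \<in> V" unfolding wt by (intro V_diff elim)
    have "R t z = gw t z + neg_laplace \<Omega> (w t) z" if z: "z \<in> V" for z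
    proof -
      have "gw t z = gv t z - gu t z" using elim(1) z by simp
      moreover have "neg_laplace \<Omega> (w t) z = neg_laplace \<Omega> (v t) z - neg_laplace \<Omega> (u t) z"
        unfolding wt by (rule neg_laplace_diff[OF elim(2,3) z])
      moreover have "gu t z + neg_laplace \<Omega> (u t) z = f t z" using elim(5) z by (simp add: gu_def)
      ultimately show ?thesis by (simp add: R_def)
    qed
    then have "normV' (R t) = normV' (\<lambda>z. gw t z + neg_laplace \<Omega> (w t) z)" by (rule normV'_cong)
    then show ?case using normV'_add_neg_laplace[OF elim(4) wV] by simp
  qed
  then have "(LINT t|?m. (normV' (R t))\<^sup>2) = (LINT t|?m. (normV' (gw t))\<^sup>2 + 2 * gw t (w t) + (normV (w t))\<^sup>2)"
    by (rule LINT_lebesgue_on_cong_AE[OF I borel_measurable_integrable[OF bochner_L2_integrable[OF RL]]])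
  also have "\<dots> = (LINT t|?m. (normV' (gw t))\<^sup>2) + 2 * (LINT t|?m. gw t (w t)) + (LINT t|?m. (normV (w t))\<^sup>2)"
    using bochner_L2_integrable[OF gwL] bochner_L2_integrable[OF wL] V'_pairing_integrable[OF gwL wL] by simp
  finally have 1: "(LINT t|?m. (normV' (R t))\<^sup>2)
      = (LINT t|?m. (normV' (gw t))\<^sup>2) + 2 * (LINT t|?m. gw t (w t)) + (LINT t|?m. (normV (w t))\<^sup>2)" .
  define W where "W = value_at \<Omega> T w"
  have Wc: "continuous_rep \<Omega> T w W" unfolding W_def by (rule continuous_rep_value_at[OF T wL wd])
  \<comment> \<open>The initial conditions concern the representatives chosen for \<open>v\<close>
    and \<open>u\<close>, whereas \<open>W\<close> is chosen for \<open>w\<close>. Uniqueness of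
    continuous representatives links them at time 0.\<close>
  have W0: "L2_norm \<mu> (W 0) = 0"
  proof -
    let ?X = "value_at \<Omega> T v" and ?Y = "value_at \<Omega> T u"
    have XY: "continuous_rep \<Omega> T w (\<lambda>t. ?X t - ?Y t)"
      unfolding w_def by (rule continuous_rep_diff[OF continuous_rep_value_at[OF T v] continuous_rep_value_at[OF T u]])
    have 0: "0 \<in> {0..T}" using T by simp
    then have L: "W 0 \<in> L2_space \<mu>" "?X 0 - ?Y 0 \<in> L2_space \<mu>" using Wc XY by (auto simp: continuous_rep_def)
    have "AE x in \<mu>. (?X 0 - ?Y 0) x = 0 x" using assms(12,14) by eventually_elim simp
    then have "L2_norm \<mu> (?X 0 - ?Y 0) = L2_norm \<mu> (0 :: 'a \<Rightarrow> real)"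
      using L by (intro L2_norm_cong_AE L2_space_measurable) (auto simp: zero_fun_def L2_space_zero)
    then have "L2_norm \<mu> (W 0) \<le> 0"
      using continuous_rep_unique[OF T Wc XY 0] L2_norm_le_diff[OF L] by (simp add: L2_norm_0)
    then show ?thesis using L2_norm_nonneg[of \<mu> "W 0"] by linarith
  qed
  have 2: "2 * (LINT t|?m. gw t (w t)) = (L2_norm \<mu> (W T))\<^sup>2"
    using energy_identity[OF T wL wd Wc] W0 by simp
  have 3: "(Q_norm \<Omega> T (\<lambda>t. grad (v t - u t)))\<^sup>2 = (LINT t|?m. (normV (w t))\<^sup>2)"
    by (simp add: bochner_norm_power2 wt V_norm_def)
  have "1/2 * (Q_norm \<Omega> T (\<lambda>t. grad (v t - u t)))\<^sup>2 + 1/2 * (L2_Vdual_norm \<Omega> \<Gamma>D T gw)\<^sup>2 + 1/2 * (L2_norm \<mu> (W T))\<^sup>2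
      = 1/2 * (L2_Vdual_norm \<Omega> \<Gamma>D T R)\<^sup>2"
    using 1 unfolding 2 3 unfolding bochner_norm_power2 by simp
  then show ?thesis using inf unfolding gw_def W_def w_def gv_def R_def by simp
qed

end
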